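(* Let $T=[T_1,\ldots,T_n]\in[B(\mathcal H)^n]_1^-$ be a row contraction. Then the following statements are equivalent: (i) the characteristic function $\Theta_T$ is a constant, i.e. $\Theta_T=\Theta_T(0)$; (ii) $\Gamma(T)\in\mathbb N_\infty\times\{0\}\times\mathbb N_\infty$; (iii) $T$ admits the canonical representation $$T_i=\begin{bmatrix}V_i&*\\0&W_i\end{bmatrix},\qquad i=1,\ldots,n,$$ with respect to $\mathcal H=\mathcal H_v\oplus\mathcal H_c$, where $V=[V_1,\ldots,V_n]\in[B(\mathcal H_v)^n]_1^-$ is a pure isometry and $W=[W_1,\ldots,W_n]\in[B(\mathcal H_c)^n]_1^-$ is a coisometry. If, in addition, $T$ is completely non-unitary, then $\Theta_T$ is constant if and only if $T$ has the representation in (iii) where $V$ is a pure isometry and $W$ is a completely non-unitary coisometry.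
   Context: $n\ge1$ is an integer, $\mathbb N=\{0,1,2,\ldots\}$, $\mathbb N_\infty=\mathbb N\cup\{\infty\}$; dimensions are regarded as elements of $\mathbb N_\infty$. Hilbert spaces are complex, subspaces are closed, direct sums are orthogonal, and summands may be $\{0\}$; $*$ denotes an unspecified entry. $\mathbb F_n^+$ is the unital free semigroup on $g_1,\ldots,g_n$ with identity $g_0$; $|g_0|=0$, $|g_{i_1}\cdots g_{i_k}|=k$; for $X=(X_1,\ldots,X_n)\in B(\mathcal H)^n$ put $X_{g_0}=I$ and $X_\alpha=X_{i_1}\cdots X_{i_k}$ if $\alpha=g_{i_1}\cdots g_{i_k}$. $[B(\mathcal H)^n]_1^-$ is the set of row contractions, i.e. $(X_1,\ldots,X_n)\in B(\mathcal H)^n$ with $\sum_iX_iX_i^*\le I$; an $n$-tuple is identified with the row operator $[X_1,\ldots,X_n]:\mathcal H^{(n)}\to\mathcal H$, where $\mathcal H^{(n)}$ is the direct sum of $n$ copies of $\mathcal H$. A row contraction $T$ is pure if $\lim_{k\to\infty}\sum_{|\alpha|=k}\|T_\alpha^*h\|^2=0$ for all $h\in\mathcal H$; it is an isometry if $T_i^*T_j=\delta_{ij}I$ for all $i,j$, a pure isometry if it is both, and a coisometry if $\sum_iT_iT_i^*=I$. $T$ is completely non-unitary (c.n.u.) if there is no nonzero subspace $\mathcal M\subseteq\mathcal H$ reducing for $T_1,\ldots,T_n$ such that $[T_1|_{\mathcal M},\ldots,T_n|_{\mathcal M}]$ is a unitary operator from $\mathcal M^{(n)}$ onto $\mathcal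 M$. Defect operators: $\Delta_T=(I-\sum_iT_iT_i^* )^{1/2}\in B(\mathcal H)$, $\Delta_{T^*}=(I-T^*T)^{1/2}\in B(\mathcal H^{(n)})$; defect spaces $\mathcal D_T=\overline{\Delta_T\mathcal H}$, $\mathcal D_{T^*}=\overline{\Delta_{T^*}\mathcal H^{(n)}}$. The characteristic function of $T$ is the function defined, for any Hilbert space $\mathcal G$ and $X\in B(\mathcal G)^n$ with $\|\sum_iX_iX_i^*\|<1$, by $$\Theta_T(X)=-I_{\mathcal G}\otimes(T|_{\mathcal D_{T^*}})+(I_{\mathcal G}\otimes\Delta_T)\Big(I-\sum_{i=1}^nX_i\otimes T_i^*\Big)^{-1}[X_1\otimes I_{\mathcal H},\ldots,X_n\otimes I_{\mathcal H}](I_{\mathcal G}\otimes\Delta_{T^*}|_{\mathcal D_{T^*}}).$$ It has a unique expansion $\Theta_T(X)=\sum_{k\ge0}\sum_{|\alpha|=k}X_\alpha\otimes A_{(\alpha)}$ with $A_{(\alpha)}\in B(\mathcal D_{T^*},\mathcal D_T)$. It is a noncommutative polynomial if only finitely many $A_{(\alpha)}$ are nonzero; its degree $\deg(\Theta_T)$ is then the largest $|\alpha|$ with $A_{(\alpha)}\ne0$, with the convention that constants (including zero) have degree $0$; $\deg(\Theta_T)=\infty$ if $\Theta_T$ is not a polynomial. $F^2(H_n)=\mathbb C1\oplus\bigoplus_{k\ge1}(\mathbb C^n)^{\otimes k}$ is the full Fock space with orthonormal basis $\{e_\alpha\}_{\alpha\in\mathbb F_n^+}$, $e_{g_0}=1$,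 $e_\alpha=e_{i_1}\otimes\cdots\otimes e_{i_k}$. The noncommutative Poisson kernel of $T$ is $K_T:\mathcal H\to F^2(H_n)\otimes\mathcal D_T$, $K_Th=\sum_{\alpha\in\mathbb F_n^+}e_\alpha\otimes\Delta_TT_\alpha^*h$. The map $\Gamma:[B(\mathcal H)^n]_1^-\to\mathbb N_\infty\times\mathbb N_\infty\times\mathbb N_\infty$ is $\Gamma(T)=(p,m,q)$ with $m=\deg(\Theta_T)$, $q=\dim\ker K_T$, and $p=\dim(\mathcal D_m\ominus\mathcal D_{m+1})$ if $m\in\mathbb N$, $p=\dim\overline{\Delta_T\mathcal H}$ if $m=\infty$, where $\mathcal D_k=\overline{\mathrm{span}}\{T_\beta\Delta_Th:h\in\mathcal H,|\beta|\ge k\}$. In (iii), "canonical" refers to the subspaces $\mathcal H_v=\overline{\mathrm{span}}\{T_\beta h:h\in\mathcal D_T,\beta\in\mathbb F_n^+\}$ and $\mathcal H_c=\{h\in\mathcal H:\sum_{|\alpha|=k}\|T_\alpha^*h\|^2=\|h\|^2\text{ for all }k\in\mathbb N\}$. *)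

theory Defs
  imports "HOL-Analysis.Analysis" "HOL-Library.Extended_Nat" "HOL-Library.Infinite_Typeclass"
begin

section \<open>Complex Hilbert spaces\<close>

text \<open>
  The library has real inner product spaces only. A complex Hilbert space is a complete
  \<^class>\<open>real_inner\<close> space with a compatible complex structure; the inner product \<open>cinner\<close> is linear
  in its first argument and its real part is the library's \<^const>\<open>inner\<close>, so that norm and topology
  are the usual ones.
\<close>

class complex_hilbert = real_inner + complete_space +
  fixes scaleC :: "complex \<Rightarrow> 'a \<Rightarrow> 'a"  (infixr \<open>*\<^sub>C\<close> 75)
    and cinner :: "'a \<Rightarrow> 'a \<Rightarrow> complex"
  assumes scaleC_add_right: "c *\<^sub>C (x + y) = c *\<^sub>C x + c *\<^sub>C y"
    and scaleC_add_left: "(c + d) *\<^sub>C x = c *\<^sub>C x + d *\<^sub>C x"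
    and scaleC_scaleC: "c *\<^sub>C d *\<^sub>C x = (c * d) *\<^sub>C x"
    and scaleR_scaleC: "r *\<^sub>R x = complex_of_real r *\<^sub>C x"
    and cinner_commute: "cinner x y = cnj (cinner y x)"
    and cinner_add_left: "cinner (x + y) z = cinner x z + cinner y z"
    and cinner_scaleC_left: "cinner (c *\<^sub>C x) y = c * cinner x y"
    and inner_eq_Re_cinner: "inner x y = Re (cinner x y)"
begin

subclass banach ..

end

lemma scaleC_one: "1 *\<^sub>C x = (x::'a::complex_hilbert)"
  using scaleR_scaleC[of 1 x] by simp

lemma cinner_add_right: "cinner x (y + z) = cinner x y + cinner x z"
  by (metis cinner_add_left cinner_commute complex_cnj_add)

lemma cinner_scaleC_right: "cinner x (c *\<^sub>C y) = cnj c * cinner x y"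
  by (metis cinner_scaleC_left cinner_commute complex_cnj_mult)

lemma cinner_self: "cinner x x = complex_of_real ((norm x)\<^sup>2)"
proof -
  have "Im (cinner x x) = 0"
    using cinner_commute[of x x] by (simp add: complex_eq_iff)
  moreover have "Re (cinner x x) = (norm x)\<^sup>2"
    by (simp add: inner_eq_Re_cinner[symmetric] power2_norm_eq_inner)
  ultimately show ?thesis
    by (simp add: complex_eq_iff)
qed

lemma norm_scaleC: "norm (c *\<^sub>C x) = cmod c * norm x"
proof -
  have "complex_of_real ((norm (c *\<^sub>C x))\<^sup>2) = c * cnj c * cinner x x"
    unfolding cinner_self[symmetric] by (simp add: cinner_scaleC_left cinner_scaleC_right)
  also have "\<dots> = complex_of_real ((cmod c * norm x)\<^sup>2)"
    by (simp only: cinner_self complex_norm_square[symmetric] of_real_mult of_real_power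
        power_mult_distrib)
  finally have "(norm (c *\<^sub>C x))\<^sup>2 = (cmod c * norm x)\<^sup>2"
    using of_real_eq_iff by blast
  then show ?thesis
    by (simp add: power2_eq_iff_nonneg)
qed

lemma cmod_cinner_le: "cmod (cinner x y) \<le> (norm x)\<^sup>2 + (norm y)\<^sup>2"
proof -
  have ni: "\<bar>inner u v\<bar> \<le> ((norm u)\<^sup>2 + (norm v)\<^sup>2) / 2" for u v
  proof -
    have "\<bar>inner u v\<bar> \<le> norm u * norm v"
      by (rule Cauchy_Schwarz_ineq2)
    also have "\<dots> \<le> ((norm u)\<^sup>2 + (norm v)\<^sup>2) / 2"
      using sum_squares_bound[of "norm u" "norm v"] by simp
    finally show ?thesis .
  qed
  have "Im (cinner x y) = inner x (\<i> *\<^sub>C y)"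
    by (simp add: inner_eq_Re_cinner cinner_scaleC_right)
  then have "\<bar>Im (cinner x y)\<bar> \<le> ((norm x)\<^sup>2 + (norm y)\<^sup>2) / 2"
    using ni[of x "\<i> *\<^sub>C y"] by (simp add: norm_scaleC)
  moreover have "\<bar>Re (cinner x y)\<bar> \<le> ((norm x)\<^sup>2 + (norm y)\<^sup>2) / 2"
    using ni[of x y] by (simp add: inner_eq_Re_cinner)
  ultimately show ?thesis
    using cmod_le[of "cinner x y"] by argo
qed

global_interpretation complex_vector: vector_space "scaleC :: complex \<Rightarrow> 'a \<Rightarrow> 'a::complex_hilbert"
  defines csubspace = complex_vector.subspace
    and cspan = complex_vector.span
  by unfold_locales (simp_all add: scaleC_add_right scaleC_add_left scaleC_scaleC scaleC_one)

instantiation complex :: complex_hilbert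
begin

definition scaleC_complex :: "complex \<Rightarrow> complex \<Rightarrow> complex"
  where "scaleC_complex c x = c * x"

definition cinner_complex :: "complex \<Rightarrow> complex \<Rightarrow> complex"
  where "cinner_complex x y = x * cnj y"

instance
  by standard
    (simp_all add: scaleC_complex_def cinner_complex_def algebra_simps scaleR_conv_of_real
      inner_complex_def)

end

text \<open>\<open>\<H>\<^sup>(\<^sup>n\<^sup>)\<close> is \<open>'h ^ 'n\<close>, the generators of the free semigroup being indexed by \<open>'n\<close>.\<close>

instantiation vec :: (complex_hilbert, finite) complex_hilbert
begin

definition scaleC_vec :: "complex \<Rightarrow> 'a ^ 'b \<Rightarrow> 'a ^ 'b"
  where "scaleC_vec c x = (\<chi> i. c *\<^sub>C x $ i)"

definition cinner_vec :: "'a ^ 'b \<Rightarrow> 'a ^ 'b \<Rightarrow> complex"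
  where "cinner_vec x y = (\<Sum>i\<in>UNIV. cinner (x $ i) (y $ i))"

instance
proof
  fix x y z :: "'a ^ 'b" and c d :: complex and r :: real
  show "cinner x y = cnj (cinner y x)"
    unfolding cinner_vec_def cnj_sum by (rule sum.cong[OF refl]) (rule cinner_commute)
qed (simp_all add: scaleC_vec_def cinner_vec_def vec_eq_iff scaleC_add_right scaleC_add_left
    scaleC_scaleC scaleR_scaleC cinner_add_left cinner_scaleC_left sum.distrib sum_distrib_left
    inner_vec_def inner_eq_Re_cinner)

end

subsection \<open>Square-summable families and tensor products\<close>

text \<open>
  \<open>('i, 'a) ell2\<close> is the orthogonal direct sum of copies of \<open>'a\<close> indexed by \<open>'i\<close>. It serves as the
  Hilbert space tensor product of \<open>('i, complex) ell2\<close> with \<open>'a\<close>.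
\<close>

typedef (overloaded) ('i, 'a::complex_hilbert) ell2 =
  "{f :: 'i \<Rightarrow> 'a. (\<lambda>i. (norm (f i))\<^sup>2) summable_on UNIV}"
  by (rule exI[of _ "\<lambda>_. 0"]) simp

setup_lifting type_definition_ell2

lemma ell2_add_summable:
  fixes f g :: "'i \<Rightarrow> 'a::complex_hilbert"
  assumes "(\<lambda>i. (norm (f i))\<^sup>2) summable_on UNIV" "(\<lambda>i. (norm (g i))\<^sup>2) summable_on UNIV"
  shows "(\<lambda>i. (norm (f i + g i))\<^sup>2) summable_on UNIV"
proof (rule summable_on_comparison_test)
  show "(\<lambda>i. 2 * (norm (f i))\<^sup>2 + 2 * (norm (g i))\<^sup>2) summable_on UNIV"
    by (intro summable_on_add summable_on_cmult_right assms)
  show "(norm (f i + g i))\<^sup>2 \<le> 2 * (norm (f i))\<^sup>2 + 2 * (norm (g i))\<^sup>2" for i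
  proof -
    have "(norm (f i + g i))\<^sup>2 \<le> (norm (f i) + norm (g i))\<^sup>2"
      by (intro power_mono norm_triangle_ineq) simp
    also have "\<dots> \<le> 2 * (norm (f i))\<^sup>2 + 2 * (norm (g i))\<^sup>2"
      using sum_squares_bound[of "norm (f i)" "norm (g i)"] by (simp add: power2_sum)
    finally show ?thesis .
  qed
qed simp

lemma ell2_scaleC_summable:
  fixes f :: "'i \<Rightarrow> 'a::complex_hilbert"
  assumes "(\<lambda>i. (norm (f i))\<^sup>2) summable_on UNIV"
  shows "(\<lambda>i. (norm (c *\<^sub>C f i))\<^sup>2) summable_on UNIV"
  unfolding norm_scaleC power_mult_distrib by (intro summable_on_cmult_right assms)

lemma ell2_cinner_summable:
  fixes f g :: "'i \<Rightarrow> 'a::complex_hilbert"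
  assumes "(\<lambda>i. (norm (f i))\<^sup>2) summable_on UNIV" "(\<lambda>i. (norm (g i))\<^sup>2) summable_on UNIV"
  shows "(\<lambda>i. cinner (f i) (g i)) summable_on UNIV"
proof (rule abs_summable_summable[OF Infinite_Sum.abs_summable_on_comparison_test'])
  show "(\<lambda>i. (norm (f i))\<^sup>2 + (norm (g i))\<^sup>2) summable_on UNIV"
    by (intro summable_on_add assms)
qed (rule cmod_cinner_le)

lemma ell2_inner_summable:
  fixes f g :: "'i \<Rightarrow> 'a::complex_hilbert"
  assumes "(\<lambda>i. (norm (f i))\<^sup>2) summable_on UNIV" "(\<lambda>i. (norm (g i))\<^sup>2) summable_on UNIV"
  shows "(\<lambda>i. inner (f i) (g i)) summable_on UNIV"
  unfolding inner_eq_Re_cinner by (intro summable_on_Re ell2_cinner_summable assms)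

instantiation ell2 :: (type, complex_hilbert) real_inner
begin

lift_definition zero_ell2 :: "('a, 'b) ell2" is "\<lambda>_. 0" by simp

lift_definition plus_ell2 :: "('a, 'b) ell2 \<Rightarrow> ('a, 'b) ell2 \<Rightarrow> ('a, 'b) ell2"
  is "\<lambda>f g i. f i + g i" by (rule ell2_add_summable)

lift_definition uminus_ell2 :: "('a, 'b) ell2 \<Rightarrow> ('a, 'b) ell2"
  is "\<lambda>f i. - f i" by simp

lift_definition minus_ell2 :: "('a, 'b) ell2 \<Rightarrow> ('a, 'b) ell2 \<Rightarrow> ('a, 'b) ell2"
  is "\<lambda>f g i. f i - g i"
  subgoal for f g using ell2_add_summable[of f "\<lambda>i. - g i"] by simp
  done

lift_definition scaleR_ell2 :: "real \<Rightarrow> ('a, 'b) ell2 \<Rightarrow> ('a, 'b) ell2"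
  is "\<lambda>r f i. r *\<^sub>R f i" unfolding scaleR_scaleC by (rule ell2_scaleC_summable)

lift_definition inner_ell2 :: "('a, 'b) ell2 \<Rightarrow> ('a, 'b) ell2 \<Rightarrow> real"
  is "\<lambda>f g. \<Sum>\<^sub>\<infinity>i. inner (f i) (g i)" .

definition norm_ell2 :: "('a, 'b) ell2 \<Rightarrow> real"
  where "norm_ell2 x = sqrt (inner x x)"

definition dist_ell2 :: "('a, 'b) ell2 \<Rightarrow> ('a, 'b) ell2 \<Rightarrow> real"
  where "dist_ell2 x y = norm (x - y)"

definition sgn_ell2 :: "('a, 'b) ell2 \<Rightarrow> ('a, 'b) ell2"
  where "sgn_ell2 x = scaleR (inverse (norm x)) x"

definition uniformity_ell2 :: "(('a, 'b) ell2 \<times> ('a, 'b) ell2) filter"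
  where "uniformity_ell2 = (INF e\<in>{0 <..}. principal {(x, y). dist x y < e})"

definition open_ell2 :: "('a, 'b) ell2 set \<Rightarrow> bool"
  where "open_ell2 U = (\<forall>x\<in>U. eventually (\<lambda>(x', y). x' = x \<longrightarrow> y \<in> U) uniformity)"

instance
proof
  fix x y z :: "('a, 'b) ell2" and r s :: real
  show "x + y + z = x + (y + z)" "x + y = y + x" "0 + x = x" "- x + x = 0" "x - y = x + - y"
    by (transfer; simp add: algebra_simps)+
  show "r *\<^sub>R (x + y) = r *\<^sub>R x + r *\<^sub>R y" "(r + s) *\<^sub>R x = r *\<^sub>R x + s *\<^sub>R x"
    "r *\<^sub>R s *\<^sub>R x = (r * s) *\<^sub>R x" "1 *\<^sub>R x = x"
    by (transfer; simp add: scaleR_add_right scaleR_add_left)+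
  show "dist x y = norm (x - y)" "sgn x = scaleR (inverse (norm x)) x" "norm x = sqrt (inner x x)"
    by (simp_all add: dist_ell2_def sgn_ell2_def norm_ell2_def)
  show "uniformity = (INF e\<in>{0 <..}. principal {(x, y :: ('a, 'b) ell2). dist x y < e})"
    by (rule uniformity_ell2_def)
  show "open U \<longleftrightarrow> (\<forall>x\<in>U. \<forall>\<^sub>F (x', y) in uniformity. x' = x \<longrightarrow> y \<in> U)"
    for U :: "('a, 'b) ell2 set"
    by (rule open_ell2_def)
  show "inner x y = inner y x"
    by transfer (simp add: inner_commute)
  show "inner (x + y) z = inner x z + inner y z"
    by transfer (simp add: inner_add_left infsum_add ell2_inner_summable)
  show "inner (r *\<^sub>R x) y = r * inner x y"
    by transfer (simp add: infsum_cmult_right')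
  show "0 \<le> inner x x"
    by transfer (simp add: infsum_nonneg)
  show "inner x x = 0 \<longleftrightarrow> x = 0"
  proof transfer
    fix f :: "'a \<Rightarrow> 'b"
    assume s: "(\<lambda>i. (norm (f i))\<^sup>2) summable_on UNIV"
    show "(\<Sum>\<^sub>\<infinity>i. inner (f i) (f i)) = 0 \<longleftrightarrow> f = (\<lambda>_. 0)"
    proof
      assume 0: "(\<Sum>\<^sub>\<infinity>i. inner (f i) (f i)) = 0"
      have "(norm (f i))\<^sup>2 = 0" for i
        using finite_sum_le_infsum[OF s, of "{i}"] 0 by (simp add: power2_norm_eq_inner[symmetric])
      then show "f = (\<lambda>_. 0)" by auto
    qed simp
  qed
qed

end

lemma ell2_norm_power2:
  fixes x :: "('a, 'b::complex_hilbert) ell2"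
  shows "(norm x)\<^sup>2 = (\<Sum>\<^sub>\<infinity>i. (norm (Rep_ell2 x i))\<^sup>2)"
  unfolding power2_norm_eq_inner by transfer (rule refl)

lemma ell2_sum_le_norm:
  fixes x :: "('a, 'b::complex_hilbert) ell2"
  assumes "finite F"
  shows "(\<Sum>i\<in>F. (norm (Rep_ell2 x i))\<^sup>2) \<le> (norm x)\<^sup>2"
  unfolding ell2_norm_power2
  using Rep_ell2[of x] by (intro finite_sum_le_infsum) (auto simp: assms)

lemma ell2_norm_component:
  fixes x :: "('a, 'b::complex_hilbert) ell2"
  shows "norm (Rep_ell2 x i) \<le> norm x"
  using ell2_sum_le_norm[of "{i}" x] by (simp add: abs_le_square_iff[symmetric])

instance ell2 :: (type, complex_hilbert) complete_space
proof
  fix X :: "nat \<Rightarrow> ('a, 'b) ell2"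
  assume X: "Cauchy X"
  have rep_diff: "Rep_ell2 (X m - X n) i = Rep_ell2 (X m) i - Rep_ell2 (X n) i" for m n i
    by transfer simp
  have "Cauchy (\<lambda>n. Rep_ell2 (X n) i)" for i
  proof (rule metric_CauchyI)
    fix e :: real
    assume "e > 0"
    then obtain M where "\<forall>m\<ge>M. \<forall>n\<ge>M. dist (X m) (X n) < e"
      using X unfolding Cauchy_def by blast
    then show "\<exists>M. \<forall>m\<ge>M. \<forall>n\<ge>M. dist (Rep_ell2 (X m) i) (Rep_ell2 (X n) i) < e"
      by (metis dist_norm ell2_norm_component le_less_trans rep_diff)
  qed
  then have "\<exists>l. (\<lambda>n. Rep_ell2 (X n) i) \<longlonglongrightarrow> l" for i
    using Cauchy_convergent convergent_def by blast
  then obtain g where g: "(\<lambda>n. Rep_ell2 (X n) i) \<longlonglongrightarrow> g i" for i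
    by metis
  have bound: "(\<Sum>i\<in>F. (norm (g i - Rep_ell2 (X n) i))\<^sup>2) \<le> e\<^sup>2"
    if M: "\<forall>m\<ge>M. \<forall>n\<ge>M. dist (X m) (X n) < e" and n: "n \<ge> M" and F: "finite F" for e M n F
  proof (rule LIMSEQ_le_const2)
    show "(\<lambda>m. \<Sum>i\<in>F. (norm (Rep_ell2 (X m) i - Rep_ell2 (X n) i))\<^sup>2)
        \<longlonglongrightarrow> (\<Sum>i\<in>F. (norm (g i - Rep_ell2 (X n) i))\<^sup>2)"
      by (intro tendsto_intros g)
    show "\<exists>N. \<forall>m\<ge>N. (\<Sum>i\<in>F. (norm (Rep_ell2 (X m) i - Rep_ell2 (X n) i))\<^sup>2) \<le> e\<^sup>2"
    proof (intro exI[of _ M] allI impI)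
      fix m assume "m \<ge> M"
      then have le: "norm (X m - X n) \<le> e"
        using M n by (metis dist_norm less_imp_le)
      have "(\<Sum>i\<in>F. (norm (Rep_ell2 (X m) i - Rep_ell2 (X n) i))\<^sup>2) \<le> (norm (X m - X n))\<^sup>2"
        using ell2_sum_le_norm[OF F, of "X m - X n"] by (simp add: rep_diff)
      also have "\<dots> \<le> e\<^sup>2"
        using le by (simp add: power_mono)
      finally show "(\<Sum>i\<in>F. (norm (Rep_ell2 (X m) i - Rep_ell2 (X n) i))\<^sup>2) \<le> e\<^sup>2" .
    qed
  qed
  have summ: "(\<lambda>i. (norm (g i - Rep_ell2 (X n) i))\<^sup>2) summable_on UNIV"
    if "\<forall>m\<ge>M. \<forall>n\<ge>M. dist (X m) (X n) < e" "n \<ge> M" for e M n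
    by (rule nonneg_bounded_partial_sums_imp_summable_on[where C = "e\<^sup>2"])
      (auto intro!: eventually_finite_subsets_at_top_weakI bound[OF that])
  obtain M1 where M1: "\<forall>m\<ge>M1. \<forall>n\<ge>M1. dist (X m) (X n) < 1"
    using X unfolding Cauchy_def by (meson zero_less_one)
  have "(\<lambda>i. (norm (g i - Rep_ell2 (X M1) i + Rep_ell2 (X M1) i))\<^sup>2) summable_on UNIV"
    by (rule ell2_add_summable[OF summ[OF M1]]) (use Rep_ell2[of "X M1"] in auto)
  then have g_l2: "(\<lambda>i. (norm (g i))\<^sup>2) summable_on UNIV"
    by simp
  define L where "L = Abs_ell2 g"
  have L: "Rep_ell2 L = g"
    unfolding L_def using g_l2 by (simp add: Abs_ell2_inverse)
  have "X \<longlonglongrightarrow> L"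
  proof (rule metric_LIMSEQ_I)
    fix e :: real
    assume e: "e > 0"
    then obtain M where M: "\<forall>m\<ge>M. \<forall>n\<ge>M. dist (X m) (X n) < e / 2"
      using X unfolding Cauchy_def by (meson half_gt_zero)
    have "dist (X n) L < e" if n: "n \<ge> M" for n
    proof -
      have "(norm (L - X n))\<^sup>2 = (\<Sum>\<^sub>\<infinity>i. (norm (g i - Rep_ell2 (X n) i))\<^sup>2)"
        unfolding ell2_norm_power2 L[symmetric] by (simp add: minus_ell2.rep_eq)
      also have "\<dots> \<le> (e / 2)\<^sup>2"
        by (rule infsum_le_finite_sums[OF summ[OF M n]]) (rule bound[OF M n])
      finally have "norm (L - X n) \<le> e / 2"
        using e by (simp add: abs_le_square_iff[symmetric])
      then show ?thesis
        using e by (simp add: dist_norm norm_minus_commute)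
    qed
    then show "\<exists>no. \<forall>n\<ge>no. dist (X n) L < e"
      by blast
  qed
  then show "convergent X"
    unfolding convergent_def by blast
qed

instantiation ell2 :: (type, complex_hilbert) complex_hilbert
begin

lift_definition scaleC_ell2 :: "complex \<Rightarrow> ('a, 'b) ell2 \<Rightarrow> ('a, 'b) ell2"
  is "\<lambda>c f i. c *\<^sub>C f i" by (rule ell2_scaleC_summable)

lift_definition cinner_ell2 :: "('a, 'b) ell2 \<Rightarrow> ('a, 'b) ell2 \<Rightarrow> complex"
  is "\<lambda>f g. \<Sum>\<^sub>\<infinity>i. cinner (f i) (g i)" .

instance
proof
  fix x y z :: "('a, 'b) ell2" and c d :: complex and r :: real
  show "c *\<^sub>C (x + y) = c *\<^sub>C x + c *\<^sub>C y" "(c + d) *\<^sub>C x = c *\<^sub>C x + d *\<^sub>C x"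
    "c *\<^sub>C d *\<^sub>C x = (c * d) *\<^sub>C x" "r *\<^sub>R x = complex_of_real r *\<^sub>C x"
    by (transfer; simp add: scaleC_add_right scaleC_add_left scaleC_scaleC scaleR_scaleC)+
  show "cinner (x + y) z = cinner x z + cinner y z"
    by transfer (simp add: cinner_add_left infsum_add ell2_cinner_summable)
  show "cinner (c *\<^sub>C x) y = c * cinner x y"
    by transfer (simp add: cinner_scaleC_left infsum_cmult_right')
  show "cinner x y = cnj (cinner y x)"
    by transfer (simp only: infsum_cnj[symmetric] cinner_commute[symmetric])
  show "inner x y = Re (cinner x y)"
    by transfer (simp add: inner_eq_Re_cinner infsum_Re ell2_cinner_summable)
qed

end

lift_definition tensor ::
  "('i, complex) ell2 \<Rightarrow> 'a::complex_hilbert \<Rightarrow> ('i, 'a) ell2"  (infixr \<open>\<otimes>\<^sub>h\<close> 70)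
  is "\<lambda>g x i. g i *\<^sub>C x"
  unfolding norm_scaleC power_mult_distrib by (intro summable_on_cmult_left)

lemma cinner_tensor: "cinner (g \<otimes>\<^sub>h x) (g' \<otimes>\<^sub>h x') = cinner g g' * cinner x x'"
  by transfer (simp add: cinner_scaleC_left cinner_scaleC_right cinner_complex_def
      infsum_cmult_right'[symmetric] ac_simps)

lift_definition ket :: "'i \<Rightarrow> ('i, complex) ell2"
  is "\<lambda>i j. if j = i then 1 else 0"
  subgoal for i
    by (rule summable_on_cong_neutral[where S = "{i}" and T = UNIV, THEN iffD1,
          of _ "\<lambda>j. (norm (if j = i then 1 else 0 :: complex))\<^sup>2"]) auto
  done

subsection \<open>Subspaces and bounded operators\<close>

definition closed_csubspace :: "'a::complex_hilbert set \<Rightarrow> bool"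
  where "closed_csubspace M \<longleftrightarrow> csubspace M \<and> closed M"

definition ortho :: "'a::complex_hilbert set \<Rightarrow> 'a set"
  where "ortho M = {x. \<forall>y\<in>M. cinner x y = 0}"

text \<open>
  Hilbert spaces that occur as closed subspaces of an ambient space are represented by these
  subspaces. Accordingly an operator \<open>\<M> \<rightarrow> \<N>\<close> between closed subspaces is represented by its extension
  by zero on the orthogonal complement of \<open>\<M>\<close>; this extension respects products, sums, adjoints and
  norms, and the identity of \<open>\<M>\<close> is represented by the orthogonal projection onto \<open>\<M>\<close>.
\<close>

definition bop :: "'a::complex_hilbert set \<Rightarrow> 'b::complex_hilbert set \<Rightarrow> ('a \<Rightarrow>\<^sub>L 'b) set"
  where "bop M N = {A :: 'a \<Rightarrow>\<^sub>L 'b. (\<forall>c x. A (c *\<^sub>C x) = c *\<^sub>C A x) \<and> (\<forall>x. A x \<in> N) \<and> (\<forall>x\<in>ortho M. A x = 0)}"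

definition oproj :: "'a::complex_hilbert set \<Rightarrow> 'a \<Rightarrow>\<^sub>L 'a"
  where "oproj M = (THE P :: 'a \<Rightarrow>\<^sub>L 'a. \<forall>x. P x \<in> M \<and> x - P x \<in> ortho M)"

definition adj :: "('a::complex_hilbert \<Rightarrow>\<^sub>L 'b::complex_hilbert) \<Rightarrow> 'b \<Rightarrow>\<^sub>L 'a"
  where "adj A = (THE B :: 'b \<Rightarrow>\<^sub>L 'a. \<forall>x y. cinner (A x) y = cinner x (B y))"

definition positive_on :: "'a::complex_hilbert set \<Rightarrow> ('a \<Rightarrow>\<^sub>L 'a) \<Rightarrow> bool"
  where "positive_on M A \<longleftrightarrow> A \<in> bop M M \<and> (\<forall>h\<in>M. cinner (A h) h \<in> \<real>\<^sub>\<ge>\<^sub>0)"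

definition sqrt_op :: "('a::complex_hilbert \<Rightarrow>\<^sub>L 'a) \<Rightarrow> 'a \<Rightarrow>\<^sub>L 'a"
  where "sqrt_op A = (THE S. positive_on UNIV S \<and> S o\<^sub>L S = A)"

definition inv_on :: "'a::complex_hilbert set \<Rightarrow> ('a \<Rightarrow>\<^sub>L 'a) \<Rightarrow> 'a \<Rightarrow>\<^sub>L 'a"
  where "inv_on M A = (THE R. R \<in> bop M M \<and> R o\<^sub>L A = oproj M \<and> A o\<^sub>L R = oproj M)"

definition unitary_between ::
  "('a::complex_hilbert \<Rightarrow>\<^sub>L 'b::complex_hilbert) \<Rightarrow> 'a set \<Rightarrow> 'b set \<Rightarrow> bool"
  where "unitary_between A M N \<longleftrightarrow>
    bij_betw A M N \<and> (\<forall>x\<in>M. \<forall>y\<in>M. cinner (A x) (A y) = cinner x y)"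

definition tensor_op ::
  "(('i, complex) ell2 \<Rightarrow>\<^sub>L ('i, complex) ell2) \<Rightarrow> ('a::complex_hilbert \<Rightarrow>\<^sub>L 'b::complex_hilbert) \<Rightarrow>
    ('i, 'a) ell2 \<Rightarrow>\<^sub>L ('i, 'b) ell2"  (infixr \<open>\<otimes>\<^sub>o\<close> 70)
  where "X \<otimes>\<^sub>o A = (THE R :: ('i, 'a) ell2 \<Rightarrow>\<^sub>L ('i, 'b) ell2. \<forall>g x. R (g \<otimes>\<^sub>h x) = X g \<otimes>\<^sub>h A x)"

definition tensor_space ::
  "('i, complex) ell2 set \<Rightarrow> 'a::complex_hilbert set \<Rightarrow> ('i, 'a) ell2 set"
  where "tensor_space G M = closure (cspan {g \<otimes>\<^sub>h x |g x. g \<in> G \<and> x \<in> M})"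

definition is_onb :: "'a::complex_hilbert set \<Rightarrow> 'a set \<Rightarrow> bool"
  where "is_onb B M \<longleftrightarrow> B \<subseteq> M \<and> (\<forall>x\<in>B. \<forall>y\<in>B. cinner x y = (if x = y then 1 else 0)) \<and>
    closure (cspan B) = M"

definition hdim :: "'a::complex_hilbert set \<Rightarrow> enat"
  where "hdim M = (THE d. \<exists>B. is_onb B M \<and> d = (if finite B then enat (card B) else \<infinity>))"

section \<open>Row contractions\<close>

text \<open>
  An \<open>n\<close>-tuple is a function on \<open>'n\<close>, and a word in the free semigroup is a list over \<open>'n\<close> whose head
  is the leftmost letter. The predicates with suffix \<open>_on\<close> concern tuples of operators on the Hilbert
  space \<open>M\<close>, a closed subspace of the ambient space.
\<close>

definition word_op :: "'a::complex_hilbert set \<Rightarrow> ('n \<Rightarrow> 'a \<Rightarrow>\<^sub>L 'a) \<Rightarrow> 'n list \<Rightarrow> 'a \<Rightarrow>\<^sub>L 'a"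
  where "word_op M X \<alpha> = foldr (\<lambda>i A. X i o\<^sub>L A) \<alpha> (oproj M)"

lift_definition vec_coord :: "'n::finite \<Rightarrow> ('a::complex_hilbert ^ 'n) \<Rightarrow>\<^sub>L 'a"
  is "\<lambda>i x. x $ i" by (rule bounded_linear_vec_nth)

definition row_op :: "('n::finite \<Rightarrow> 'a::complex_hilbert \<Rightarrow>\<^sub>L 'a) \<Rightarrow> ('a ^ 'n) \<Rightarrow>\<^sub>L 'a"
  where "row_op X = (\<Sum>i\<in>UNIV. X i o\<^sub>L vec_coord i)"

definition row_contraction_on ::
  "'a::complex_hilbert set \<Rightarrow> ('n::finite \<Rightarrow> 'a \<Rightarrow>\<^sub>L 'a) \<Rightarrow> bool"
  where "row_contraction_on M X \<longleftrightarrow>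
    (\<forall>i. X i \<in> bop M M) \<and> positive_on M (oproj M - (\<Sum>i\<in>UNIV. X i o\<^sub>L adj (X i)))"

abbreviation row_contraction :: "('n::finite \<Rightarrow> 'a::complex_hilbert \<Rightarrow>\<^sub>L 'a) \<Rightarrow> bool"
  where "row_contraction \<equiv> row_contraction_on UNIV"

definition strict_row_contraction_on ::
  "'a::complex_hilbert set \<Rightarrow> ('n::finite \<Rightarrow> 'a \<Rightarrow>\<^sub>L 'a) \<Rightarrow> bool"
  where "strict_row_contraction_on M X \<longleftrightarrow>
    (\<forall>i. X i \<in> bop M M) \<and> norm (\<Sum>i\<in>UNIV. X i o\<^sub>L adj (X i)) < 1"

definition pure_on :: "'a::complex_hilbert set \<Rightarrow> ('n::finite \<Rightarrow> 'a \<Rightarrow>\<^sub>L 'a) \<Rightarrow> bool"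
  where "pure_on M X \<longleftrightarrow>
    (\<forall>h\<in>M. (\<lambda>k. \<Sum>\<alpha> | length \<alpha> = k. (norm (adj (word_op M X \<alpha>) h))\<^sup>2) \<longlonglongrightarrow> 0)"

definition isometry_on :: "'a::complex_hilbert set \<Rightarrow> ('n::finite \<Rightarrow> 'a \<Rightarrow>\<^sub>L 'a) \<Rightarrow> bool"
  where "isometry_on M X \<longleftrightarrow> (\<forall>i j. adj (X i) o\<^sub>L X j = (if i = j then oproj M else 0))"

definition coisometry_on :: "'a::complex_hilbert set \<Rightarrow> ('n::finite \<Rightarrow> 'a \<Rightarrow>\<^sub>L 'a) \<Rightarrow> bool"
  where "coisometry_on M X \<longleftrightarrow> (\<Sum>i\<in>UNIV. X i o\<^sub>L adj (X i)) = oproj M"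

definition reducing :: "('n \<Rightarrow> 'a::complex_hilbert \<Rightarrow>\<^sub>L 'a) \<Rightarrow> 'a set \<Rightarrow> bool"
  where "reducing X M \<longleftrightarrow> closed_csubspace M \<and> (\<forall>i. \<forall>x\<in>M. X i x \<in> M \<and> adj (X i) x \<in> M)"

definition cnu_on :: "'a::complex_hilbert set \<Rightarrow> ('n::finite \<Rightarrow> 'a \<Rightarrow>\<^sub>L 'a) \<Rightarrow> bool"
  where "cnu_on M X \<longleftrightarrow>
    \<not> (\<exists>L. L \<subseteq> M \<and> L \<noteq> {0} \<and> reducing X L \<and> unitary_between (row_op X) {x. \<forall>i. x $ i \<in> L} L)"

subsection \<open>Defect operators and the characteristic function\<close>

definition defect :: "('n::finite \<Rightarrow> 'h::complex_hilbert \<Rightarrow>\<^sub>L 'h) \<Rightarrow> 'h \<Rightarrow>\<^sub>L 'h"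
  where "defect T = sqrt_op (id_blinfun - (\<Sum>i\<in>UNIV. T i o\<^sub>L adj (T i)))"

definition defect_star :: "('n::finite \<Rightarrow> 'h::complex_hilbert \<Rightarrow>\<^sub>L 'h) \<Rightarrow> ('h ^ 'n) \<Rightarrow>\<^sub>L ('h ^ 'n)"
  where "defect_star T = sqrt_op (id_blinfun - (adj (row_op T) o\<^sub>L row_op T))"

definition defect_space :: "('n::finite \<Rightarrow> 'h::complex_hilbert \<Rightarrow>\<^sub>L 'h) \<Rightarrow> 'h set"
  where "defect_space T = closure (range (defect T))"

definition defect_star_space :: "('n::finite \<Rightarrow> 'h::complex_hilbert \<Rightarrow>\<^sub>L 'h) \<Rightarrow> ('h ^ 'n) set"
  where "defect_star_space T = closure (range (defect_star T))"

text \<open>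
  A Hilbert space \<open>G\<close> at which the characteristic function is evaluated is a closed subspace of
  \<open>('s, complex) ell2\<close>, and \<open>X i \<in> bop G G\<close>. In the formula, the identity of \<open>G\<close> is \<open>oproj G\<close>, the
  restrictions to \<^const>\<open>defect_star_space\<close> are compositions with the projection, and \<open>G \<otimes> 'h ^ 'n\<close> is
  identified with the direct sum of copies of \<open>G \<otimes> 'h\<close> in the row operator with the entries
  \<open>X i \<otimes>\<^sub>o id_blinfun\<close>.
\<close>

definition charfun ::
  "('n::finite \<Rightarrow> 'h::complex_hilbert \<Rightarrow>\<^sub>L 'h) \<Rightarrow> ('s, complex) ell2 set \<Rightarrow>
    ('n \<Rightarrow> ('s, complex) ell2 \<Rightarrow>\<^sub>L ('s, complex) ell2) \<Rightarrow> ('s, 'h ^ 'n) ell2 \<Rightarrow>\<^sub>L ('s, 'h) ell2"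
  where "charfun T G X =
    - (oproj G \<otimes>\<^sub>o (row_op T o\<^sub>L oproj (defect_star_space T))) +
    ((oproj G \<otimes>\<^sub>o defect T)
      o\<^sub>L inv_on (tensor_space G UNIV) ((oproj G \<otimes>\<^sub>o id_blinfun) - (\<Sum>i\<in>UNIV. X i \<otimes>\<^sub>o adj (T i)))
      o\<^sub>L (\<Sum>i\<in>UNIV. (X i \<otimes>\<^sub>o id_blinfun) o\<^sub>L (oproj G \<otimes>\<^sub>o vec_coord i))
      o\<^sub>L (oproj G \<otimes>\<^sub>o (defect_star T o\<^sub>L oproj (defect_star_space T))))"

text \<open>
  Quantification over all Hilbert spaces \<open>G\<close> becomes quantification over the closed subspaces of
  \<open>('s, complex) ell2\<close>, for an arbitrary infinite type \<open>'s\<close>, which is a parameter of the notions below.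
  Up to unitary equivalence these are the Hilbert spaces of dimension at most the cardinality of \<open>'s\<close>.
\<close>

definition charfun_constant ::
  "'s::infinite itself \<Rightarrow> ('n::finite \<Rightarrow> 'h::complex_hilbert \<Rightarrow>\<^sub>L 'h) \<Rightarrow> bool"
  where "charfun_constant _ T \<longleftrightarrow>
    (\<forall>(G :: ('s, complex) ell2 set) X. closed_csubspace G \<and> strict_row_contraction_on G X \<longrightarrow>
      charfun T G X = charfun T G (\<lambda>_. 0))"

definition charfun_coeff ::
  "'s::infinite itself \<Rightarrow> ('n::finite \<Rightarrow> 'h::complex_hilbert \<Rightarrow>\<^sub>L 'h) \<Rightarrow> 'n list \<Rightarrow> ('h ^ 'n) \<Rightarrow>\<^sub>L 'h"
  where "charfun_coeff _ T = (THE A.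
    (\<forall>\<alpha>. A \<alpha> \<in> bop (defect_star_space T) (defect_space T)) \<and>
    (\<forall>(G :: ('s, complex) ell2 set) X. closed_csubspace G \<and> strict_row_contraction_on G X \<longrightarrow>
      (\<lambda>k. \<Sum>\<alpha> | length \<alpha> = k. word_op G X \<alpha> \<otimes>\<^sub>o A \<alpha>) sums charfun T G X))"

definition charfun_degree ::
  "'s::infinite itself \<Rightarrow> ('n::finite \<Rightarrow> 'h::complex_hilbert \<Rightarrow>\<^sub>L 'h) \<Rightarrow> enat"
  where "charfun_degree S T = (let N = {\<alpha>. charfun_coeff S T \<alpha> \<noteq> 0} in
    if finite N then enat (Max (insert 0 (length ` N))) else \<infinity>)"

subsection \<open>The invariant\<close>

definition poisson_kernel ::
  "('n::finite \<Rightarrow> 'h::complex_hilbert \<Rightarrow>\<^sub>L 'h) \<Rightarrow> 'h \<Rightarrow> ('n list, 'h) ell2"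
  where "poisson_kernel T h = (\<Sum>\<^sub>\<infinity>\<alpha>. ket \<alpha> \<otimes>\<^sub>h defect T (adj (word_op UNIV T \<alpha>) h))"

definition defect_tail :: "('n::finite \<Rightarrow> 'h::complex_hilbert \<Rightarrow>\<^sub>L 'h) \<Rightarrow> nat \<Rightarrow> 'h set"
  where "defect_tail T k =
    closure (cspan {word_op UNIV T \<beta> (defect T h) |\<beta> h. k \<le> length \<beta>})"

definition Gamma_map ::
  "'s::infinite itself \<Rightarrow> ('n::finite \<Rightarrow> 'h::complex_hilbert \<Rightarrow>\<^sub>L 'h) \<Rightarrow> enat \<times> enat \<times> enat"
  where "Gamma_map S T =
    ((case charfun_degree S T of
       enat m \<Rightarrow> hdim (defect_tail T m \<inter> ortho (defect_tail T (Suc m)))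
     | \<infinity> \<Rightarrow> hdim (defect_space T)),
     charfun_degree S T,
     hdim {h. poisson_kernel T h = 0})"

subsection \<open>The canonical representation\<close>

definition H_v :: "('n::finite \<Rightarrow> 'h::complex_hilbert \<Rightarrow>\<^sub>L 'h) \<Rightarrow> 'h set"
  where "H_v T = closure (cspan {word_op UNIV T \<beta> h |\<beta> h. h \<in> defect_space T})"

definition H_c :: "('n::finite \<Rightarrow> 'h::complex_hilbert \<Rightarrow>\<^sub>L 'h) \<Rightarrow> 'h set"
  where "H_c T =
    {h. \<forall>k. (\<Sum>\<alpha> | length \<alpha> = k. (norm (adj (word_op UNIV T \<alpha>) h))\<^sup>2) = (norm h)\<^sup>2}"

definition orthogonal_decomposition :: "'a::complex_hilbert set \<Rightarrow> 'a set \<Rightarrow> bool"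
  where "orthogonal_decomposition M N \<longleftrightarrow> closed_csubspace M \<and> closed_csubspace N \<and>
    (\<forall>x\<in>M. \<forall>y\<in>N. cinner x y = 0) \<and> (\<forall>h. \<exists>x\<in>M. \<exists>y\<in>N. h = x + y)"

text \<open>\<open>T i\<close> has the block matrix \<open>[V i, *; 0, W i]\<close> with respect to the decomposition into \<open>M\<close> and \<open>N\<close>.\<close>

definition upper_triangular_rep ::
  "'h::complex_hilbert set \<Rightarrow> 'h set \<Rightarrow> ('n \<Rightarrow> 'h \<Rightarrow>\<^sub>L 'h) \<Rightarrow> ('n \<Rightarrow> 'h \<Rightarrow>\<^sub>L 'h) \<Rightarrow> ('n \<Rightarrow> 'h \<Rightarrow>\<^sub>L 'h) \<Rightarrow> bool"
  where "upper_triangular_rep M N T V W \<longleftrightarrow> orthogonal_decomposition M N \<and>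
    (\<forall>i. V i \<in> bop M M \<and> W i \<in> bop N N \<and>
      (\<exists>Y\<in>bop N M. \<forall>x\<in>M. \<forall>y\<in>N. T i (x + y) = (V i x + Y y) + W i y))"

end

theory Submission
  imports Defs
begin

text \<open>
  Write \<open>\<Delta>\<close> and \<open>\<Delta>\<^sub>*\<close> for the two defect operators, \<open>T\<^sub>\<gamma>\<close> for the product of the \<open>T\<^sub>i\<close> along a word
  \<open>\<gamma>\<close>, and \<open>P\<^sub>i\<close> for the \<open>i\<close>-th coordinate of \<open>\<H>\<^sup>n\<close>.

  The Neumann series of the inverse in the characteristic function gives its expansion: the coefficient
  of a word ending in \<open>i\<close> is a restriction of \<open>\<Delta> T\<^sub>\<gamma>\<^sup>* P\<^sub>i \<Delta>\<^sub>*\<close>, where \<open>\<gamma>\<close> is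
  the word without its last letter, reversed (\<open>charfun_expansion\<close>). Evaluation at truncated creation operators recovers every coefficient
  (\<open>power_series_coeff_unique\<close>), so that both ``constant'' and ``degree zero'' say that
  \<open>\<Delta> T\<^sub>\<gamma>\<^sup>* P\<^sub>i \<Delta>\<^sub>* = 0\<close> for all \<open>\<gamma>\<close> and \<open>i\<close>. This settles the equivalence of (i) and (ii).

  The vectors \<open>h\<close> with \<open>\<Delta> T\<^sub>\<gamma>\<^sup>* h = 0\<close> for all \<open>\<gamma>\<close> are those orthogonal to all \<open>T\<^sub>\<gamma> \<Delta> k\<close>, hence to
  \<open>\<H>\<^sub>v\<close>; and they form \<open>\<H>\<^sub>c\<close>, because the sums in the definition of \<open>\<H>\<^sub>c\<close> drop from one length of words to
  the next by exactly the sum of the \<open>\<parallel>\<Delta> T\<^sub>\<gamma>\<^sup>* h\<parallel>\<^sup>2\<close> (\<open>Hc_eq\<close>). So every row contraction is block upper triangular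
  with respect to \<open>\<H> = \<H>\<^sub>v \<oplus> \<H>\<^sub>c\<close>, with a coisometry in the lower corner, and \<open>T\<close> determines the diagonal
  blocks \<open>V\<close> and \<open>W\<close>. What the vanishing of the coefficients adds is that \<open>\<Delta>\<^sub>*\<close> maps into vectors with all
  components in \<open>\<H>\<^sub>c\<close>. As \<open>\<Delta>\<^sub>*\<close> is self-adjoint, this means that \<open>\<Delta>\<^sub>*\<close> annihilates the vectors with all
  components in \<open>\<H>\<^sub>v\<close>, that is, that \<open>T\<close> is isometric there, which is to say that \<open>V\<close> is an isometry
  (\<open>isometry_Vc_iff\<close>). Its purity then follows: \<open>\<Delta> T = T \<Delta>\<^sub>*\<close> shows that \<open>\<Delta> T\<^sub>i\<close> vanishes on \<open>\<H>\<^sub>v\<close>, so each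
  \<open>V\<^sub>i\<^sup>*\<close> annihilates the defect space, which generates \<open>\<H>\<^sub>v\<close> (\<open>pure_Vc\<close>).

  For completely non-unitary \<open>T\<close> it remains to see that \<open>W\<close> is completely non-unitary. If \<open>W\<close> is unitary on a
  reducing subspace, then contractivity of \<open>T\<close> leaves no room for the off-diagonal block there, so
  the subspace reduces \<open>T\<close> as well, and \<open>T\<close> is unitary on it (\<open>cnu_Wc\<close>).

  Before that, the operators that occur in the definitions (orthogonal projections, adjoints, positive square
  roots, tensor products) are shown to exist and to be unique.
\<close>

section \<open>Projections, adjoints and square roots\<close>

subsection \<open>The complex inner product\<close>

lemma cinner_zero_left [simp]: "cinner 0 (y::'a::complex_hilbert) = 0"
  using cinner_add_left[of 0 0 y] by simp

lemma cinner_zero_right [simp]: "cinner (x::'a::complex_hilbert) 0 = 0"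
  using cinner_add_right[of x 0 0] by simp

lemma cinner_minus_left: "cinner (- x) (y::'a::complex_hilbert) = - cinner x y"
  using cinner_add_left[of x "- x" y] by (simp add: eq_neg_iff_add_eq_0 add.commute)

lemma cinner_minus_right: "cinner x (- (y::'a::complex_hilbert)) = - cinner x y"
  using cinner_add_right[of x y "- y"] by (simp add: eq_neg_iff_add_eq_0 add.commute)

lemma cinner_diff_left: "cinner (x - y) (z::'a::complex_hilbert) = cinner x z - cinner y z"
  using cinner_add_left[of x "- y" z] by (simp add: cinner_minus_left)

lemma cinner_diff_right: "cinner x (y - (z::'a::complex_hilbert)) = cinner x y - cinner x z"
  using cinner_add_right[of x y "- z"] by (simp add: cinner_minus_right)

lemma cinner_sum_left: "cinner (sum f A) (z::'a::complex_hilbert) = (\<Sum>i\<in>A. cinner (f i) z)"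
  by (induction A rule: infinite_finite_induct) (auto simp: cinner_add_left)

lemma cinner_sum_right: "cinner (z::'a::complex_hilbert) (sum f A) = (\<Sum>i\<in>A. cinner z (f i))"
  by (induction A rule: infinite_finite_induct) (auto simp: cinner_add_right)

lemma scaleC_zero_right [simp]: "c *\<^sub>C (0::'a::complex_hilbert) = 0"
  using norm_scaleC[of c "0::'a"] by simp

lemma scaleC_zero_left [simp]: "0 *\<^sub>C (x::'a::complex_hilbert) = 0"
  using norm_scaleC[of 0 x] by simp

lemma scaleC_minus_right: "c *\<^sub>C (- (x::'a::complex_hilbert)) = - (c *\<^sub>C x)"
  using scaleC_add_right[of c x "- x"] by (simp add: eq_neg_iff_add_eq_0 add.commute)

lemma scaleC_diff_right: "c *\<^sub>C (x - (y::'a::complex_hilbert)) = c *\<^sub>C x - c *\<^sub>C y"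
  using scaleC_add_right[of c x "- y"] by (simp add: scaleC_minus_right)

lemma scaleC_sum_right: "c *\<^sub>C (sum f A :: 'a::complex_hilbert) = (\<Sum>i\<in>A. c *\<^sub>C f i)"
  by (induction A rule: infinite_finite_induct) (auto simp: scaleC_add_right)

lemma cinner_scaleR_left: "cinner (r *\<^sub>R x) (y::'a::complex_hilbert) = r *\<^sub>R cinner x y"
  by (simp add: scaleR_scaleC cinner_scaleC_left scaleC_complex_def)

lemma cinner_scaleR_right: "cinner x (r *\<^sub>R (y::'a::complex_hilbert)) = r *\<^sub>R cinner x y"
  by (simp add: scaleR_scaleC[of _ y] cinner_scaleC_right scaleR_conv_of_real)

lemma cinner_sym_zero: "cinner x (y::'a::complex_hilbert) = 0 \<longleftrightarrow> cinner y x = 0"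
  by (metis cinner_commute complex_cnj_zero)

lemma cinner_self_eq_0 [simp]: "cinner x (x::'a::complex_hilbert) = 0 \<longleftrightarrow> x = 0"
  by (simp add: cinner_self)

lemma Im_cinner: "Im (cinner x (y::'a::complex_hilbert)) = inner x (\<i> *\<^sub>C y)"
  by (simp add: inner_eq_Re_cinner cinner_scaleC_right)

lemma norm_cinner_le: "cmod (cinner x (y::'a::complex_hilbert)) \<le> norm x * norm y"
proof (cases "cinner x y = 0")
  case False
  define u where "u = cnj (cinner x y) / cmod (cinner x y)"
  have u: "cmod u = 1" using False by (simp add: u_def norm_divide)
  have "cinner (u *\<^sub>C x) y = u * cinner x y" by (simp add: cinner_scaleC_left)
  also have "\<dots> = cmod (cinner x y)"
    using False complex_norm_square[of "cinner x y"]
    by (simp add: u_def field_simps power2_eq_square)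
  finally have "cmod (cinner x y) = inner (u *\<^sub>C x) y"
    by (simp add: inner_eq_Re_cinner)
  also have "\<dots> \<le> norm (u *\<^sub>C x) * norm y" by (rule norm_cauchy_schwarz)
  finally show ?thesis by (simp add: norm_scaleC u)
qed simp

lemma Re_cinner_le: "Re (cinner x (y::'a::complex_hilbert)) \<le> norm x * norm y"
  using norm_cauchy_schwarz[of x y] by (simp add: inner_eq_Re_cinner)

interpretation cinner: bounded_bilinear "cinner :: 'a::complex_hilbert \<Rightarrow> 'a \<Rightarrow> complex"
  by unfold_locales
    (auto simp: cinner_add_left cinner_add_right cinner_scaleR_left cinner_scaleR_right
      intro!: exI[of _ 1] norm_cinner_le)

lemma bounded_linear_scaleC_right: "bounded_linear (\<lambda>x::'a::complex_hilbert. c *\<^sub>C x)"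
  by (rule bounded_linear_intro[where K = "cmod c"])
    (auto simp: scaleC_add_right scaleR_scaleC scaleC_scaleC mult.commute norm_scaleC)

lemma bounded_linear_scaleC_left: "bounded_linear (\<lambda>c. c *\<^sub>C (x::'a::complex_hilbert))"
  by (rule bounded_linear_intro[where K = "norm x"])
    (auto simp: scaleC_add_left scaleR_scaleC scaleC_scaleC norm_scaleC scaleC_complex_def)

lemma cinner_left_ext:
  assumes "\<And>z. cinner x z = cinner (y::'a::complex_hilbert) z"
  shows "x = y"
  using assms[of "x - y"] by (metis cinner_diff_left cinner_self_eq_0 right_minus_eq)

lemma cinner_right_ext:
  assumes "\<And>z. cinner z x = cinner z (y::'a::complex_hilbert)"
  shows "x = y"
  using assms by (metis cinner_commute cinner_left_ext)

lemma norm_add_square: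
  "(norm (x + (y::'a::complex_hilbert)))\<^sup>2 = (norm x)\<^sup>2 + 2 * Re (cinner x y) + (norm y)\<^sup>2"
  by (simp add: power2_norm_eq_inner inner_add_left inner_add_right inner_commute
      inner_eq_Re_cinner[symmetric])

lemma norm_square_cinner: "(norm (x::'a::complex_hilbert))\<^sup>2 = Re (cinner x x)"
  by (simp add: cinner_self)

subsection \<open>Closed subspaces and projections\<close>

lemma csubspace_iff:
  "csubspace M \<longleftrightarrow> (0::'a::complex_hilbert) \<in> M \<and> (\<forall>x\<in>M. \<forall>y\<in>M. x + y \<in> M) \<and> (\<forall>c. \<forall>x\<in>M. c *\<^sub>C x \<in> M)"
  by (auto simp: complex_vector.subspace_def)

lemma closed_csubspaceD:
  assumes "closed_csubspace (M :: 'a::complex_hilbert set)"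
  shows "0 \<in> M" "\<And>x y. x \<in> M \<Longrightarrow> y \<in> M \<Longrightarrow> x + y \<in> M" "\<And>c x. x \<in> M \<Longrightarrow> c *\<^sub>C x \<in> M"
    "\<And>x y. x \<in> M \<Longrightarrow> y \<in> M \<Longrightarrow> x - y \<in> M" "\<And>x. x \<in> M \<Longrightarrow> - x \<in> M" "closed M" "csubspace M"
  using assms unfolding closed_csubspace_def
  by (auto simp: csubspace_iff complex_vector.subspace_diff complex_vector.subspace_neg)

lemma closed_csubspace_sum:
  assumes "closed_csubspace (M :: 'a::complex_hilbert set)" "\<And>i. i \<in> A \<Longrightarrow> f i \<in> M"
  shows "sum f A \<in> M"
  using complex_vector.subspace_sum[of M A f] assms unfolding closed_csubspace_def by auto

lemma closed_csubspace_UNIV [simp]: "closed_csubspace UNIV"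
  by (simp add: closed_csubspace_def complex_vector.subspace_UNIV)

lemma closed_csubspace_ortho: "closed_csubspace (ortho (M :: 'a::complex_hilbert set))"
proof -
  have "ortho M = (\<Inter>y\<in>M. {x. cinner x y = 0})" by (auto simp: ortho_def)
  moreover have "closed {x. cinner x y = 0}" for y :: 'a
    by (intro closed_Collect_eq cinner.continuous_on continuous_intros)
  ultimately have "closed (ortho M)" by auto
  then show ?thesis
    by (auto simp: closed_csubspace_def csubspace_iff ortho_def cinner_add_left cinner_scaleC_left)
qed

lemma csubspace_closure:
  assumes "csubspace (M :: 'a::complex_hilbert set)"
  shows "closed_csubspace (closure M)"
proof -
  have "0 \<in> closure M"
    using assms closure_subset[of M] by (auto simp: csubspace_iff)
  moreover have "x + y \<in> closure M" if x: "x \<in> closure M" and y: "y \<in> closure M" for x y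
  proof -
    obtain f where f: "\<And>n. f n \<in> M" "f \<longlonglongrightarrow> x" using x closure_sequential by blast
    obtain g where g: "\<And>n. g n \<in> M" "g \<longlonglongrightarrow> y" using y closure_sequential by blast
    have "(\<lambda>n. f n + g n) \<longlonglongrightarrow> x + y" by (intro tendsto_add f g)
    moreover have "f n + g n \<in> M" for n
      using assms f g by (auto simp: csubspace_iff)
    ultimately show ?thesis
      by (auto simp: closure_sequential intro!: exI[of _ "\<lambda>n. f n + g n"])
  qed
  moreover have "c *\<^sub>C x \<in> closure M" if x: "x \<in> closure M" for c x
  proof -
    obtain f where f: "\<And>n. f n \<in> M" "f \<longlonglongrightarrow> x" using x closure_sequential by blast
    have "(\<lambda>n. c *\<^sub>C f n) \<longlonglongrightarrow> c *\<^sub>C x"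
      by (rule bounded_linear.tendsto[OF bounded_linear_scaleC_right f(2)])
    moreover have "c *\<^sub>C f n \<in> M" for n
      using assms f by (auto simp: csubspace_iff)
    ultimately show ?thesis
      by (auto simp: closure_sequential intro!: exI[of _ "\<lambda>n. c *\<^sub>C f n"])
  qed
  ultimately show ?thesis by (auto simp: closed_csubspace_def csubspace_iff)
qed

lemma closed_csubspace_closure_cspan:
  "closed_csubspace (closure (cspan (S :: 'a::complex_hilbert set)))"
  by (rule csubspace_closure) (rule complex_vector.subspace_span)

lemma closure_cspan_minimal:
  assumes "S \<subseteq> M" "closed_csubspace (M :: 'a::complex_hilbert set)"
  shows "closure (cspan S) \<subseteq> M"
  using assms by (intro closure_minimal complex_vector.span_minimal) (auto simp: closed_csubspace_def)

lemma closure_cspan_superset: "S \<subseteq> closure (cspan (S :: 'a::complex_hilbert set))"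
  using complex_vector.span_superset closure_subset by blast

text \<open>The vectors orthogonal to a given one form a closed subspace, so orthogonality to \<open>S\<close> passes to its
  closed span.\<close>

lemma ortho_closure_cspan: "ortho (closure (cspan S)) = ortho (S :: 'a::complex_hilbert set)"
proof
  show "ortho (closure (cspan S)) \<subseteq> ortho S"
    using closure_cspan_superset[of S] by (auto simp: ortho_def)
  show "ortho S \<subseteq> ortho (closure (cspan S))"
  proof
    fix x assume x: "x \<in> ortho S"
    have "S \<subseteq> ortho {x}" using x by (auto simp: ortho_def cinner_sym_zero)
    then have "closure (cspan S) \<subseteq> ortho {x}"
      by (rule closure_cspan_minimal) (rule closed_csubspace_ortho)
    then show "x \<in> ortho (closure (cspan S))"
      by (auto simp: ortho_def cinner_sym_zero)
  qed
qed

text \<open>A minimising sequence in \<open>M\<close> for the distance to \<open>x\<close> is Cauchy by the parallelogram law, and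
  its limit is the foot of the perpendicular.\<close>

lemma orthogonal_projection_exists:
  fixes x :: "'a::complex_hilbert"
  assumes M: "closed_csubspace M"
  shows "\<exists>p\<in>M. x - p \<in> ortho M"
proof -
  define d where "d = Inf ((\<lambda>y. (norm (x - y))\<^sup>2) ` M)"
  have ne: "M \<noteq> {}" using closed_csubspaceD(1)[OF M] by auto
  have bdd: "bdd_below ((\<lambda>y. (norm (x - y))\<^sup>2) ` M)" by (intro bdd_belowI[of _ 0]) auto
  have dle: "d \<le> (norm (x - y))\<^sup>2" if "y \<in> M" for y
    unfolding d_def by (rule cInf_lower[OF _ bdd]) (use that in auto)
  have "\<exists>y\<in>M. (norm (x - y))\<^sup>2 < d + 1 / Suc n" for n
    using cInf_lessD[of "(\<lambda>y. (norm (x - y))\<^sup>2) ` M" "d + 1 / Suc n"] ne by (auto simp: d_def)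
  then obtain y where y: "\<And>n. y n \<in> M" "\<And>n. (norm (x - y n))\<^sup>2 < d + 1 / Suc n" by metis
  have par: "(norm (y m - y n))\<^sup>2 \<le> 2 / Suc m + 2 / Suc n" for m n
  proof -
    have "(1/2) *\<^sub>R (y m + y n) \<in> M"
      unfolding scaleR_scaleC by (intro closed_csubspaceD[OF M] y)
    then have "d \<le> (norm (x - (1/2) *\<^sub>R (y m + y n)))\<^sup>2" by (rule dle)
    moreover have "(norm (y m - y n))\<^sup>2 =
        2 * (norm (x - y m))\<^sup>2 + 2 * (norm (x - y n))\<^sup>2 - 4 * (norm (x - (1/2) *\<^sub>R (y m + y n)))\<^sup>2"
      by (simp add: power2_norm_eq_inner algebra_simps inner_commute)
    ultimately show ?thesis using y(2)[of m] y(2)[of n] by auto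
  qed
  have "Cauchy y"
  proof (rule metric_CauchyI)
    fix e :: real assume e: "e > 0"
    obtain N where N: "4 / e\<^sup>2 < real (Suc N)" using reals_Archimedean2 less_Suc_eq of_nat_less_iff
      by (metis less_trans lessI)
    have "dist (y m) (y n) < e" if "m \<ge> N" "n \<ge> N" for m n
    proof -
      have "2 / real (Suc m) \<le> 2 / real (Suc N)" "2 / real (Suc n) \<le> 2 / real (Suc N)"
        using that by (auto intro!: divide_left_mono)
      then have "(norm (y m - y n))\<^sup>2 \<le> 4 / real (Suc N)"
        using par[of m n] by simp
      also have "\<dots> < e\<^sup>2" using N e by (simp add: field_simps)
      finally show ?thesis using e power2_less_imp_less[of "norm (y m - y n)" e] by (simp add: dist_norm)
    qed
    then show "\<exists>M. \<forall>m\<ge>M. \<forall>n\<ge>M. dist (y m) (y n) < e" by blast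
  qed
  then obtain p where p: "y \<longlonglongrightarrow> p" using Cauchy_convergent convergent_def by blast
  have pM: "p \<in> M" using closed_csubspaceD(6)[OF M] y(1) p closed_sequentially by blast
  have "(\<lambda>n. (norm (x - y n))\<^sup>2) \<longlonglongrightarrow> (norm (x - p))\<^sup>2" by (intro tendsto_intros p)
  moreover have "(\<lambda>n. d + 1 / Suc n) \<longlonglongrightarrow> d + 0" by (intro tendsto_intros LIMSEQ_Suc lim_1_over_n)
  ultimately have "(norm (x - p))\<^sup>2 \<le> d + 0"
    by (rule LIMSEQ_le) (use y(2) less_imp_le in blast)
  then have min: "(norm (x - p))\<^sup>2 \<le> (norm (x - p - t *\<^sub>R z))\<^sup>2" if "z \<in> M" for z t
  proof -
    have "p + t *\<^sub>R z \<in> M"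
      unfolding scaleR_scaleC by (intro closed_csubspaceD[OF M] pM that)
    then have "(norm (x - p))\<^sup>2 \<le> (norm (x - (p + t *\<^sub>R z)))\<^sup>2"
      using dle order_trans \<open>(norm (x - p))\<^sup>2 \<le> d + 0\<close> by fastforce
    then show ?thesis by (simp only: diff_diff_add)
  qed
  have "inner (x - p) z = 0" if z: "z \<in> M" for z
  proof (cases "z = 0")
    case False
    define t where "t = inner (x - p) z / (norm z)\<^sup>2"
    have "(norm (x - p - t *\<^sub>R z))\<^sup>2 = (norm (x - p))\<^sup>2 - 2 * t * inner (x - p) z + t\<^sup>2 * (norm z)\<^sup>2"
      unfolding power2_norm_eq_inner
      by (simp add: inner_diff_left inner_diff_right inner_commute power2_eq_square algebra_simps)
    also have "t\<^sup>2 * (norm z)\<^sup>2 = t * inner (x - p) z"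
      using False by (simp add: t_def power2_eq_square)
    finally have "t * inner (x - p) z \<le> 0" using min[OF z, of t] by simp
    then have "(inner (x - p) z)\<^sup>2 \<le> 0"
      using False by (simp add: t_def power2_eq_square divide_le_0_iff mult_le_0_iff)
    then show ?thesis by simp
  qed simp
  then have "x - p \<in> ortho M"
    using closed_csubspaceD(3)[OF M]
    by (auto simp: ortho_def complex_eq_iff Im_cinner inner_eq_Re_cinner[symmetric])
  with pM show ?thesis by blast
qed

lemma orthogonal_projection_unique:
  assumes M: "closed_csubspace (M :: 'a::complex_hilbert set)"
    and "p \<in> M" "x - p \<in> ortho M" "q \<in> M" "x - q \<in> ortho M"
  shows "p = q"
proof -
  have "p - q \<in> M" using assms closed_csubspaceD(4)[OF M] by auto
  moreover have "p - q \<in> ortho M"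
    using closed_csubspaceD(4)[OF closed_csubspace_ortho assms(5) assms(3)] by simp
  ultimately have "cinner (p - q) (p - q) = 0" by (auto simp: ortho_def)
  then show ?thesis by simp
qed

text \<open>The type of bounded operators only provides real linearity.\<close>

definition clin :: "('a::complex_hilbert \<Rightarrow>\<^sub>L 'b::complex_hilbert) \<Rightarrow> bool"
  where "clin A \<longleftrightarrow> (\<forall>c x. A (c *\<^sub>C x) = c *\<^sub>C A x)"

lemma clinD: "clin A \<Longrightarrow> A (c *\<^sub>C x) = c *\<^sub>C A x"
  by (simp add: clin_def)

lemma clin_id [simp]: "clin id_blinfun" by (simp add: clin_def)
lemma clin_zero [simp]: "clin 0" by (simp add: clin_def)
lemma clin_compose [simp]: "clin A \<Longrightarrow> clin B \<Longrightarrow> clin (A o\<^sub>L B)" by (simp add: clin_def)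
lemma clin_add [simp]: "clin A \<Longrightarrow> clin B \<Longrightarrow> clin (A + B)"
  by (simp add: clin_def blinfun.add_left scaleC_add_right)
lemma clin_diff [simp]: "clin A \<Longrightarrow> clin B \<Longrightarrow> clin (A - B)"
  by (simp add: clin_def blinfun.diff_left scaleC_diff_right)
lemma clin_minus [simp]: "clin A \<Longrightarrow> clin (- A)"
  by (simp add: clin_def blinfun.minus_left scaleC_minus_right)
lemma clin_scaleR [simp]: "clin A \<Longrightarrow> clin (r *\<^sub>R A)"
  by (simp add: clin_def blinfun.scaleR_left scaleR_scaleC scaleC_scaleC mult.commute)
lemma clin_sum [simp]: "(\<And>i. i \<in> S \<Longrightarrow> clin (f i)) \<Longrightarrow> clin (sum f S)"
  by (induction S rule: infinite_finite_induct) auto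

lemma clin_lim:
  assumes "F \<longlonglongrightarrow> A" "\<And>n::nat. clin (F n)"
  shows "clin A"
  unfolding clin_def
proof (intro allI)
  fix c x
  have "(\<lambda>n. F n (c *\<^sub>C x)) \<longlonglongrightarrow> A (c *\<^sub>C x)" by (intro tendsto_intros assms)
  moreover have "(\<lambda>n. c *\<^sub>C F n x) \<longlonglongrightarrow> c *\<^sub>C A x"
    by (intro bounded_linear.tendsto[OF bounded_linear_scaleC_right] tendsto_intros assms)
  ultimately show "A (c *\<^sub>C x) = c *\<^sub>C A x"
    using assms(2) by (simp add: clin_def LIMSEQ_unique)
qed

lemma blinfun_compose_assoc: "(A o\<^sub>L B) o\<^sub>L C = A o\<^sub>L (B o\<^sub>L C)"
  by (rule blinfun_eqI) simp

lemma blinfun_compose_id [simp]: "A o\<^sub>L id_blinfun = A" "id_blinfun o\<^sub>L A = A"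
  by (rule blinfun_eqI, simp)+

lemma blinfun_compose_applyD: "A o\<^sub>L B = C \<Longrightarrow> A (B x) = C x"
  by (drule arg_cong[where f = "\<lambda>R. blinfun_apply R x"]) simp

lemma blinfun_compose3_applyD: "A o\<^sub>L B o\<^sub>L C = D \<Longrightarrow> A (B (C x)) = D x"
  by (drule arg_cong[where f = "\<lambda>R. blinfun_apply R x"]) simp

lemma csubspace_range:
  fixes A :: "'a::complex_hilbert \<Rightarrow>\<^sub>L 'b::complex_hilbert"
  assumes A: "clin A" shows "csubspace (range A)"
  unfolding csubspace_iff
proof (intro conjI ballI allI)
  show "0 \<in> range A" by (rule range_eqI[of _ _ 0]) (simp add: blinfun.zero_right)
next
  fix x y assume "x \<in> range A" "y \<in> range A"
  then obtain a b where "x = A a" "y = A b" by blast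
  then have "x + y = A (a + b)" by (simp add: blinfun.add_right)
  then show "x + y \<in> range A" by (rule range_eqI)
next
  fix c x assume "x \<in> range A"
  then obtain a where "x = A a" by blast
  then have "c *\<^sub>C x = A (c *\<^sub>C a)" by (simp add: clinD[OF A])
  then show "c *\<^sub>C x \<in> range A" by (rule range_eqI)
qed

lemma ortho_UNIV: "ortho (UNIV :: 'a::complex_hilbert set) = {0}"
proof -
  have "x = 0" if "x \<in> ortho UNIV" for x :: 'a
    using that cinner_self_eq_0[of x] unfolding ortho_def by blast
  then show ?thesis by (auto simp: ortho_def)
qed

lemma bop_UNIV: "A \<in> bop UNIV UNIV \<longleftrightarrow> clin A"
  by (auto simp: bop_def clin_def ortho_UNIV blinfun.zero_right)

lemma bop_iff: "A \<in> bop M N \<longleftrightarrow> clin A \<and> (\<forall>x. A x \<in> N) \<and> (\<forall>x\<in>ortho M. A x = 0)"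
  by (simp add: bop_def clin_def)

lemma oproj_unique:
  fixes P :: "'a::complex_hilbert \<Rightarrow>\<^sub>L 'a"
  assumes M: "closed_csubspace M"
    and P: "\<And>x. P x \<in> M" "\<And>x. x - P x \<in> ortho M"
  shows "oproj M = P"
  unfolding oproj_def
proof (rule the_equality)
  show "\<forall>x. P x \<in> M \<and> x - P x \<in> ortho M" using P by simp
  show "Q = P" if "\<forall>x. Q x \<in> M \<and> x - Q x \<in> ortho M" for Q :: "'a \<Rightarrow>\<^sub>L 'a"
    using that P orthogonal_projection_unique[OF M] by (intro blinfun_eqI) blast
qed

lemma oproj_exists:
  assumes M: "closed_csubspace (M :: 'a::complex_hilbert set)"
  shows "\<exists>P :: 'a \<Rightarrow>\<^sub>L 'a. clin P \<and> (\<forall>x. P x \<in> M \<and> x - P x \<in> ortho M)"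
proof -
  obtain p where p: "\<And>x. p x \<in> M" "\<And>x. x - p x \<in> ortho M"
    using orthogonal_projection_exists[OF M] by metis
  note sub = closed_csubspaceD[OF M] and osub = closed_csubspaceD[OF closed_csubspace_ortho[of M]]
  have add: "p (x + y) = p x + p y" for x y
  proof (rule orthogonal_projection_unique[OF M, of _ "x + y"])
    have "x + y - (p x + p y) = (x - p x) + (y - p y)" by simp
    then show "x + y - (p x + p y) \<in> ortho M" using p osub(2) by metis
  qed (use p sub in auto)
  have scale: "p (c *\<^sub>C x) = c *\<^sub>C p x" for c x
  proof (rule orthogonal_projection_unique[OF M, of _ "c *\<^sub>C x"])
    show "c *\<^sub>C x - c *\<^sub>C p x \<in> ortho M"
      using p osub(3) by (metis scaleC_diff_right)
  qed (use p sub in auto)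
  have norm: "norm (p x) \<le> norm x * 1" for x
  proof -
    have "cinner (x - p x) (p x) = 0" using p[of x] by (auto simp: ortho_def)
    then have "(norm x)\<^sup>2 = (norm (x - p x))\<^sup>2 + (norm (p x))\<^sup>2"
      using norm_add_square[of "x - p x" "p x"] by simp
    then have "(norm (p x))\<^sup>2 \<le> (norm x)\<^sup>2" by simp
    then show ?thesis using power2_le_imp_le[of "norm (p x)" "norm x"] by simp
  qed
  have bl: "bounded_linear p"
    by (rule bounded_linear_intro[OF add _ norm]) (simp add: scaleR_scaleC scale)
  show ?thesis
    by (rule exI[of _ "Blinfun p"])
      (use p scale in \<open>simp add: bounded_linear_Blinfun_apply[OF bl] clin_def\<close>)
qed

lemma
  assumes M: "closed_csubspace (M :: 'a::complex_hilbert set)"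
  shows oproj_in: "oproj M x \<in> M" and oproj_ortho: "x - oproj M x \<in> ortho M"
    and clin_oproj: "clin (oproj M)"
proof -
  obtain P :: "'a \<Rightarrow>\<^sub>L 'a" where P: "clin P" "\<And>x. P x \<in> M" "\<And>x. x - P x \<in> ortho M"
    using oproj_exists[OF M] by blast
  then have "oproj M = P" by (intro oproj_unique M)
  then show "oproj M x \<in> M" "x - oproj M x \<in> ortho M" "clin (oproj M)" using P by auto
qed

lemma oproj_fix: "closed_csubspace M \<Longrightarrow> x \<in> M \<Longrightarrow> oproj M x = (x::'a::complex_hilbert)"
  using orthogonal_projection_unique[of M "oproj M x" x x]
  by (simp add: oproj_in oproj_ortho closed_csubspaceD(1) closed_csubspace_ortho)

lemma oproj_ker: "closed_csubspace M \<Longrightarrow> x \<in> ortho M \<Longrightarrow> oproj M x = (0::'a::complex_hilbert)"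
  using orthogonal_projection_unique[of M "oproj M x" x 0]
  by (simp add: oproj_in oproj_ortho closed_csubspaceD(1))

lemma oproj_UNIV [simp]: "oproj UNIV = id_blinfun"
  by (rule oproj_unique) (auto simp: closed_csubspaceD(1) closed_csubspace_ortho)

lemma oproj_selfadjoint:
  assumes M: "closed_csubspace (M :: 'a::complex_hilbert set)"
  shows "cinner (oproj M x) y = cinner x (oproj M y)"
proof -
  have "cinner (y - oproj M y) (oproj M x) = 0" "cinner (x - oproj M x) (oproj M y) = 0"
    using oproj_in[OF M] oproj_ortho[OF M] by (auto simp: ortho_def)
  then have "cinner (oproj M x) (y - oproj M y) = 0" "cinner (x - oproj M x) (oproj M y) = 0"
    using cinner_sym_zero by blast+
  then show ?thesis by (simp add: cinner_diff_left cinner_diff_right)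
qed

lemma ortho_ortho:
  assumes M: "closed_csubspace (M :: 'a::complex_hilbert set)"
  shows "ortho (ortho M) = M"
proof
  show "M \<subseteq> ortho (ortho M)" by (auto simp: ortho_def cinner_sym_zero)
  show "ortho (ortho M) \<subseteq> M"
  proof
    fix x assume x: "x \<in> ortho (ortho M)"
    have "oproj M x \<in> ortho (ortho M)"
      using oproj_in[OF M, of x] \<open>M \<subseteq> ortho (ortho M)\<close> by auto
    then have "x - oproj M x \<in> ortho (ortho M)"
      using x closed_csubspaceD(4)[OF closed_csubspace_ortho] by blast
    then have "cinner (x - oproj M x) (x - oproj M x) = 0"
      using oproj_ortho[OF M, of x] by (auto simp: ortho_def)
    then have "x = oproj M x" by simp
    then show "x \<in> M" using oproj_in[OF M, of x] by simp
  qed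
qed

subsection \<open>Adjoints\<close>

text \<open>A suitable multiple of any nonzero vector orthogonal to the kernel of the functional represents it.\<close>

lemma riesz_representation:
  fixes f :: "'a::complex_hilbert \<Rightarrow>\<^sub>L complex"
  assumes f: "clin f"
  shows "\<exists>z. \<forall>x. f x = cinner x z"
proof (cases "\<exists>x. f x \<noteq> 0")
  case True
  then obtain x0 where x0: "f x0 \<noteq> 0" by blast
  define M where "M = {x. f x = 0}"
  have "closed M" unfolding M_def by (intro closed_Collect_eq continuous_intros)
  then have M: "closed_csubspace M"
    by (auto simp: closed_csubspace_def csubspace_iff M_def blinfun.add_right clinD[OF f] blinfun.zero_right)
  define w where "w = x0 - oproj M x0"
  have "f (oproj M x0) = 0" using oproj_in[OF M, of x0] by (simp add: M_def)
  then have fw: "f w = f x0" by (simp add: w_def blinfun.diff_right)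
  then have w0: "w \<noteq> 0" using x0 by (auto simp: blinfun.zero_right)
  have w: "w \<in> ortho M" unfolding w_def by (rule oproj_ortho[OF M])
  show ?thesis
  proof (intro exI allI)
    fix x
    have "f w *\<^sub>C x - f x *\<^sub>C w \<in> M"
      by (simp add: M_def blinfun.diff_right clinD[OF f] scaleC_complex_def)
    then have "cinner w (f w *\<^sub>C x - f x *\<^sub>C w) = 0" using w by (auto simp: ortho_def)
    then have "cinner (f w *\<^sub>C x - f x *\<^sub>C w) w = 0" by (simp add: cinner_sym_zero)
    then have "f w * cinner x w = f x * cinner w w"
      by (simp add: cinner_diff_left cinner_scaleC_left)
    then have "f x = f w * cinner x w / cinner w w" using w0 by (simp add: field_simps)
    also have "\<dots> = cinner x (cnj (f w / cinner w w) *\<^sub>C w)"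
      by (simp add: cinner_scaleC_right field_simps)
    finally show "f x = cinner x (cnj (f w / cinner w w) *\<^sub>C w)" .
  qed
qed (auto intro!: exI[of _ 0])

text \<open>With this lemma an adjoint is computed by exhibiting it.\<close>

lemma adj_unique:
  fixes A :: "'a::complex_hilbert \<Rightarrow>\<^sub>L 'b::complex_hilbert" and B :: "'b \<Rightarrow>\<^sub>L 'a"
  assumes "\<And>x y. cinner (A x) y = cinner x (B y)"
  shows "adj A = B"
  unfolding adj_def
proof (rule the_equality)
  show "C = B" if "\<forall>x y. cinner (A x) y = cinner x (C y)" for C :: "'b \<Rightarrow>\<^sub>L 'a"
    by (rule blinfun_eqI, rule cinner_right_ext) (simp add: that[rule_format, symmetric] assms[symmetric])
qed (simp add: assms)

lemma adj_exists:
  assumes A: "clin (A :: 'a::complex_hilbert \<Rightarrow>\<^sub>L 'b::complex_hilbert)"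
  shows "\<exists>B :: 'b \<Rightarrow>\<^sub>L 'a. \<forall>x y. cinner (A x) y = cinner x (B y)"
proof -
  have "\<exists>z. \<forall>x. cinner (A x) y = cinner x z" for y
  proof -
    have bl: "bounded_linear (\<lambda>x. cinner (A x) y)"
      by (intro bounded_linear_compose[OF cinner.bounded_linear_left] blinfun.bounded_linear_right)
    have "clin (Blinfun (\<lambda>x. cinner (A x) y))"
      by (simp add: clin_def bounded_linear_Blinfun_apply[OF bl] clinD[OF A] cinner_scaleC_left
          scaleC_complex_def)
    from riesz_representation[OF this] show ?thesis
      by (simp add: bounded_linear_Blinfun_apply[OF bl])
  qed
  then obtain b where b: "\<And>x y. cinner (A x) y = cinner x (b y)" by metis
  have "bounded_linear b"
  proof (rule bounded_linear_intro)
    show "b (x + y) = b x + b y" for x y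
      by (rule cinner_right_ext) (simp add: b[symmetric] cinner_add_right)
    show "b (r *\<^sub>R x) = r *\<^sub>R b x" for r x
      by (rule cinner_right_ext) (simp add: b[symmetric] cinner_scaleR_right)
    show "norm (b y) \<le> norm y * norm A" for y
    proof -
      have "(norm (b y))\<^sup>2 = cmod (cinner (A (b y)) y)" by (simp add: b cinner_self norm_power)
      also have "\<dots> \<le> norm (A (b y)) * norm y" by (rule norm_cinner_le)
      also have "\<dots> \<le> norm A * norm (b y) * norm y"
        by (intro mult_right_mono norm_blinfun) auto
      finally have "norm (b y) * norm (b y) \<le> norm (b y) * (norm y * norm A)"
        by (simp add: power2_eq_square ac_simps)
      then show ?thesis
        using mult_left_le_imp_le[of "norm (b y)" "norm (b y)" "norm y * norm A"] by (cases "b y = 0") simp_all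
    qed
  qed
  then have "\<forall>x y. cinner (A x) y = cinner x (Blinfun b y)"
    by (simp add: bounded_linear_Blinfun_apply b)
  then show ?thesis by blast
qed

lemma cinner_adj:
  fixes A :: "'a::complex_hilbert \<Rightarrow>\<^sub>L 'b::complex_hilbert"
  assumes A: "clin A"
  shows "cinner (A x) y = cinner x (adj A y)"
proof -
  obtain B :: "'b \<Rightarrow>\<^sub>L 'a" where B: "\<And>x y. cinner (A x) y = cinner x (B y)" using adj_exists[OF A] by blast
  then have "adj A = B" by (intro adj_unique)
  then show ?thesis using B by simp
qed

lemma cinner_adj':
  assumes A: "clin A"
  shows "cinner (adj A y) x = cinner y (A x)"
  by (subst (1 2) cinner_commute) (simp only: cinner_adj[OF A])

lemma clin_adj [simp]:
  assumes "clin A" shows "clin (adj A)"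
  unfolding clin_def
  by (rule allI, rule allI, rule cinner_right_ext) (simp add: cinner_adj[OF assms, symmetric] cinner_scaleC_right)

lemma adj_adj [simp]: "clin A \<Longrightarrow> adj (adj A) = A"
  by (rule adj_unique) (rule cinner_adj')

lemma adj_compose: "clin A \<Longrightarrow> clin B \<Longrightarrow> adj (A o\<^sub>L B) = adj B o\<^sub>L adj A"
  by (rule adj_unique) (simp add: cinner_adj)

lemma adj_id [simp]: "adj id_blinfun = id_blinfun"
  by (rule adj_unique) simp

lemma adj_zero [simp]: "adj 0 = 0"
  by (rule adj_unique) simp

lemma adj_sum: "(\<And>i. i \<in> S \<Longrightarrow> clin (f i)) \<Longrightarrow> adj (sum f S) = (\<Sum>i\<in>S. adj (f i))"
  by (rule adj_unique)
    (simp add: blinfun.sum_left cinner_sum_left cinner_sum_right cinner_adj)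

lemma adj_oproj: "closed_csubspace M \<Longrightarrow> adj (oproj M) = oproj M"
  by (rule adj_unique) (rule oproj_selfadjoint)

lemma norm_oproj_le:
  assumes M: "closed_csubspace M" shows "norm (oproj M x) \<le> norm (x::'a::complex_hilbert)"
proof -
  have "(norm (oproj M x))\<^sup>2 = Re (cinner x (oproj M x))"
    using oproj_selfadjoint[OF M, of x "oproj M x"] oproj_fix[OF M oproj_in[OF M, of x]]
    by (simp add: norm_square_cinner)
  also have "\<dots> \<le> norm x * norm (oproj M x)"
    by (rule Re_cinner_le)
  finally show ?thesis
    by (cases "oproj M x = 0") (auto simp: power2_eq_square)
qed

lemma norm_adj_le:
  assumes A: "clin A" shows "norm (adj A) \<le> norm A"
proof (rule norm_blinfun_bound)
  fix y
  have "(norm (adj A y))\<^sup>2 = Re (cinner (A (adj A y)) y)"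
    by (simp add: cinner_adj[OF A] norm_square_cinner)
  also have "\<dots> \<le> norm (A (adj A y)) * norm y" by (rule Re_cinner_le)
  also have "\<dots> \<le> norm A * norm (adj A y) * norm y" by (intro mult_right_mono norm_blinfun) auto
  finally have "norm (adj A y) * norm (adj A y) \<le> norm (adj A y) * (norm A * norm y)"
    by (simp add: power2_eq_square ac_simps)
  then show "norm (adj A y) \<le> norm A * norm y"
    using mult_left_le_imp_le[of "norm (adj A y)" "norm (adj A y)" "norm A * norm y"]
    by (cases "adj A y = 0") simp_all
qed simp

text \<open>The column operator with entries \<open>adj (A i)\<close> is the adjoint of a row operator, and the operator on the
  right-hand side is the row times its adjoint.\<close>

lemma sum_norm_adj_le:
  assumes A: "\<And>i. i \<in> I \<Longrightarrow> clin (A i)"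
  shows "(\<Sum>i\<in>I. (norm (adj (A i) f))\<^sup>2) \<le> norm (\<Sum>i\<in>I. A i o\<^sub>L adj (A i)) * (norm f)\<^sup>2"
proof -
  let ?B = "\<Sum>i\<in>I. A i o\<^sub>L adj (A i)"
  have "(\<Sum>i\<in>I. (norm (adj (A i) f))\<^sup>2) = Re (cinner (?B f) f)"
    by (simp add: blinfun.sum_left cinner_sum_left cinner_adj A norm_square_cinner)
  also have "\<dots> \<le> norm (?B f) * norm f" by (rule Re_cinner_le)
  also have "\<dots> \<le> norm ?B * norm f * norm f" by (intro mult_right_mono norm_blinfun) auto
  finally show ?thesis by (simp add: power2_eq_square mult.assoc)
qed

text \<open>Complex polarization: with \<open>a\<close>, \<open>b\<close> the inner products of \<open>Q x\<close> with \<open>y\<close> and of \<open>Q y\<close> with \<open>x\<close>, the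
  hypothesis at \<open>x + y\<close> gives \<open>a + b = 0\<close>, and at \<open>x + \<i> y\<close> it gives \<open>a = b\<close>.\<close>

lemma quadratic_form_zero:
  assumes Q: "clin Q" and 0: "\<And>x. cinner (Q x) x = 0"
  shows "Q = 0"
proof (rule blinfun_eqI, rule cinner_left_ext)
  fix x y
  have 1: "cinner (Q x) y + cinner (Q y) x = 0"
    using 0[of "x + y"] 0[of x] 0[of y]
    by (simp add: blinfun.add_right cinner_add_left cinner_add_right add.commute)
  have "- \<i> * cinner (Q x) y + \<i> * cinner (Q y) x = 0"
    using 0[of "x + \<i> *\<^sub>C y"] 0[of x] 0[of y]
    by (simp add: blinfun.add_right cinner_add_left cinner_add_right clinD[OF Q]
        cinner_scaleC_left cinner_scaleC_right)
  then have "\<i> * (cinner (Q y) x - cinner (Q x) y) = 0" by (simp add: algebra_simps)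
  then have "cinner (Q y) x = cinner (Q x) y" by simp
  with 1 show "cinner (Q x) y = cinner (blinfun_apply 0 x) y" by simp
qed

lemma positive_selfadjoint:
  assumes "positive_on UNIV S"
  shows "clin S" "adj S = S"
proof -
  show S: "clin S" using assms by (simp add: positive_on_def bop_UNIV)
  have "S - adj S = 0"
  proof (rule quadratic_form_zero)
    fix x
    have "cinner (S x) x \<in> \<real>" using assms nonneg_Reals_subset_Reals by (auto simp: positive_on_def)
    then have "cinner (S x) x = cnj (cinner (S x) x)" by (metis Reals_cnj_iff)
    then show "cinner ((S - adj S) x) x = 0"
      by (simp add: blinfun.diff_left cinner_diff_left cinner_adj'[OF S] cinner_commute[symmetric])
  qed (simp add: S)
  then show "adj S = S" by simp
qed

subsection \<open>Square roots of positive operators\<close>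

text \<open>If \<open>R = (B + R\<^sup>2) / 2\<close> then \<open>(I - R)\<^sup>2 = I - B\<close>. The fixed point is reached by iteration from \<open>0\<close>;
  the scalar iteration for \<open>B = 1\<close>, which increases to a limit at most \<open>1\<close>, dominates the increments of the
  one for any \<open>B\<close> of norm at most \<open>1\<close>. Since every iterate is a polynomial in \<open>B\<close>, intertwining relations
  are inherited by the square root.\<close>

fun sqrt_iter :: "('a::complex_hilbert \<Rightarrow>\<^sub>L 'a) \<Rightarrow> nat \<Rightarrow> 'a \<Rightarrow>\<^sub>L 'a" where
  "sqrt_iter B 0 = 0"
| "sqrt_iter B (Suc k) = (1/2) *\<^sub>R (B + (sqrt_iter B k o\<^sub>L sqrt_iter B k))"

fun sqrt_majorant :: "nat \<Rightarrow> real" where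
  "sqrt_majorant 0 = 0"
| "sqrt_majorant (Suc k) = (1 + (sqrt_majorant k)\<^sup>2) / 2"

lemma sqrt_majorant_bounds: "0 \<le> sqrt_majorant k \<and> sqrt_majorant k \<le> 1"
proof (induction k)
  case (Suc k)
  then have "(sqrt_majorant k)\<^sup>2 \<le> 1" by (simp add: power_le_one)
  then show ?case by simp
qed simp

lemma sqrt_majorant_mono: "sqrt_majorant k \<le> sqrt_majorant (Suc k)"
  using sum_squares_bound[of "sqrt_majorant k" 1] by (simp add: field_simps)

lemma sqrt_iter_norm:
  assumes B: "norm B \<le> 1"
  shows "norm (sqrt_iter B k) \<le> sqrt_majorant k"
proof (induction k)
  case (Suc k)
  have "norm (sqrt_iter B k o\<^sub>L sqrt_iter B k) \<le> norm (sqrt_iter B k) * norm (sqrt_iter B k)"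
    by (rule norm_blinfun_compose)
  also have "\<dots> \<le> sqrt_majorant k * sqrt_majorant k"
    using Suc sqrt_majorant_bounds[of k] by (intro mult_mono) auto
  finally have "norm (B + (sqrt_iter B k o\<^sub>L sqrt_iter B k)) \<le> 1 + (sqrt_majorant k)\<^sup>2"
    using B norm_triangle_le[of B "sqrt_iter B k o\<^sub>L sqrt_iter B k" "1 + (sqrt_majorant k)\<^sup>2"]
    by (simp add: power2_eq_square)
  then show ?case by simp
qed simp

text \<open>\<open>R'\<^sup>2 - R\<^sup>2 = R' (R' - R) + (R' - R) R\<close> holds without commutativity, and in the scalar case it is an
  equality of the same shape.\<close>

lemma sqrt_iter_diff:
  assumes B: "norm B \<le> 1"
  shows "norm (sqrt_iter B (Suc k) - sqrt_iter B k) \<le> sqrt_majorant (Suc k) - sqrt_majorant k"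
proof (induction k)
  case 0
  then show ?case using B by simp
next
  case (Suc k)
  let ?R = "sqrt_iter B k" and ?R' = "sqrt_iter B (Suc k)"
  let ?r = "sqrt_majorant k" and ?r' = "sqrt_majorant (Suc k)"
  have "sqrt_iter B (Suc (Suc k)) - ?R' = (1/2) *\<^sub>R ((?R' o\<^sub>L ?R') - (?R o\<^sub>L ?R))"
    by (subst sqrt_iter.simps(2), subst (3) sqrt_iter.simps(2)) (simp add: algebra_simps)
  also have "(?R' o\<^sub>L ?R') - (?R o\<^sub>L ?R) = (?R' o\<^sub>L (?R' - ?R)) + ((?R' - ?R) o\<^sub>L ?R)"
    by (intro blinfun_eqI) (simp add: blinfun.bilinear_simps del: sqrt_iter.simps)
  finally have eq: "sqrt_iter B (Suc (Suc k)) - ?R' = (1/2) *\<^sub>R ((?R' o\<^sub>L (?R' - ?R)) + ((?R' - ?R) o\<^sub>L ?R))" .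
  have "norm (?R' o\<^sub>L (?R' - ?R)) \<le> ?r' * (?r' - ?r)"
    using Suc sqrt_iter_norm[OF B, of "Suc k"] sqrt_majorant_bounds[of "Suc k"]
    by (intro order_trans[OF norm_blinfun_compose] mult_mono) (auto simp del: sqrt_iter.simps sqrt_majorant.simps)
  moreover have "norm ((?R' - ?R) o\<^sub>L ?R) \<le> (?r' - ?r) * ?r"
    using Suc sqrt_iter_norm[OF B, of k] sqrt_majorant_bounds[of k] sqrt_majorant_mono[of k]
    by (intro order_trans[OF norm_blinfun_compose] mult_mono) (auto simp del: sqrt_iter.simps sqrt_majorant.simps)
  ultimately have "norm ((?R' o\<^sub>L (?R' - ?R)) + ((?R' - ?R) o\<^sub>L ?R)) \<le> ?r' * (?r' - ?r) + (?r' - ?r) * ?r"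
    by (rule norm_triangle_mono)
  also have "\<dots> = ?r'\<^sup>2 - ?r\<^sup>2" by (simp add: power2_eq_square algebra_simps)
  also have "\<dots> = 2 * (sqrt_majorant (Suc (Suc k)) - ?r')"
    by (subst sqrt_majorant.simps(2), subst (3) sqrt_majorant.simps(2)) (simp add: field_simps)
  finally show ?case unfolding eq by (simp del: sqrt_iter.simps sqrt_majorant.simps)
qed

lemma sqrt_iter_converges:
  fixes B :: "'a::complex_hilbert \<Rightarrow>\<^sub>L 'a"
  assumes B: "norm B \<le> 1"
  shows "convergent (sqrt_iter B)"
proof -
  have le: "norm (sqrt_iter B (k + j) - sqrt_iter B k) \<le> sqrt_majorant (k + j) - sqrt_majorant k" for k j
  proof (induction j)
    case (Suc j)
    have "norm (sqrt_iter B (k + Suc j) - sqrt_iter B k)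
      \<le> norm (sqrt_iter B (Suc (k + j)) - sqrt_iter B (k + j)) + norm (sqrt_iter B (k + j) - sqrt_iter B k)"
      by (rule order_trans[OF _ norm_triangle_ineq]) simp
    then show ?case using Suc sqrt_iter_diff[OF B, of "k + j"] by simp
  qed simp
  have "incseq sqrt_majorant" by (rule incseq_SucI) (rule sqrt_majorant_mono)
  then have "convergent sqrt_majorant"
    using sqrt_majorant_bounds by (meson incseq_convergent convergentI)
  then have "Cauchy sqrt_majorant" by (rule convergent_Cauchy)
  have "Cauchy (sqrt_iter B)"
  proof (rule metric_CauchyI)
    fix e :: real assume "e > 0"
    then obtain N where N: "\<And>m n. m \<ge> N \<Longrightarrow> n \<ge> N \<Longrightarrow> dist (sqrt_majorant m) (sqrt_majorant n) < e / 2"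
      using \<open>Cauchy sqrt_majorant\<close> half_gt_zero unfolding Cauchy_def by metis
    have near: "dist (sqrt_iter B m) (sqrt_iter B N) < e / 2" if "m \<ge> N" for m
      using le[of N "m - N"] N[OF that order_refl] that
        abs_ge_self[of "sqrt_majorant m - sqrt_majorant N"] by (simp add: dist_norm)
    have "dist (sqrt_iter B m) (sqrt_iter B n) < e" if "m \<ge> N" "n \<ge> N" for m n
      using near[OF that(1)] near[OF that(2)] by (rule dist_triangle_half_l)
    then show "\<exists>N. \<forall>m\<ge>N. \<forall>n\<ge>N. dist (sqrt_iter B m) (sqrt_iter B n) < e" by blast
  qed
  then show ?thesis by (rule Cauchy_convergent)
qed

lemma sqrt_iter_clin: "clin B \<Longrightarrow> clin (sqrt_iter B k)"
  by (induction k) auto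

lemma sqrt_iter_intertwine:
  assumes "C o\<^sub>L B' = B o\<^sub>L C"
  shows "C o\<^sub>L sqrt_iter B' k = sqrt_iter B k o\<^sub>L C"
proof (induction k)
  case 0
  then show ?case by (intro blinfun_eqI) (simp add: blinfun.zero_right)
next
  case (Suc k)
  have 1: "C (B' x) = B (C x)" for x using assms by (metis blinfun_apply_blinfun_compose)
  have 2: "C (sqrt_iter B' k x) = sqrt_iter B k (C x)" for x
    using Suc by (metis blinfun_apply_blinfun_compose)
  show ?case by (intro blinfun_eqI) (simp add: blinfun.bilinear_simps 1 2)
qed

lemma sqrt_iter_adj:
  assumes "clin B" "adj B = B"
  shows "cinner (sqrt_iter B k x) y = cinner x (sqrt_iter B k y)"
proof (induction k arbitrary: x y)
  case (Suc k)
  then show ?case using cinner_adj[OF assms(1)] assms(2)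
    by (simp add: blinfun.bilinear_simps cinner_add_left cinner_add_right cinner_scaleR_left cinner_scaleR_right)
qed simp

text \<open>Two positive square roots of the same operator agree: with \<open>D = S - S'\<close> and \<open>S\<close>, \<open>S'\<close> commuting,
  the sum of the positive operators \<open>D S D\<close> and \<open>D S' D\<close> is \<open>D (S\<^sup>2 - S'\<^sup>2) = 0\<close>. So both are \<open>0\<close>, and so is
  their difference \<open>D\<^sup>3\<close>.\<close>

lemma positive_sqrt_unique:
  fixes S S' :: "'a::complex_hilbert \<Rightarrow>\<^sub>L 'a"
  assumes S: "positive_on UNIV S" and S': "positive_on UNIV S'"
    and comm: "S o\<^sub>L S' = S' o\<^sub>L S" and eq: "S o\<^sub>L S = S' o\<^sub>L S'"
  shows "S = S'"
proof -
  define D where "D = S - S'"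
  note lin = positive_selfadjoint(1)[OF S] positive_selfadjoint(1)[OF S']
  have D: "clin D" using lin by (simp add: D_def)
  have com: "S (S' x) = S' (S x)" for x using comm by (metis blinfun_apply_blinfun_compose)
  have sq: "S (S x) = S' (S' x)" for x using eq by (metis blinfun_apply_blinfun_compose)
  have Dsa: "cinner (D x) y = cinner x (D y)" for x y
    using positive_selfadjoint[OF S] positive_selfadjoint[OF S']
    by (simp add: D_def blinfun.diff_left cinner_diff_left cinner_diff_right cinner_adj)
  have nn: "0 \<le> Re (cinner (S x) x)" "0 \<le> Re (cinner (S' x) x)"
      "Im (cinner (S x) x) = 0" "Im (cinner (S' x) x) = 0" for x
    using S S' by (auto simp: positive_on_def complex_nonneg_Reals_iff)
  have sum0: "S (D x) + S' (D x) = 0" for x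
    by (simp add: D_def blinfun.diff_left blinfun.diff_right com sq)
  have s: "cinner (S (D x)) (D x) + cinner (S' (D x)) (D x) = 0" for x
    unfolding cinner_add_left[symmetric] by (simp add: sum0)
  have z: "cinner (S (D x)) (D x) = 0 \<and> cinner (S' (D x)) (D x) = 0" for x
    using nn[of "D x"] s[of x] by (auto simp: complex_eq_iff)
  have "D o\<^sub>L S o\<^sub>L D = 0"
    by (rule quadratic_form_zero) (use z lin D in \<open>auto simp: Dsa\<close>)
  moreover have "D o\<^sub>L S' o\<^sub>L D = 0"
    by (rule quadratic_form_zero) (use z lin D in \<open>auto simp: Dsa\<close>)
  ultimately have "D (S (D x)) = 0" "D (S' (D x)) = 0" for x
    by (metis blinfun_apply_blinfun_compose blinfun.zero_left)+
  then have D3: "D (D (D x)) = 0" for x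
    by (subst (2) D_def) (simp add: blinfun.diff_left blinfun.diff_right)
  have D2: "D (D x) = 0" for x
    using D3[of x] Dsa[of "D x" "D (D x)"] by simp
  have "D x = 0" for x
    using D2[of x] Dsa[of x "D x"] by simp
  then have "D = 0" by (intro blinfun_eqI) simp
  then show ?thesis by (simp add: D_def)
qed

text \<open>The positive operators \<open>I - B\<close> with these \<open>B\<close> include the two whose roots are the defect operators.\<close>

locale selfadjoint_contraction =
  fixes B :: "'a::complex_hilbert \<Rightarrow>\<^sub>L 'a"
  assumes lin: "clin B" and sa: "adj B = B" and contr: "norm B \<le> 1"
begin

lemma sqrt_exists:
  "\<exists>S. positive_on UNIV S \<and> S o\<^sub>L S = id_blinfun - B \<and> sqrt_iter B \<longlonglongrightarrow> id_blinfun - S"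
proof -
  obtain R where R: "sqrt_iter B \<longlonglongrightarrow> R"
    using sqrt_iter_converges[OF contr] convergent_def by blast
  have clinR: "clin R" using R by (rule clin_lim) (rule sqrt_iter_clin[OF lin])
  have nR: "norm R \<le> 1"
  proof (rule LIMSEQ_le_const2)
    show "(\<lambda>k. norm (sqrt_iter B k)) \<longlonglongrightarrow> norm R" by (intro tendsto_intros R)
    show "\<exists>N. \<forall>n\<ge>N. norm (sqrt_iter B n) \<le> 1"
      using sqrt_iter_norm[OF contr] sqrt_majorant_bounds order_trans by blast
  qed
  have "sqrt_iter B (Suc k) = (1/2) *\<^sub>R (B + (sqrt_iter B k o\<^sub>L sqrt_iter B k))" for k by simp
  moreover have "(\<lambda>k. (1/2) *\<^sub>R (B + (sqrt_iter B k o\<^sub>L sqrt_iter B k))) \<longlonglongrightarrow> (1/2) *\<^sub>R (B + (R o\<^sub>L R))"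
    by (intro tendsto_intros R bounded_bilinear.tendsto[OF bounded_bilinear_blinfun_compose])
  ultimately have "R = (1/2) *\<^sub>R (B + (R o\<^sub>L R))"
    using LIMSEQ_Suc[OF R] LIMSEQ_unique by simp
  then have eqR: "R + R = B + (R o\<^sub>L R)"
    by (metis scaleR_half_double scaleR_right_distrib)
  have Rsa: "cinner (R x) y = cinner x (R y)" for x y
  proof (rule LIMSEQ_unique)
    show "(\<lambda>k. cinner (sqrt_iter B k x) y) \<longlonglongrightarrow> cinner (R x) y"
      by (intro cinner.tendsto tendsto_intros R)
    show "(\<lambda>k. cinner (sqrt_iter B k x) y) \<longlonglongrightarrow> cinner x (R y)"
      unfolding sqrt_iter_adj[OF lin sa] by (intro cinner.tendsto tendsto_intros R)
  qed
  have "positive_on UNIV (id_blinfun - R)"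
    unfolding positive_on_def bop_UNIV
  proof (intro conjI ballI)
    fix h :: 'a
    have "cinner (R h) h = cnj (cinner (R h) h)" by (metis Rsa cinner_commute)
    then have im: "Im (cinner (R h) h) = 0" by (simp add: complex_eq_iff)
    have "Re (cinner (R h) h) \<le> norm (R h) * norm h"
      by (rule Re_cinner_le)
    also have "\<dots> \<le> norm R * norm h * norm h" by (intro mult_right_mono norm_blinfun) auto
    also have "\<dots> \<le> 1 * norm h * norm h" by (intro mult_right_mono nR) auto
    finally show "cinner ((id_blinfun - R) h) h \<in> \<real>\<^sub>\<ge>\<^sub>0"
      using im by (simp add: blinfun.diff_left cinner_diff_left cinner_self complex_nonneg_Reals_iff
          power2_eq_square del: of_real_power of_real_mult)
  qed (simp add: clinR)
  moreover have "(id_blinfun - R) o\<^sub>L (id_blinfun - R) = id_blinfun - B"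
  proof -
    have "R x + R x = B x + R (R x)" for x
      using eqR by (metis blinfun.add_left blinfun_apply_blinfun_compose)
    then show ?thesis
      by (intro blinfun_eqI) (simp add: blinfun.diff_left blinfun.diff_right algebra_simps)
  qed
  ultimately show ?thesis
    by (intro exI[of _ "id_blinfun - R"]) (simp add: R)
qed

lemma
  shows sqrt_positive: "positive_on UNIV (sqrt_op (id_blinfun - B))"
    and sqrt_square: "sqrt_op (id_blinfun - B) o\<^sub>L sqrt_op (id_blinfun - B) = id_blinfun - B"
    and sqrt_iter_lim: "sqrt_iter B \<longlonglongrightarrow> id_blinfun - sqrt_op (id_blinfun - B)"
proof -
  obtain S where S: "positive_on UNIV S" "S o\<^sub>L S = id_blinfun - B" "sqrt_iter B \<longlonglongrightarrow> id_blinfun - S"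
    using sqrt_exists by blast
  have "sqrt_op (id_blinfun - B) = S"
    unfolding sqrt_op_def
  proof (rule the_equality)
    \<comment> \<open>A competing root commutes with its square, hence with \<open>B\<close>, hence with the limit \<open>S\<close>.\<close>
    fix S' assume S': "positive_on UNIV S' \<and> S' o\<^sub>L S' = id_blinfun - B"
    have "B = id_blinfun - (S' o\<^sub>L S')" using S' by simp
    then have "S' o\<^sub>L B = B o\<^sub>L S'"
      by (intro blinfun_eqI) (simp add: blinfun.diff_left blinfun.diff_right)
    then have 1: "S' o\<^sub>L sqrt_iter B k = sqrt_iter B k o\<^sub>L S'" for k by (rule sqrt_iter_intertwine)
    have "(\<lambda>k. S' o\<^sub>L sqrt_iter B k) \<longlonglongrightarrow> (S' o\<^sub>L (id_blinfun - S))"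
      by (intro bounded_bilinear.tendsto[OF bounded_bilinear_blinfun_compose] tendsto_const S)
    moreover have "(\<lambda>k. S' o\<^sub>L sqrt_iter B k) \<longlonglongrightarrow> ((id_blinfun - S) o\<^sub>L S')"
      unfolding 1 by (intro bounded_bilinear.tendsto[OF bounded_bilinear_blinfun_compose] tendsto_const S)
    ultimately have "S' o\<^sub>L (id_blinfun - S) = (id_blinfun - S) o\<^sub>L S'" by (rule LIMSEQ_unique)
    then have "(S' o\<^sub>L (id_blinfun - S)) x = ((id_blinfun - S) o\<^sub>L S') x" for x by simp
    then have "S' o\<^sub>L S = S o\<^sub>L S'"
      by (intro blinfun_eqI) (simp add: blinfun.diff_left blinfun.diff_right)
    then show "S' = S" using positive_sqrt_unique[of S' S] S S' by simp
  qed (use S in simp)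
  then show "positive_on UNIV (sqrt_op (id_blinfun - B))"
    "sqrt_op (id_blinfun - B) o\<^sub>L sqrt_op (id_blinfun - B) = id_blinfun - B"
    "sqrt_iter B \<longlonglongrightarrow> id_blinfun - sqrt_op (id_blinfun - B)"
    using S by auto
qed

end

text \<open>For the defect operators this gives \<open>T \<Delta>\<^sub>* = \<Delta> T\<close>.\<close>

lemma sqrt_op_intertwine:
  assumes B: "selfadjoint_contraction B" and B': "selfadjoint_contraction B'" and C: "C o\<^sub>L B' = B o\<^sub>L C"
  shows "C o\<^sub>L sqrt_op (id_blinfun - B') = sqrt_op (id_blinfun - B) o\<^sub>L C"
proof -
  have "(\<lambda>k. C o\<^sub>L sqrt_iter B' k) \<longlonglongrightarrow> (C o\<^sub>L (id_blinfun - sqrt_op (id_blinfun - B')))"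
    by (intro bounded_bilinear.tendsto[OF bounded_bilinear_blinfun_compose] tendsto_const
        selfadjoint_contraction.sqrt_iter_lim B')
  moreover have "(\<lambda>k. C o\<^sub>L sqrt_iter B' k) \<longlonglongrightarrow> ((id_blinfun - sqrt_op (id_blinfun - B)) o\<^sub>L C)"
    unfolding sqrt_iter_intertwine[OF C]
    by (intro bounded_bilinear.tendsto[OF bounded_bilinear_blinfun_compose] tendsto_const
        selfadjoint_contraction.sqrt_iter_lim B)
  ultimately have eq: "C o\<^sub>L (id_blinfun - sqrt_op (id_blinfun - B')) = (id_blinfun - sqrt_op (id_blinfun - B)) o\<^sub>L C"
    by (rule LIMSEQ_unique)
  have "(C o\<^sub>L (id_blinfun - sqrt_op (id_blinfun - B'))) x = ((id_blinfun - sqrt_op (id_blinfun - B)) o\<^sub>L C) x" for x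
    using eq by simp
  then show ?thesis
    by (intro blinfun_eqI) (simp add: blinfun.diff_left blinfun.diff_right)
qed

section \<open>Tensor products of operators\<close>

lemma norm_sum_orthogonal:
  fixes f :: "'i \<Rightarrow> 'a::complex_hilbert"
  assumes "finite U" "\<And>u v. u \<in> U \<Longrightarrow> v \<in> U \<Longrightarrow> u \<noteq> v \<Longrightarrow> cinner (f u) (f v) = 0"
  shows "(norm (sum f U))\<^sup>2 = (\<Sum>u\<in>U. (norm (f u))\<^sup>2)"
  using assms
proof (induction U rule: finite_induct)
  case (insert x U)
  have "cinner (f x) (sum f U) = (\<Sum>u\<in>U. cinner (f x) (f u))" by (rule cinner_sum_right)
  also have "\<dots> = 0" by (rule sum.neutral) (use insert in auto)
  finally show ?case using insert by (simp add: norm_add_square)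
qed simp

text \<open>Gram--Schmidt: the component of a new vector orthogonal to the system found so far is normalised and
  added to it.\<close>

lemma finite_orthonormal_expansion:
  assumes "finite (S :: 'a::complex_hilbert set)"
  shows "\<exists>U. finite U \<and> (\<forall>u\<in>U. \<forall>v\<in>U. cinner u v = (if u = v then 1 else 0)) \<and>
    (\<forall>x\<in>S. x = (\<Sum>u\<in>U. cinner x u *\<^sub>C u))"
  using assms
proof (induction S rule: finite_induct)
  case empty
  show ?case by (intro exI[of _ "{}"]) simp
next
  case (insert x S)
  then obtain U where U: "finite U" "\<And>u v. u \<in> U \<Longrightarrow> v \<in> U \<Longrightarrow> cinner u v = (if u = v then 1 else 0)"
    "\<And>s. s \<in> S \<Longrightarrow> s = (\<Sum>u\<in>U. cinner s u *\<^sub>C u)" by blast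
  define p where "p = (\<Sum>u\<in>U. cinner x u *\<^sub>C u)"
  define y where "y = x - p"
  show ?case
  proof (cases "y = 0")
    case True
    then show ?thesis using U by (intro exI[of _ U]) (auto simp: y_def p_def)
  next
    case False
    define v where "v = complex_of_real (1 / norm y) *\<^sub>C y"
    have "cinner p u = cinner x u" if "u \<in> U" for u
    proof -
      have "cinner p u = (\<Sum>w\<in>U. cinner x w * (if w = u then 1 else 0))"
        unfolding p_def cinner_sum_left by (rule sum.cong) (auto simp: cinner_scaleC_left U(2) that)
      also have "\<dots> = cinner x u" using U(1) that by (simp add: if_distrib cong: if_cong)
      finally show ?thesis .
    qed
    then have yu: "cinner y u = 0" if "u \<in> U" for u
      using that by (simp add: y_def cinner_diff_left)
    then have vu: "cinner v u = 0" "cinner u v = 0" if "u \<in> U" for u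
      using that by (simp_all add: v_def cinner_scaleC_left cinner_scaleC_right cinner_sym_zero[of u])
    have "norm v = 1" using False by (simp add: v_def norm_scaleC norm_divide)
    then have vv: "cinner v v = 1" by (simp add: cinner_self)
    have vU: "v \<notin> U" using vu(1)[of v] vv by auto
    have sv: "cinner s v = 0" if "s \<in> S" for s
    proof -
      have "cinner s v = (\<Sum>u\<in>U. cinner s u * cinner u v)"
        using arg_cong[OF U(3)[OF that], of "\<lambda>z. cinner z v"]
        by (simp add: cinner_sum_left cinner_scaleC_left)
      also have "\<dots> = 0" by (rule sum.neutral) (simp add: vu)
      finally show ?thesis .
    qed
    have "cinner p v = 0"
      unfolding p_def cinner_sum_left by (rule sum.neutral) (simp add: vu cinner_scaleC_left)
    then have "cinner x v = cinner y v" by (simp add: y_def cinner_diff_left)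
    also have "\<dots> = norm y"
      using False by (simp add: v_def cinner_scaleC_right cinner_self power2_eq_square)
    finally have "cinner x v *\<^sub>C v = y"
      using False by (simp add: v_def scaleC_scaleC scaleC_one)
    then have "x = (\<Sum>u\<in>insert v U. cinner x u *\<^sub>C u)"
      using U(1) vU by (simp add: y_def p_def)
    moreover have "s = (\<Sum>u\<in>insert v U. cinner s u *\<^sub>C u)" if "s \<in> S" for s
      using U(1) vU U(3)[OF that] by (simp add: sv[OF that])
    ultimately show ?thesis
      using U(1,2) vu vv vU by (intro exI[of _ "insert v U"]) auto
  qed
qed

subsection \<open>Elementary tensors\<close>

lemma tensor_add_left: "(g + g') \<otimes>\<^sub>h x = g \<otimes>\<^sub>h x + g' \<otimes>\<^sub>h x"
  by transfer (simp add: scaleC_add_left)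

lemma tensor_add_right: "g \<otimes>\<^sub>h (x + y) = g \<otimes>\<^sub>h x + g \<otimes>\<^sub>h y"
  by transfer (simp add: scaleC_add_right)

lemma tensor_scaleC_left: "(c *\<^sub>C g) \<otimes>\<^sub>h x = c *\<^sub>C (g \<otimes>\<^sub>h x)"
  by transfer (simp add: scaleC_scaleC scaleC_complex_def)

lemma tensor_scaleC_right: "g \<otimes>\<^sub>h (c *\<^sub>C x) = c *\<^sub>C (g \<otimes>\<^sub>h x)"
  by transfer (simp add: scaleC_scaleC mult.commute)

lemma norm_tensor: "norm (g \<otimes>\<^sub>h x) = norm g * norm x"
proof -
  have "(norm (g \<otimes>\<^sub>h x))\<^sup>2 = Re (cinner g g * cinner x x)"
    by (simp add: norm_square_cinner cinner_tensor)
  also have "\<dots> = (norm g * norm x)\<^sup>2"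
    by (simp add: cinner_self power_mult_distrib flip: of_real_mult of_real_power)
  finally show ?thesis by (simp add: power2_eq_iff_nonneg)
qed

interpretation tensor: bounded_bilinear
  "tensor :: ('i, complex) ell2 \<Rightarrow> 'a::complex_hilbert \<Rightarrow> ('i, 'a) ell2"
  by unfold_locales
    (auto simp: tensor_add_left tensor_add_right scaleR_scaleC tensor_scaleC_left tensor_scaleC_right
      norm_tensor intro!: exI[of _ 1])

lemma cinner_ket_tensor_right: "cinner f (ket i \<otimes>\<^sub>h x) = cinner (Rep_ell2 f i) x"
proof transfer
  fix f :: "'a \<Rightarrow> 'b" and i x
  have "(\<Sum>\<^sub>\<infinity>j. cinner (f j) ((if j = i then 1 else 0) *\<^sub>C x)) = (\<Sum>\<^sub>\<infinity>j\<in>{i}. cinner (f j) x)"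
    by (rule infsum_cong_neutral) (auto simp: scaleC_one)
  then show "(\<Sum>\<^sub>\<infinity>j. cinner (f j) ((if j = i then 1 else 0) *\<^sub>C x)) = cinner (f i) x" by simp
qed

lemma Rep_ket: "Rep_ell2 (ket i) j = (if j = i then 1 else 0)"
  by transfer simp

lemma Rep_tensor: "Rep_ell2 (g \<otimes>\<^sub>h x) i = Rep_ell2 g i *\<^sub>C x"
  by transfer simp

lemma ket_tensor_complex: "ket i \<otimes>\<^sub>h (c::complex) = c *\<^sub>C ket i"
  by transfer (auto simp: scaleC_complex_def)

lemma cinner_ket_ket: "cinner (ket i) (ket j) = (if i = j then 1 else 0)"
  using cinner_ket_tensor_right[of "ket i" j "1::complex"]
  by (simp add: ket_tensor_complex scaleC_one Rep_ket cinner_complex_def)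

lemma norm_ket: "norm (ket i) = 1"
  by (simp add: norm_eq_sqrt_inner inner_eq_Re_cinner cinner_ket_ket)

lemma ell2_ext: "(\<And>i. Rep_ell2 f i = Rep_ell2 g i) \<Longrightarrow> f = g"
  using Rep_ell2_inject by blast

text \<open>The squared distance from \<open>f\<close> to a finite partial sum is the tail of the series for the squared norm
  of \<open>f\<close>.\<close>

lemma ell2_expansion: "((\<lambda>i. ket i \<otimes>\<^sub>h Rep_ell2 f i) has_sum f) UNIV"
proof -
  let ?p = "\<lambda>i. (norm (Rep_ell2 f i))\<^sup>2"
  let ?S = "\<lambda>F. \<Sum>i\<in>F. ket i \<otimes>\<^sub>h Rep_ell2 f i"
  have eq: "(norm (f - ?S F))\<^sup>2 = (norm f)\<^sup>2 - sum ?p F" if "finite F" for F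
  proof -
    have "(norm (?S F))\<^sup>2 = sum ?p F"
      using that by (subst norm_sum_orthogonal)
        (auto simp: cinner_tensor cinner_ket_ket norm_square_cinner)
    moreover have "Re (cinner f (?S F)) = sum ?p F"
      by (simp add: cinner_sum_right cinner_ket_tensor_right norm_square_cinner)
    ultimately show ?thesis
      using norm_add_square[of f "- ?S F"] by (simp add: cinner_minus_right)
  qed
  have "?p summable_on UNIV" using Rep_ell2[of f] by simp
  then have "(sum ?p \<longlongrightarrow> (norm f)\<^sup>2) (finite_subsets_at_top UNIV)"
    unfolding ell2_norm_power2 by (rule infsum_tendsto)
  then have "((\<lambda>F. (norm f)\<^sup>2 - sum ?p F) \<longlongrightarrow> (norm f)\<^sup>2 - (norm f)\<^sup>2) (finite_subsets_at_top UNIV)"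
    by (intro tendsto_intros)
  moreover have "\<forall>\<^sub>F F in finite_subsets_at_top UNIV. (norm (f - ?S F))\<^sup>2 = (norm f)\<^sup>2 - sum ?p F"
    by (rule eventually_finite_subsets_at_top_weakI) (rule eq)
  ultimately have "((\<lambda>F. (norm (f - ?S F))\<^sup>2) \<longlongrightarrow> 0) (finite_subsets_at_top UNIV)"
    by (simp add: tendsto_cong)
  then have "((\<lambda>F. sqrt ((norm (f - ?S F))\<^sup>2)) \<longlongrightarrow> sqrt 0) (finite_subsets_at_top UNIV)"
    by (rule tendsto_real_sqrt)
  then have "((\<lambda>F. f - ?S F) \<longlongrightarrow> 0) (finite_subsets_at_top UNIV)"
    by (subst tendsto_norm_zero_iff[symmetric]) simp
  then have "((\<lambda>F. f - (f - ?S F)) \<longlongrightarrow> f - 0) (finite_subsets_at_top UNIV)"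
    by (intro tendsto_intros)
  then show ?thesis by (simp add: has_sum_def)
qed

lemma bounded_linear_eq_on_tensors:
  assumes A: "bounded_linear A" and B: "bounded_linear B"
    and eq: "\<And>i x. A (ket i \<otimes>\<^sub>h x) = B (ket i \<otimes>\<^sub>h x)"
  shows "A f = B f"
  using has_sum_bounded_linear[OF A ell2_expansion[of f]] has_sum_bounded_linear[OF B ell2_expansion[of f]]
  by (simp add: o_def eq has_sum_unique)

lemma orthogonal_to_tensors:
  assumes "\<And>i x. cinner f (ket i \<otimes>\<^sub>h x) = 0"
  shows "f = 0"
proof (rule ell2_ext)
  fix i
  show "Rep_ell2 f i = Rep_ell2 0 i"
    by (rule cinner_left_ext) (use assms[of i] in \<open>simp add: cinner_ket_tensor_right zero_ell2.rep_eq\<close>)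
qed

subsection \<open>The operator \<open>X \<otimes> A\<close>\<close>

text \<open>Expanding the vectors \<open>x s\<close> in a finite orthonormal system \<open>U\<close> turns the sum into an orthogonal
  one, \<open>\<Sum>u\<in>U. X (\<dots>) \<otimes> u\<close>, to whose terms the norm of \<open>X\<close> applies.\<close>

lemma norm_sum_tensor_le:
  assumes X: "clin X" and F: "finite F"
  shows "(norm (\<Sum>s\<in>F. X (ket s) \<otimes>\<^sub>h x s))\<^sup>2 \<le> (norm X)\<^sup>2 * (\<Sum>s\<in>F. (norm (x s))\<^sup>2)"
proof -
  obtain U where U: "finite U" "\<And>u v. u \<in> U \<Longrightarrow> v \<in> U \<Longrightarrow> cinner u v = (if u = v then 1 else 0)"
    and exp: "\<And>s. s \<in> F \<Longrightarrow> x s = (\<Sum>u\<in>U. cinner (x s) u *\<^sub>C u)"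
    using finite_orthonormal_expansion[of "x ` F"] F by auto
  define k where "k u = (\<Sum>s\<in>F. cinner (x s) u *\<^sub>C ket s)" for u
  have normU: "norm u = 1" if "u \<in> U" for u
    by (simp add: norm_eq_sqrt_inner inner_eq_Re_cinner U(2)[OF that that])
  have "(\<Sum>s\<in>F. X (ket s) \<otimes>\<^sub>h x s) = (\<Sum>s\<in>F. X (ket s) \<otimes>\<^sub>h (\<Sum>u\<in>U. cinner (x s) u *\<^sub>C u))"
    by (rule sum.cong[OF refl]) (subst exp, auto)
  also have "\<dots> = (\<Sum>s\<in>F. \<Sum>u\<in>U. X (cinner (x s) u *\<^sub>C ket s) \<otimes>\<^sub>h u)"
    by (simp add: tensor.sum_right tensor_scaleC_right tensor_scaleC_left clinD[OF X])
  also have "\<dots> = (\<Sum>u\<in>U. X (k u) \<otimes>\<^sub>h u)"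
    by (subst sum.swap) (simp add: k_def blinfun.sum_right tensor.sum_left)
  finally have "(norm (\<Sum>s\<in>F. X (ket s) \<otimes>\<^sub>h x s))\<^sup>2 = (\<Sum>u\<in>U. (norm (X (k u) \<otimes>\<^sub>h u))\<^sup>2)"
    using U by (simp add: norm_sum_orthogonal cinner_tensor)
  also have "\<dots> \<le> (\<Sum>u\<in>U. (norm X)\<^sup>2 * (norm (k u))\<^sup>2)"
  proof (rule sum_mono)
    fix u assume u: "u \<in> U"
    have "norm (X (k u) \<otimes>\<^sub>h u) \<le> norm X * norm (k u)"
      using norm_blinfun[of X "k u"] by (simp add: norm_tensor normU[OF u])
    then show "(norm (X (k u) \<otimes>\<^sub>h u))\<^sup>2 \<le> (norm X)\<^sup>2 * (norm (k u))\<^sup>2"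
      using power_mono[of "norm (X (k u) \<otimes>\<^sub>h u)" "norm X * norm (k u)" 2] by (simp add: power_mult_distrib)
  qed
  also have "\<dots> = (norm X)\<^sup>2 * (\<Sum>u\<in>U. \<Sum>s\<in>F. (cmod (cinner (x s) u))\<^sup>2)"
  proof -
    have "(norm (k u))\<^sup>2 = (\<Sum>s\<in>F. (cmod (cinner (x s) u))\<^sup>2)" for u
      unfolding k_def using F
      by (subst norm_sum_orthogonal)
        (auto simp: cinner_scaleC_left cinner_scaleC_right cinner_ket_ket norm_scaleC norm_ket)
    then show ?thesis by (simp add: sum_distrib_left)
  qed
  also have "(\<Sum>u\<in>U. \<Sum>s\<in>F. (cmod (cinner (x s) u))\<^sup>2) = (\<Sum>s\<in>F. (norm (x s))\<^sup>2)"
  proof (subst sum.swap, rule sum.cong[OF refl])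
    fix s assume s: "s \<in> F"
    have "(norm (x s))\<^sup>2 = (norm (\<Sum>u\<in>U. cinner (x s) u *\<^sub>C u))\<^sup>2" using exp[OF s] by simp
    also have "\<dots> = (\<Sum>u\<in>U. (norm (cinner (x s) u *\<^sub>C u))\<^sup>2)"
      using U by (intro norm_sum_orthogonal) (auto simp: cinner_scaleC_left cinner_scaleC_right)
    also have "\<dots> = (\<Sum>u\<in>U. (cmod (cinner (x s) u))\<^sup>2)"
      by (rule sum.cong) (auto simp: norm_scaleC normU)
    finally show "(\<Sum>u\<in>U. (cmod (cinner (x s) u))\<^sup>2) = (norm (x s))\<^sup>2" by simp
  qed
  finally show ?thesis .
qed

lemma summable_on_square_dominated:
  fixes f :: "'i \<Rightarrow> 'a::banach"
  assumes p: "p summable_on UNIV" "\<And>i. 0 \<le> p i" and C: "0 \<le> C"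
    and le: "\<And>F. finite F \<Longrightarrow> (norm (sum f F))\<^sup>2 \<le> C * sum p F"
  shows "f summable_on UNIV"
proof -
  have "\<exists>P. eventually P (finite_subsets_at_top UNIV) \<and> (\<forall>F F'. P F \<and> P F' \<longrightarrow> dist (sum f F) (sum f F') < e)"
    if e: "e > 0" for e
  proof -
    \<comment> \<open>\<open>C + 1\<close> instead of \<open>C\<close>, which may be \<open>0\<close>.\<close>
    define d where "d = (e / 2)\<^sup>2 / (C + 1)"
    have d: "d > 0" using e C by (simp add: d_def)
    obtain F0 where F0: "finite F0" "dist (sum p F0) (infsum p UNIV) \<le> d / 2"
      using infsum_finite_approximation[OF p(1), of "d / 2"] d by auto
    have near: "dist (sum f F) (sum f F0) < e / 2" if F: "finite F" "F0 \<subseteq> F" for F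
    proof -
      have "sum p F \<le> infsum p UNIV" by (rule finite_sum_le_infsum) (use F p in auto)
      moreover have "sum p (F - F0) = sum p F - sum p F0" using F by (simp add: sum_diff)
      ultimately have tail: "sum p (F - F0) < d"
        using F0(2) d unfolding dist_real_def by linarith
      have "(norm (sum f (F - F0)))\<^sup>2 \<le> C * sum p (F - F0)" using F by (intro le) auto
      also have "\<dots> \<le> C * d" using tail C by (intro mult_left_mono) auto
      also have "\<dots> < (C + 1) * d" using d by simp
      also have "\<dots> = (e / 2)\<^sup>2" using C by (simp add: d_def)
      finally have "norm (sum f (F - F0)) < e / 2" using e power2_less_imp_less[of _ "e/2"] by simp
      then show ?thesis using F by (simp add: sum_diff dist_norm)
    qed
    show ?thesis
    proof (intro exI[of _ "\<lambda>F. finite F \<and> F0 \<subseteq> F"] conjI allI impI)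
      show "eventually (\<lambda>F. finite F \<and> F0 \<subseteq> F) (finite_subsets_at_top UNIV)"
        using F0(1) by (auto simp: eventually_finite_subsets_at_top)
      show "dist (sum f F) (sum f F') < e" if "(finite F \<and> F0 \<subseteq> F) \<and> finite F' \<and> F0 \<subseteq> F'" for F F'
        using near[of F] near[of F'] that by (auto intro: dist_triangle_half_l)
    qed
  qed
  then have "cauchy_filter (filtermap (sum f) (finite_subsets_at_top UNIV))"
    by (simp add: cauchy_filter_metric_filtermap)
  moreover have "complete (UNIV::'a set)"
    by (meson Cauchy_convergent UNIV_I complete_def convergent_def)
  ultimately obtain L where "(sum f \<longlongrightarrow> L) (finite_subsets_at_top UNIV)"
    using complete_uniform[where S=UNIV] by (force simp add: filterlim_def)
  then show ?thesis using summable_on_def has_sum_def by blast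
qed

text \<open>The image of \<open>f\<close> is the sum of \<open>X (ket s) \<otimes> A (f s)\<close> over all \<open>s\<close>. The terms need not be absolutely
  summable, but the bound \<open>norm_sum_tensor_le\<close> on finite partial sums makes the series converge.\<close>

lemma tensor_op_exists:
  fixes X :: "('i, complex) ell2 \<Rightarrow>\<^sub>L ('i, complex) ell2" and A :: "'a::complex_hilbert \<Rightarrow>\<^sub>L 'b::complex_hilbert"
  assumes X: "clin X" and A: "clin A"
  shows "\<exists>R :: ('i, 'a) ell2 \<Rightarrow>\<^sub>L ('i, 'b) ell2. clin R \<and> norm R \<le> norm X * norm A \<and> (\<forall>g x. R (g \<otimes>\<^sub>h x) = X g \<otimes>\<^sub>h A x)"
proof -
  define h where "h f s = X (ket s) \<otimes>\<^sub>h A (Rep_ell2 f s)" for f :: "('i, 'a) ell2" and s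
  have bound: "(norm (sum (h f) F))\<^sup>2 \<le> (norm X)\<^sup>2 * (norm A)\<^sup>2 * (\<Sum>s\<in>F. (norm (Rep_ell2 f s))\<^sup>2)"
    if "finite F" for f F
  proof -
    have "(norm (sum (h f) F))\<^sup>2 \<le> (norm X)\<^sup>2 * (\<Sum>s\<in>F. (norm (A (Rep_ell2 f s)))\<^sup>2)"
      unfolding h_def by (rule norm_sum_tensor_le[OF X that])
    also have "\<dots> \<le> (norm X)\<^sup>2 * (\<Sum>s\<in>F. (norm A)\<^sup>2 * (norm (Rep_ell2 f s))\<^sup>2)"
      by (intro mult_left_mono sum_mono)
        (auto simp: norm_blinfun simp flip: power_mult_distrib intro!: power_mono)
    finally show ?thesis by (simp add: sum_distrib_left mult.assoc)
  qed
  define R where "R f = infsum (h f) UNIV" for f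
  have hs: "(h f has_sum R f) UNIV" for f
  proof -
    have "h f summable_on UNIV"
      by (rule summable_on_square_dominated[where p = "\<lambda>s. (norm (Rep_ell2 f s))\<^sup>2", OF _ _ _ bound])
        (use Rep_ell2[of f] in auto)
    then show ?thesis unfolding R_def by (rule has_sum_infsum)
  qed
  have add: "R (f + g) = R f + R g" for f g
  proof (rule has_sum_unique[OF hs])
    have "h (f + g) = (\<lambda>s. h f s + h g s)"
      by (auto simp: h_def plus_ell2.rep_eq blinfun.add_right tensor_add_right)
    then show "(h (f + g) has_sum R f + R g) UNIV"
      using has_sum_add[OF hs[of f] hs[of g]] by simp
  qed
  have scale: "R (c *\<^sub>C f) = c *\<^sub>C R f" for c f
  proof (rule has_sum_unique[OF hs])
    have "h (c *\<^sub>C f) = (\<lambda>s. c *\<^sub>C h f s)"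
      by (auto simp: h_def scaleC_ell2.rep_eq clinD[OF A] tensor_scaleC_right)
    then show "(h (c *\<^sub>C f) has_sum c *\<^sub>C R f) UNIV"
      using has_sum_bounded_linear[OF bounded_linear_scaleC_right hs[of f], of c] by (simp add: o_def)
  qed
  have norm: "norm (R f) \<le> norm f * (norm X * norm A)" for f
  proof (rule tendsto_upperbound)
    show "((\<lambda>F. norm (sum (h f) F)) \<longlongrightarrow> norm (R f)) (finite_subsets_at_top UNIV)"
      using hs[of f] unfolding has_sum_def by (rule tendsto_norm)
    show "\<forall>\<^sub>F F in finite_subsets_at_top UNIV. norm (sum (h f) F) \<le> norm f * (norm X * norm A)"
    proof (rule eventually_finite_subsets_at_top_weakI)
      fix F :: "'i set" assume F: "finite F"
      have "(norm (sum (h f) F))\<^sup>2 \<le> (norm X)\<^sup>2 * (norm A)\<^sup>2 * (norm f)\<^sup>2"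
        by (rule order_trans[OF bound[OF F]]) (intro mult_left_mono ell2_sum_le_norm[OF F], simp)
      also have "\<dots> = (norm f * (norm X * norm A))\<^sup>2" by (simp add: power_mult_distrib)
      finally show "norm (sum (h f) F) \<le> norm f * (norm X * norm A)"
        by (rule power2_le_imp_le) simp
    qed
  qed simp
  have bl: "bounded_linear R"
    by (rule bounded_linear_intro[OF add _ norm]) (simp add: scaleR_scaleC scale)
  have "R (g \<otimes>\<^sub>h x) = X g \<otimes>\<^sub>h A x" for g x
  proof (rule has_sum_unique[OF hs])
    have blx: "bounded_linear (\<lambda>k. X k \<otimes>\<^sub>h A x)"
      by (intro bounded_linear_compose[OF tensor.bounded_linear_left] blinfun.bounded_linear_right)
    have "h (g \<otimes>\<^sub>h x) = (\<lambda>s. X (ket s \<otimes>\<^sub>h Rep_ell2 g s) \<otimes>\<^sub>h A x)"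
      by (auto simp: h_def Rep_tensor ket_tensor_complex clinD[OF A] clinD[OF X]
          tensor_scaleC_right tensor_scaleC_left)
    then show "(h (g \<otimes>\<^sub>h x) has_sum X g \<otimes>\<^sub>h A x) UNIV"
      using has_sum_bounded_linear[OF blx ell2_expansion[of g]] by (simp add: o_def)
  qed
  moreover have "norm (Blinfun R) \<le> norm X * norm A"
    by (rule norm_blinfun_bound) (use norm in \<open>auto simp: bounded_linear_Blinfun_apply[OF bl] mult.commute\<close>)
  ultimately show ?thesis
    by (intro exI[of _ "Blinfun R"]) (simp add: bounded_linear_Blinfun_apply[OF bl] clin_def scale)
qed

lemma tensor_op_eqI:
  fixes R R' :: "('i, 'a::complex_hilbert) ell2 \<Rightarrow>\<^sub>L 'b::complex_hilbert"
  assumes "\<And>g x. R (g \<otimes>\<^sub>h x) = R' (g \<otimes>\<^sub>h x)"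
  shows "R = R'"
  by (rule blinfun_eqI, rule bounded_linear_eq_on_tensors[OF blinfun.bounded_linear_right blinfun.bounded_linear_right])
    (rule assms)

lemma
  fixes X :: "('i, complex) ell2 \<Rightarrow>\<^sub>L ('i, complex) ell2" and A :: "'a::complex_hilbert \<Rightarrow>\<^sub>L 'b::complex_hilbert"
  assumes X: "clin X" and A: "clin A"
  shows tensor_op_tensor: "(X \<otimes>\<^sub>o A) (g \<otimes>\<^sub>h x) = X g \<otimes>\<^sub>h A x"
    and clin_tensor_op [simp]: "clin (X \<otimes>\<^sub>o A)"
    and norm_tensor_op: "norm (X \<otimes>\<^sub>o A) \<le> norm X * norm A"
proof -
  obtain R :: "('i, 'a) ell2 \<Rightarrow>\<^sub>L ('i, 'b) ell2"
    where R: "clin R" "norm R \<le> norm X * norm A" "\<And>g x. R (g \<otimes>\<^sub>h x) = X g \<otimes>\<^sub>h A x"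
    using tensor_op_exists[OF X A] by blast
  have "X \<otimes>\<^sub>o A = R"
    unfolding tensor_op_def by (rule the_equality) (auto simp: R(3) intro!: tensor_op_eqI)
  then show "(X \<otimes>\<^sub>o A) (g \<otimes>\<^sub>h x) = X g \<otimes>\<^sub>h A x" "clin (X \<otimes>\<^sub>o A)" "norm (X \<otimes>\<^sub>o A) \<le> norm X * norm A"
    using R by auto
qed

lemma tensor_op_compose:
  assumes "clin X" "clin Y" "clin A" "clin B"
  shows "(X \<otimes>\<^sub>o A) o\<^sub>L (Y \<otimes>\<^sub>o B) = (X o\<^sub>L Y) \<otimes>\<^sub>o (A o\<^sub>L B)"
  by (rule tensor_op_eqI) (simp add: tensor_op_tensor assms)

lemma tensor_op_sum_left:
  assumes "\<And>i. i \<in> S \<Longrightarrow> clin (X i)" "clin A"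
  shows "(\<Sum>i\<in>S. X i) \<otimes>\<^sub>o A = (\<Sum>i\<in>S. X i \<otimes>\<^sub>o A)"
  by (rule tensor_op_eqI) (simp add: tensor_op_tensor assms blinfun.sum_left tensor.sum_left)

lemma tensor_op_sum_right:
  assumes "clin X" "\<And>i. i \<in> S \<Longrightarrow> clin (A i)"
  shows "X \<otimes>\<^sub>o (\<Sum>i\<in>S. A i) = (\<Sum>i\<in>S. X \<otimes>\<^sub>o A i)"
  by (rule tensor_op_eqI) (simp add: tensor_op_tensor assms blinfun.sum_left tensor.sum_right)

lemma tensor_op_minus_right:
  assumes "clin X" "clin A"
  shows "X \<otimes>\<^sub>o (- A) = - (X \<otimes>\<^sub>o A)"
  by (rule tensor_op_eqI) (simp add: tensor_op_tensor assms blinfun.minus_left tensor.minus_right)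

lemma tensor_op_zero_left: "clin A \<Longrightarrow> 0 \<otimes>\<^sub>o A = 0"
  by (rule tensor_op_eqI) (simp add: tensor_op_tensor tensor.zero_left)

lemma tensor_op_zero_right: "clin X \<Longrightarrow> X \<otimes>\<^sub>o 0 = 0"
  by (rule tensor_op_eqI) (simp add: tensor_op_tensor tensor.zero_right)

lemma adj_tensor_op:
  fixes X :: "('i, complex) ell2 \<Rightarrow>\<^sub>L ('i, complex) ell2" and A :: "'a::complex_hilbert \<Rightarrow>\<^sub>L 'b::complex_hilbert"
  assumes X: "clin X" and A: "clin A"
  shows "adj (X \<otimes>\<^sub>o A) = adj X \<otimes>\<^sub>o adj A"
proof (rule tensor_op_eqI, rule cinner_right_ext)
  fix g x and f :: "('i, 'a) ell2"
  let ?l = "\<lambda>f. cinner f (adj (X \<otimes>\<^sub>o A) (g \<otimes>\<^sub>h x))" and ?r = "\<lambda>f. cinner f ((adj X \<otimes>\<^sub>o adj A) (g \<otimes>\<^sub>h x))"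
  show "?l f = ?r f"
  proof (rule bounded_linear_eq_on_tensors[of ?l ?r])
    show "?l (ket i \<otimes>\<^sub>h y) = ?r (ket i \<otimes>\<^sub>h y)" for i y
      using X A by (simp add: cinner_adj[symmetric] tensor_op_tensor cinner_tensor)
  qed (rule cinner.bounded_linear_left)+
qed

lemma oproj_tensor_space:
  fixes G :: "('i, complex) ell2 set"
  assumes G: "closed_csubspace G"
  shows "oproj (tensor_space G (UNIV :: 'a::complex_hilbert set)) = oproj G \<otimes>\<^sub>o id_blinfun"
proof -
  let ?S = "{g \<otimes>\<^sub>h x |g (x::'a). g \<in> G \<and> x \<in> UNIV}"
  let ?M = "tensor_space G (UNIV :: 'a set)" and ?P = "oproj G \<otimes>\<^sub>o (id_blinfun :: 'a \<Rightarrow>\<^sub>L 'a)"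
  have M: "closed_csubspace ?M" unfolding tensor_space_def by (rule closed_csubspace_closure_cspan)
  have oM: "ortho ?M = ortho ?S" unfolding tensor_space_def by (rule ortho_closure_cspan)
  have P: "clin ?P" "adj ?P = ?P" using G by (simp_all add: clin_oproj adj_tensor_op adj_oproj)
  show ?thesis
  proof (rule oproj_unique[OF M])
    fix f
    have "cinner (f - ?P f) (g \<otimes>\<^sub>h x) = 0" if "g \<in> G" for g x
    proof -
      have "cinner (?P f) (g \<otimes>\<^sub>h x) = cinner f (?P (g \<otimes>\<^sub>h x))"
        using cinner_adj[OF P(1)] P(2) by simp
      then show ?thesis
        by (simp add: cinner_diff_left tensor_op_tensor clin_oproj G oproj_fix that)
    qed
    then show "f - ?P f \<in> ortho ?M" unfolding oM by (auto simp: ortho_def)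
    have "cinner (?P f) k = 0" if k: "k \<in> ortho ?M" for k
    proof -
      have "?P k = 0"
      proof (rule orthogonal_to_tensors)
        fix i x
        have "cinner (?P k) (ket i \<otimes>\<^sub>h x) = cinner k (?P (ket i \<otimes>\<^sub>h x))"
          using cinner_adj[OF P(1)] P(2) by simp
        also have "\<dots> = cinner k (oproj G (ket i) \<otimes>\<^sub>h x)"
          by (simp add: tensor_op_tensor clin_oproj G)
        also have "\<dots> = 0" using k oproj_in[OF G, of "ket i"] unfolding oM by (auto simp: ortho_def)
        finally show "cinner (?P k) (ket i \<otimes>\<^sub>h x) = 0" .
      qed
      then show ?thesis using cinner_adj[OF P(1), of f k] P(2) by simp
    qed
    then have "?P f \<in> ortho (ortho ?M)" by (auto simp: ortho_def)
    then show "?P f \<in> ?M" by (simp add: ortho_ortho[OF M])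
  qed
qed

section \<open>Row contractions and their defect operators\<close>

lemma clin_vec_coord [simp]: "clin (vec_coord i)"
  by (simp add: clin_def vec_coord.rep_eq scaleC_vec_def)

lemma row_op_apply: "row_op X x = (\<Sum>i\<in>UNIV. X i (x $ i))"
  by (simp add: row_op_def blinfun.sum_left vec_coord.rep_eq)

lemma clin_row_op: "(\<And>i. clin (X i)) \<Longrightarrow> clin (row_op X)"
  unfolding row_op_def by (intro clin_sum clin_compose clin_vec_coord) auto

lemma adj_row_op:
  fixes T :: "'n::finite \<Rightarrow> 'h::complex_hilbert \<Rightarrow>\<^sub>L 'h"
  assumes T: "\<And>i. clin (T i)"
  shows "adj (row_op T) h $ i = adj (T i) h"
proof -
  have "cinner z (adj (row_op T) h) = cinner z (\<chi> i. adj (T i) h)" for z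
  proof -
    have "cinner z (adj (row_op T) h) = cinner (row_op T z) h"
      by (rule cinner_adj[OF clin_row_op[OF T], symmetric])
    then show ?thesis
      by (simp add: row_op_apply cinner_sum_left cinner_adj[OF T] cinner_vec_def)
  qed
  then have "adj (row_op T) h = (\<chi> i. adj (T i) h)" by (rule cinner_right_ext)
  then show ?thesis by simp
qed

lemma norm_vec_square: "(norm (x :: 'a::complex_hilbert ^ 'n))\<^sup>2 = (\<Sum>i\<in>UNIV. (norm (x $ i))\<^sup>2)"
  by (simp add: norm_square_cinner[of x] cinner_vec_def norm_square_cinner)

lemma word_op_Nil: "word_op M X [] = oproj M"
  by (simp add: word_op_def)

lemma word_op_Cons: "word_op M X (i # \<alpha>) = X i o\<^sub>L word_op M X \<alpha>"
  by (simp add: word_op_def)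

lemma clin_word_op: "closed_csubspace M \<Longrightarrow> (\<And>i. clin (X i)) \<Longrightarrow> clin (word_op M X \<alpha>)"
  by (induction \<alpha>) (simp_all add: word_op_Nil word_op_Cons clin_oproj)

lemma bop_oproj_left: "closed_csubspace N \<Longrightarrow> A \<in> bop M N \<Longrightarrow> oproj N o\<^sub>L A = A"
  by (rule blinfun_eqI) (simp add: bop_iff oproj_fix)

lemma bop_oproj_right:
  assumes M: "closed_csubspace M" and A: "A \<in> bop M N"
  shows "A o\<^sub>L oproj M = A"
proof (rule blinfun_eqI)
  fix x
  have "A (x - oproj M x) = 0" using A oproj_ortho[OF M] by (simp add: bop_iff)
  then show "(A o\<^sub>L oproj M) x = A x" by (simp add: blinfun.diff_right)
qed

lemma word_op_in:
  "closed_csubspace M \<Longrightarrow> (\<And>i. X i \<in> bop M M) \<Longrightarrow> word_op M X \<alpha> x \<in> M"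
  by (cases \<alpha>) (simp_all add: word_op_Nil word_op_Cons oproj_in bop_iff)

lemma word_op_append:
  assumes M: "closed_csubspace M" and X: "\<And>i. X i \<in> bop M M"
  shows "word_op M X (\<alpha> @ \<beta>) = word_op M X \<alpha> o\<^sub>L word_op M X \<beta>"
proof (induction \<alpha>)
  case Nil
  show ?case
    by (rule blinfun_eqI) (simp add: word_op_Nil oproj_fix[OF M] word_op_in M X)
next
  case (Cons i \<alpha>)
  then show ?case by (simp add: word_op_Cons blinfun_compose_assoc)
qed

lemma finite_words: "finite {\<alpha> :: 'n::finite list. length \<alpha> = k}"
  using finite_lists_length_eq[of "UNIV :: 'n set" k] by simp

lemma sum_words_Cons:
  "(\<Sum>\<alpha> | length (\<alpha> :: 'n::finite list) = Suc k. f \<alpha>) = (\<Sum>i\<in>UNIV. \<Sum>\<alpha> | length \<alpha> = k. f (i # \<alpha>))"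
proof -
  have "(\<Sum>\<alpha> | length (\<alpha> :: 'n list) = Suc k. f \<alpha>) = (\<Sum>(i, \<alpha>) \<in> UNIV \<times> {\<alpha>. length \<alpha> = k}. f (i # \<alpha>))"
    by (rule sum.reindex_bij_witness[where i = "\<lambda>(i, \<alpha>). i # \<alpha>" and j = "\<lambda>\<alpha>. (hd \<alpha>, tl \<alpha>)"])
      (auto simp: length_Suc_conv)
  then show ?thesis by (simp add: sum.cartesian_product)
qed

lemma sum_words_snoc:
  "(\<Sum>\<alpha> | length (\<alpha> :: 'n::finite list) = Suc k. f \<alpha>) = (\<Sum>\<alpha> | length \<alpha> = k. \<Sum>i\<in>UNIV. f (\<alpha> @ [i]))"
proof -
  have "(\<Sum>\<alpha> | length (\<alpha> :: 'n list) = Suc k. f \<alpha>) = (\<Sum>(\<alpha>, i) \<in> {\<alpha>. length \<alpha> = k} \<times> UNIV. f (\<alpha> @ [i]))"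
    by (rule sum.reindex_bij_witness[where i = "\<lambda>(\<alpha>, i). \<alpha> @ [i]" and j = "\<lambda>\<alpha>. (butlast \<alpha>, last \<alpha>)"])
      (auto simp: length_Suc_conv_rev)
  then show ?thesis by (simp add: sum.cartesian_product)
qed

text \<open>\<open>\<Delta>s\<close> is the defect operator \<open>\<Delta>\<^sub>*\<close> on \<open>\<H>\<^sup>n\<close>, and \<open>rowT\<close> is \<open>T\<close> as an operator from \<open>\<H>\<^sup>n\<close> to \<open>\<H>\<close>.\<close>

locale row_contraction_tuple =
  fixes T :: "'n::finite \<Rightarrow> 'h::complex_hilbert \<Rightarrow>\<^sub>L 'h"
  assumes rc: "row_contraction T"
begin

abbreviation "\<Delta> \<equiv> defect T"
abbreviation "\<Delta>s \<equiv> defect_star T"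
abbreviation "TT \<equiv> (\<Sum>i\<in>UNIV. T i o\<^sub>L adj (T i))"
abbreviation "rowT \<equiv> row_op T"
abbreviation "Tw \<equiv> word_op UNIV T"

lemma clin_T [simp]: "clin (T i)"
  using rc by (simp add: row_contraction_on_def bop_UNIV)

lemma clin_row [simp]: "clin rowT"
  by (rule clin_row_op) simp

lemma clin_Tw [simp]: "clin (Tw \<alpha>)"
  by (rule clin_word_op) simp_all

lemma row_adj_row: "rowT o\<^sub>L adj rowT = TT"
  by (rule blinfun_eqI) (simp add: row_op_apply adj_row_op blinfun.sum_left)

lemma sum_adj_T_le: "(\<Sum>i\<in>UNIV. (norm (adj (T i) h))\<^sup>2) \<le> (norm h)\<^sup>2"
proof -
  have "cinner ((id_blinfun - TT) h) h \<in> \<real>\<^sub>\<ge>\<^sub>0"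
    using rc by (simp add: row_contraction_on_def positive_on_def)
  then have "0 \<le> Re (cinner ((id_blinfun - TT) h) h)" by (simp add: complex_nonneg_Reals_iff)
  also have "\<dots> = (norm h)\<^sup>2 - (\<Sum>i\<in>UNIV. (norm (adj (T i) h))\<^sup>2)"
    by (simp add: blinfun.diff_left blinfun.sum_left cinner_diff_left cinner_sum_left cinner_adj
        norm_square_cinner)
  finally show ?thesis by simp
qed

lemma norm_adj_row: "norm (adj rowT) \<le> 1"
proof (rule norm_blinfun_bound)
  fix h
  have "(norm (adj rowT h))\<^sup>2 \<le> (norm h)\<^sup>2"
    using sum_adj_T_le[of h] by (simp add: norm_vec_square adj_row_op)
  then show "norm (adj rowT h) \<le> 1 * norm h" using power2_le_imp_le[of "norm (adj rowT h)" "norm h"] by simp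
qed simp

lemma norm_row: "norm rowT \<le> 1"
  using norm_adj_le[of "adj rowT"] norm_adj_row by simp

lemma selfadjoint_contraction_TT: "selfadjoint_contraction TT"
proof
  show "clin TT" by simp
  show "adj TT = TT" by (simp add: adj_sum adj_compose)
  have "norm (rowT o\<^sub>L adj rowT) \<le> norm rowT * norm (adj rowT)" by (rule norm_blinfun_compose)
  also have "\<dots> \<le> 1 * 1" by (intro mult_mono norm_row norm_adj_row) auto
  finally show "norm TT \<le> 1" by (simp add: row_adj_row)
qed

lemma selfadjoint_contraction_star: "selfadjoint_contraction (adj rowT o\<^sub>L rowT)"
proof
  show "clin (adj rowT o\<^sub>L rowT)" by simp
  show "adj (adj rowT o\<^sub>L rowT) = adj rowT o\<^sub>L rowT" by (simp add: adj_compose)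
  have "norm (adj rowT o\<^sub>L rowT) \<le> norm (adj rowT) * norm rowT" by (rule norm_blinfun_compose)
  also have "\<dots> \<le> 1 * 1" by (intro mult_mono norm_row norm_adj_row) auto
  finally show "norm (adj rowT o\<^sub>L rowT) \<le> 1" by simp
qed

lemma defect_props:
  shows clin_defect [simp]: "clin \<Delta>" and adj_defect [simp]: "adj \<Delta> = \<Delta>"
    and defect_square: "\<Delta> (\<Delta> h) = h - (\<Sum>i\<in>UNIV. T i (adj (T i) h))"
proof -
  have p: "positive_on UNIV \<Delta>" unfolding defect_def
    by (rule selfadjoint_contraction.sqrt_positive[OF selfadjoint_contraction_TT])
  show "clin \<Delta>" "adj \<Delta> = \<Delta>" using positive_selfadjoint[OF p] by auto
  have "\<Delta> o\<^sub>L \<Delta> = id_blinfun - TT" unfolding defect_def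
    by (rule selfadjoint_contraction.sqrt_square[OF selfadjoint_contraction_TT])
  then have "(\<Delta> o\<^sub>L \<Delta>) h = (id_blinfun - TT) h" by simp
  then show "\<Delta> (\<Delta> h) = h - (\<Sum>i\<in>UNIV. T i (adj (T i) h))"
    by (simp add: blinfun.diff_left blinfun.sum_left)
qed

lemma defect_star_props:
  shows clin_defect_star [simp]: "clin \<Delta>s" and adj_defect_star [simp]: "adj \<Delta>s = \<Delta>s"
    and defect_star_square: "\<Delta>s (\<Delta>s x) = x - adj rowT (rowT x)"
proof -
  have p: "positive_on UNIV \<Delta>s" unfolding defect_star_def
    by (rule selfadjoint_contraction.sqrt_positive[OF selfadjoint_contraction_star])
  show "clin \<Delta>s" "adj \<Delta>s = \<Delta>s" using positive_selfadjoint[OF p] by auto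
  have "\<Delta>s o\<^sub>L \<Delta>s = id_blinfun - (adj rowT o\<^sub>L rowT)" unfolding defect_star_def
    by (rule selfadjoint_contraction.sqrt_square[OF selfadjoint_contraction_star])
  then have "(\<Delta>s o\<^sub>L \<Delta>s) x = (id_blinfun - (adj rowT o\<^sub>L rowT)) x" by simp
  then show "\<Delta>s (\<Delta>s x) = x - adj rowT (rowT x)"
    by (simp add: blinfun.diff_left)
qed

lemma norm_defect: "(norm (\<Delta> h))\<^sup>2 = (norm h)\<^sup>2 - (\<Sum>i\<in>UNIV. (norm (adj (T i) h))\<^sup>2)"
proof -
  have "(norm (\<Delta> h))\<^sup>2 = Re (cinner (\<Delta> (\<Delta> h)) h)"
    using cinner_adj[OF clin_defect, of "\<Delta> h" h] by (simp only: norm_square_cinner adj_defect)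
  also have "\<dots> = (norm h)\<^sup>2 - (\<Sum>i\<in>UNIV. (norm (adj (T i) h))\<^sup>2)"
    by (simp only: defect_square cinner_diff_left cinner_sum_left cinner_adj[OF clin_T]
        norm_square_cinner minus_complex.sel Re_sum)
  finally show ?thesis .
qed

lemma norm_defect_star: "(norm (\<Delta>s x))\<^sup>2 = (norm x)\<^sup>2 - (norm (rowT x))\<^sup>2"
proof -
  have "(norm (\<Delta>s x))\<^sup>2 = Re (cinner (\<Delta>s (\<Delta>s x)) x)"
    using cinner_adj[OF clin_defect_star, of "\<Delta>s x" x] by (simp only: norm_square_cinner adj_defect_star)
  also have "\<dots> = (norm x)\<^sup>2 - (norm (rowT x))\<^sup>2"
    by (simp only: defect_star_square cinner_diff_left cinner_adj'[OF clin_row]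
        norm_square_cinner minus_complex.sel)
  finally show ?thesis .
qed

lemma row_defect_star: "rowT (\<Delta>s x) = \<Delta> (rowT x)"
proof -
  have "rowT o\<^sub>L (adj rowT o\<^sub>L rowT) = TT o\<^sub>L rowT"
    by (simp add: row_adj_row[symmetric] blinfun_compose_assoc)
  then have "rowT o\<^sub>L \<Delta>s = \<Delta> o\<^sub>L rowT"
    unfolding defect_def defect_star_def
    by (rule sqrt_op_intertwine[OF selfadjoint_contraction_TT selfadjoint_contraction_star])
  then have "(rowT o\<^sub>L \<Delta>s) x = (\<Delta> o\<^sub>L rowT) x" by (rule arg_cong)
  then show ?thesis by simp
qed

lemma closed_csubspace_defect_space: "closed_csubspace (defect_space T)"
  unfolding defect_space_def by (intro csubspace_closure csubspace_range) simp

lemma closed_csubspace_defect_star_space: "closed_csubspace (defect_star_space T)"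
  unfolding defect_star_space_def by (intro csubspace_closure csubspace_range) simp

text \<open>This is why the constant coefficient, a restriction of \<open>- T\<close>, has values in the defect space.\<close>

lemma row_defect_star_space:
  assumes "x \<in> defect_star_space T" shows "rowT x \<in> defect_space T"
proof -
  have "rowT ` closure (range \<Delta>s) \<subseteq> closure (range \<Delta>)"
  proof (rule image_closure_subset)
    show "continuous_on (closure (range \<Delta>s)) rowT"
      by (rule linear_continuous_on) (rule blinfun.bounded_linear_right)
    show "rowT ` range \<Delta>s \<subseteq> closure (range \<Delta>)"
      using closure_subset[of "range \<Delta>"] by (auto simp: row_defect_star)
  qed simp
  then show ?thesis using assms by (auto simp: defect_space_def defect_star_space_def)
qed

lemma defect_star_oproj: "\<Delta>s (oproj (defect_star_space T) x) = \<Delta>s x"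
proof -
  have z: "x - oproj (defect_star_space T) x \<in> ortho (defect_star_space T)"
    by (rule oproj_ortho[OF closed_csubspace_defect_star_space])
  have "\<Delta>s (x - oproj (defect_star_space T) x) = 0"
  proof (rule cinner_left_ext)
    fix w
    have "\<Delta>s w \<in> defect_star_space T"
      unfolding defect_star_space_def by (rule subsetD[OF closure_subset]) simp
    then have "cinner (x - oproj (defect_star_space T) x) (\<Delta>s w) = 0"
      using z unfolding ortho_def by blast
    then show "cinner (\<Delta>s (x - oproj (defect_star_space T) x)) w = cinner 0 w"
      by (simp only: cinner_adj[OF clin_defect_star] adj_defect_star cinner_zero_left)
  qed
  then have "\<Delta>s x - \<Delta>s (oproj (defect_star_space T) x) = 0" by (simp only: blinfun.diff_right)
  then show ?thesis unfolding right_minus_eq by (rule sym)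
qed

lemma Tw_append: "Tw (\<alpha> @ \<beta>) = Tw \<alpha> o\<^sub>L Tw \<beta>"
  by (rule word_op_append) (simp_all add: bop_UNIV)

lemma Tw_Nil [simp]: "Tw [] = id_blinfun"
  by (simp add: word_op_Nil)

lemma adj_Tw_Cons: "adj (Tw (i # \<alpha>)) h = adj (Tw \<alpha>) (adj (T i) h)"
  by (simp add: word_op_Cons adj_compose)

lemma adj_Tw_snoc: "adj (Tw (\<alpha> @ [i])) h = adj (T i) (adj (Tw \<alpha>) h)"
  by (simp add: Tw_append adj_compose word_op_Cons)

section \<open>The coefficients of the characteristic function\<close>

text \<open>The reversal of the word comes from \<open>T\<^sub>i\<^sup>* T\<^sub>j\<^sup>* = (T\<^sub>j T\<^sub>i)\<^sup>*\<close>.\<close>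

definition char_coeff :: "'n list \<Rightarrow> ('h ^ 'n) \<Rightarrow>\<^sub>L 'h" where
  "char_coeff \<alpha> = (if \<alpha> = [] then - (rowT o\<^sub>L oproj (defect_star_space T))
    else \<Delta> o\<^sub>L adj (Tw (rev (butlast \<alpha>))) o\<^sub>L vec_coord (last \<alpha>) o\<^sub>L (\<Delta>s o\<^sub>L oproj (defect_star_space T)))"

lemma clin_char_coeff [simp]: "clin (char_coeff \<alpha>)"
  by (simp add: char_coeff_def clin_oproj closed_csubspace_defect_star_space)

lemma char_coeff_bop: "char_coeff \<alpha> \<in> bop (defect_star_space T) (defect_space T)"
  unfolding bop_iff
proof (intro conjI allI ballI)
  fix x
  note D = closed_csubspace_defect_star_space
  show "char_coeff \<alpha> x \<in> defect_space T"
  proof (cases "\<alpha> = []")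
    case True
    then show ?thesis
      by (simp add: char_coeff_def blinfun.minus_left closed_csubspaceD(5)[OF closed_csubspace_defect_space]
          row_defect_star_space oproj_in[OF D])
  next
    case False
    then have "char_coeff \<alpha> x \<in> range \<Delta>" by (simp add: char_coeff_def)
    then show ?thesis unfolding defect_space_def by (rule subsetD[OF closure_subset])
  qed
  assume "x \<in> ortho (defect_star_space T)"
  then show "char_coeff \<alpha> x = 0"
    by (simp add: char_coeff_def oproj_ker[OF D] blinfun.minus_left blinfun.zero_right)
qed simp

end

text \<open>With the factors \<open>X\<^sub>i \<otimes> T\<^sub>i\<^sup>* = (X\<^sub>i \<otimes> I) (I \<otimes> T\<^sub>i\<^sup>*)\<close> the sum is a row of norm less than \<open>1\<close> times a
  column of norm at most \<open>1\<close>.\<close>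

lemma norm_row_tensor_adj_lt_1:
  fixes T :: "'n::finite \<Rightarrow> 'h::complex_hilbert \<Rightarrow>\<^sub>L 'h" and X :: "'n \<Rightarrow> ('s, complex) ell2 \<Rightarrow>\<^sub>L ('s, complex) ell2"
  assumes T: "row_contraction T" and X: "\<And>i. clin (X i)" and lt: "norm (\<Sum>i\<in>UNIV. X i o\<^sub>L adj (X i)) < 1"
  shows "norm (\<Sum>i\<in>UNIV. X i \<otimes>\<^sub>o adj (T i)) < 1"
proof -
  interpret row_contraction_tuple T by unfold_locales (rule T)
  let ?c = "norm (\<Sum>i\<in>UNIV. X i o\<^sub>L adj (X i))"
  let ?I = "id_blinfun :: ('s, complex) ell2 \<Rightarrow>\<^sub>L ('s, complex) ell2"
  let ?J = "id_blinfun :: 'h \<Rightarrow>\<^sub>L 'h"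
  let ?Z = "\<Sum>i\<in>UNIV. X i \<otimes>\<^sub>o adj (T i)"
  have a: "(\<Sum>i\<in>UNIV. (norm ((?I \<otimes>\<^sub>o adj (T i)) f))\<^sup>2) \<le> (norm f)\<^sup>2" for f
  proof -
    have "(\<Sum>i\<in>UNIV. (norm ((?I \<otimes>\<^sub>o adj (T i)) f))\<^sup>2) = (\<Sum>i\<in>UNIV. (norm (adj (?I \<otimes>\<^sub>o T i) f))\<^sup>2)"
      by (simp add: adj_tensor_op)
    also have "\<dots> \<le> norm (\<Sum>i\<in>UNIV. (?I \<otimes>\<^sub>o T i) o\<^sub>L adj (?I \<otimes>\<^sub>o T i)) * (norm f)\<^sup>2"
      by (rule sum_norm_adj_le) simp
    also have "(\<Sum>i\<in>UNIV. (?I \<otimes>\<^sub>o T i) o\<^sub>L adj (?I \<otimes>\<^sub>o T i)) = (?I o\<^sub>L ?I) \<otimes>\<^sub>o TT"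
      by (simp add: adj_tensor_op tensor_op_compose tensor_op_sum_right)
    also have "norm \<dots> * (norm f)\<^sup>2 \<le> 1 * (norm f)\<^sup>2"
    proof (rule mult_right_mono)
      have "norm ((?I o\<^sub>L ?I) \<otimes>\<^sub>o TT) \<le> norm (?I o\<^sub>L ?I) * norm TT" by (rule norm_tensor_op) simp_all
      also have "\<dots> \<le> 1 * 1"
      proof (rule mult_mono)
        show "norm (?I o\<^sub>L ?I) \<le> 1" by (rule norm_blinfun_bound) simp_all
        show "norm TT \<le> 1" using selfadjoint_contraction.contr[OF selfadjoint_contraction_TT] .
      qed simp_all
      finally show "norm ((?I o\<^sub>L ?I) \<otimes>\<^sub>o TT) \<le> 1" by simp
    qed simp
    finally show ?thesis by simp
  qed
  have b: "(\<Sum>i\<in>UNIV. (norm ((adj (X i) \<otimes>\<^sub>o ?J) k))\<^sup>2) \<le> ?c * (norm k)\<^sup>2" for k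
  proof -
    have "(\<Sum>i\<in>UNIV. (norm ((adj (X i) \<otimes>\<^sub>o ?J) k))\<^sup>2) = (\<Sum>i\<in>UNIV. (norm (adj (X i \<otimes>\<^sub>o ?J) k))\<^sup>2)"
      by (simp add: adj_tensor_op X)
    also have "\<dots> \<le> norm (\<Sum>i\<in>UNIV. (X i \<otimes>\<^sub>o ?J) o\<^sub>L adj (X i \<otimes>\<^sub>o ?J)) * (norm k)\<^sup>2"
      by (rule sum_norm_adj_le) (simp add: X)
    also have "(\<Sum>i\<in>UNIV. (X i \<otimes>\<^sub>o ?J) o\<^sub>L adj (X i \<otimes>\<^sub>o ?J)) = (\<Sum>i\<in>UNIV. X i o\<^sub>L adj (X i)) \<otimes>\<^sub>o (?J o\<^sub>L ?J)"
      by (simp add: adj_tensor_op tensor_op_compose tensor_op_sum_left X)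
    also have "norm \<dots> * (norm k)\<^sup>2 \<le> ?c * (norm k)\<^sup>2"
    proof (rule mult_right_mono)
      have "norm ((\<Sum>i\<in>UNIV. X i o\<^sub>L adj (X i)) \<otimes>\<^sub>o (?J o\<^sub>L ?J)) \<le> ?c * norm (?J o\<^sub>L ?J)"
        by (rule norm_tensor_op) (simp_all add: X)
      also have "\<dots> \<le> ?c * 1"
        by (intro mult_left_mono norm_blinfun_bound) simp_all
      finally show "norm ((\<Sum>i\<in>UNIV. X i o\<^sub>L adj (X i)) \<otimes>\<^sub>o (?J o\<^sub>L ?J)) \<le> ?c" by simp
    qed simp
    finally show ?thesis .
  qed
  have "norm ?Z \<le> sqrt ?c"
  proof (rule norm_blinfun_bound)
    fix f
    let ?k = "?Z f"
    have splt: "cinner ((X i \<otimes>\<^sub>o adj (T i)) f) ?k = cinner ((?I \<otimes>\<^sub>o adj (T i)) f) ((adj (X i) \<otimes>\<^sub>o ?J) ?k)" for i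
    proof -
      have "X i \<otimes>\<^sub>o adj (T i) = (X i \<otimes>\<^sub>o ?J) o\<^sub>L (?I \<otimes>\<^sub>o adj (T i))"
        by (subst tensor_op_compose) (simp_all add: X)
      then show ?thesis
        by (simp add: cinner_adj X adj_tensor_op)
    qed
    have "(norm ?k)\<^sup>2 = (\<Sum>i\<in>UNIV. Re (cinner ((X i \<otimes>\<^sub>o adj (T i)) f) ?k))"
      by (subst norm_square_cinner) (subst (1) blinfun.sum_left, simp add: cinner_sum_left)
    also have "\<dots> \<le> (\<Sum>i\<in>UNIV. \<bar>norm ((?I \<otimes>\<^sub>o adj (T i)) f)\<bar> * \<bar>norm ((adj (X i) \<otimes>\<^sub>o ?J) ?k)\<bar>)"
      unfolding splt abs_norm_cancel by (intro sum_mono Re_cinner_le)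
    also have "\<dots> \<le> L2_set (\<lambda>i. norm ((?I \<otimes>\<^sub>o adj (T i)) f)) UNIV * L2_set (\<lambda>i. norm ((adj (X i) \<otimes>\<^sub>o ?J) ?k)) UNIV"
      by (rule L2_set_mult_ineq)
    also have "\<dots> \<le> norm f * (sqrt ?c * norm ?k)"
    proof (rule mult_mono)
      show "L2_set (\<lambda>i. norm ((?I \<otimes>\<^sub>o adj (T i)) f)) UNIV \<le> norm f"
        unfolding L2_set_def using real_sqrt_le_mono[OF a[of f]] by simp
      show "L2_set (\<lambda>i. norm ((adj (X i) \<otimes>\<^sub>o ?J) ?k)) UNIV \<le> sqrt ?c * norm ?k"
        unfolding L2_set_def using real_sqrt_le_mono[OF b[of ?k]] by (simp add: real_sqrt_mult)
    qed (simp_all add: L2_set_nonneg)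
    finally have "norm ?k * norm ?k \<le> norm ?k * (sqrt ?c * norm f)"
      by (simp add: power2_eq_square ac_simps)
    then show "norm ?k \<le> sqrt ?c * norm f"
      using mult_left_le_imp_le[of "norm ?k" "norm ?k" "sqrt ?c * norm f"]
      by (cases "?k = 0") simp_all
  qed simp
  also have "\<dots> < 1" using lt by simp
  finally show ?thesis .
qed

section \<open>Power series expansion of the characteristic function\<close>

lemma inv_on_eqI:
  assumes M: "closed_csubspace M" and R: "R \<in> bop M M" and RA: "R o\<^sub>L A = oproj M" and AR: "A o\<^sub>L R = oproj M"
  shows "inv_on M A = R"
  unfolding inv_on_def
proof (rule the_equality)
  fix R' assume R': "R' \<in> bop M M \<and> R' o\<^sub>L A = oproj M \<and> A o\<^sub>L R' = oproj M"
  have "R' o\<^sub>L oproj M = R'" by (rule bop_oproj_right[OF M]) (use R' in blast)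
  then have "R' = R' o\<^sub>L (A o\<^sub>L R)" by (simp only: AR)
  also have "\<dots> = (R' o\<^sub>L A) o\<^sub>L R" by (simp only: blinfun_compose_assoc)
  also have "\<dots> = R" using R' bop_oproj_left[OF M R] by simp
  finally show "R' = R" .
qed (use assms in simp)

lemma summable_of_ratio_bound:
  fixes W :: "nat \<Rightarrow> 'a::banach"
  assumes "\<And>k. norm (W (Suc k)) \<le> c * norm (W k)" "0 \<le> c" "c < 1"
  shows "summable W"
proof (rule summable_comparison_test)
  have "norm (W k) \<le> norm (W 0) * c ^ k" for k
  proof (induction k)
    case (Suc k)
    have "norm (W (Suc k)) \<le> c * norm (W k)" by (rule assms(1))
    also have "\<dots> \<le> c * (norm (W 0) * c ^ k)" using Suc assms(2) by (rule mult_left_mono)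
    finally show ?case by (simp add: ac_simps)
  qed simp
  then show "\<exists>N. \<forall>n\<ge>N. norm (W n) \<le> norm (W 0) * c ^ n" by blast
  show "summable (\<lambda>n. norm (W 0) * c ^ n)"
    using assms by (intro summable_mult summable_geometric) simp
qed

context row_contraction_tuple
begin

text \<open>With \<open>P\<close> the identity of \<open>\<G> \<otimes> \<H>\<close> and \<open>Z = \<Sum>i. X\<^sub>i \<otimes> T\<^sub>i\<^sup>*\<close>, the power \<open>Z\<^sup>k P\<close> is the sum \<open>W k\<close> of
  \<open>X\<^sub>\<alpha> \<otimes> T\<^sub>\<gamma>\<^sup>*\<close> over the words \<open>\<alpha>\<close> of length \<open>k\<close> with reversals \<open>\<gamma>\<close>, and the \<open>W k\<close> add up to the
  inverse of \<open>P - Z\<close>. The row operator in the definition appends one letter, which accounts for the shift of the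
  index in \<open>FS\<close>.\<close>

lemma charfun_expansion:
  fixes G :: "('s, complex) ell2 set" and X :: "'n \<Rightarrow> ('s, complex) ell2 \<Rightarrow>\<^sub>L ('s, complex) ell2"
  assumes G: "closed_csubspace G" and X: "strict_row_contraction_on G X"
  shows "(\<lambda>k. \<Sum>\<alpha> | length \<alpha> = k. word_op G X \<alpha> \<otimes>\<^sub>o char_coeff \<alpha>) sums charfun T G X"
proof -
  have Xb: "X i \<in> bop G G" for i using X by (simp add: strict_row_contraction_on_def)
  have Xc [simp]: "clin (X i)" for i using Xb[of i] by (simp add: bop_iff)
  have Gc [simp]: "clin (oproj G)" using G by (rule clin_oproj)
  note Gl = bop_oproj_left[OF G Xb] and Gr = bop_oproj_right[OF G Xb]
  have wc [simp]: "clin (word_op G X \<alpha>)" for \<alpha> using G by (intro clin_word_op) simp_all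
  have GG: "oproj G o\<^sub>L oproj G = oproj G"
    by (rule blinfun_eqI) (simp add: oproj_fix[OF G] oproj_in[OF G])
  have wl: "oproj G o\<^sub>L word_op G X \<alpha> = word_op G X \<alpha>" for \<alpha>
    by (rule blinfun_eqI) (simp add: oproj_fix[OF G] word_op_in[where X = X, OF G Xb])
  have wr: "word_op G X \<alpha> o\<^sub>L oproj G = word_op G X \<alpha>" for \<alpha>
    using word_op_append[where X = X and \<alpha> = \<alpha> and \<beta> = "[]", OF G Xb] by (simp add: word_op_Nil)
  have w1: "word_op G X (\<alpha> @ [i]) = word_op G X \<alpha> o\<^sub>L X i" for \<alpha> i
    using word_op_append[where X = X and \<alpha> = \<alpha> and \<beta> = "[i]", OF G Xb] by (simp add: word_op_Nil word_op_Cons Gr)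
  define Ps where "Ps = oproj (defect_star_space T)"
  have Psc [simp]: "clin Ps" unfolding Ps_def by (rule clin_oproj[OF closed_csubspace_defect_star_space])
  let ?M = "tensor_space G (UNIV :: 'h set)"
  let ?J = "id_blinfun :: 'h \<Rightarrow>\<^sub>L 'h"
  define P where "P = oproj G \<otimes>\<^sub>o ?J"
  define Z where "Z = (\<Sum>i\<in>UNIV. X i \<otimes>\<^sub>o adj (T i))"
  define W where "W k = (\<Sum>\<alpha> | length \<alpha> = k. word_op G X \<alpha> \<otimes>\<^sub>o adj (Tw (rev \<alpha>)))" for k
  have M: "closed_csubspace ?M" unfolding tensor_space_def by (rule closed_csubspace_closure_cspan)
  have PM: "oproj ?M = P" unfolding P_def by (rule oproj_tensor_space[OF G])
  have W0: "W 0 = P" by (simp add: W_def P_def word_op_Nil)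
  have ZW: "W (Suc k) = Z o\<^sub>L W k" for k
  proof -
    have "Z o\<^sub>L W k = (\<Sum>i\<in>UNIV. \<Sum>\<alpha> | length \<alpha> = k. (X i \<otimes>\<^sub>o adj (T i)) o\<^sub>L (word_op G X \<alpha> \<otimes>\<^sub>o adj (Tw (rev \<alpha>))))"
      unfolding Z_def W_def
      by (rule blinfun_eqI) (simp add: blinfun.sum_left blinfun.sum_right, rule sum.swap)
    also have "\<dots> = (\<Sum>i\<in>UNIV. \<Sum>\<alpha> | length \<alpha> = k. word_op G X (i # \<alpha>) \<otimes>\<^sub>o adj (Tw (rev (i # \<alpha>))))"
      by (simp add: tensor_op_compose word_op_Cons Tw_append adj_compose)
    finally show ?thesis by (simp add: W_def sum_words_Cons)
  qed
  have PZ: "P o\<^sub>L Z = Z" "Z o\<^sub>L P = Z"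
  proof -
    have "P o\<^sub>L (X i \<otimes>\<^sub>o adj (T i)) = X i \<otimes>\<^sub>o adj (T i)" "(X i \<otimes>\<^sub>o adj (T i)) o\<^sub>L P = X i \<otimes>\<^sub>o adj (T i)" for i
      by (simp_all add: P_def tensor_op_compose Gl Gr)
    note this[THEN blinfun_compose_applyD]
    then show "P o\<^sub>L Z = Z" "Z o\<^sub>L P = Z"
      by (auto simp: Z_def blinfun.sum_left blinfun.sum_right intro!: blinfun_eqI)
  qed
  have WZ: "W (Suc k) = W k o\<^sub>L Z" for k
  proof (induction k)
    case 0
    show ?case by (simp add: ZW W0 PZ)
  next
    case (Suc k)
    have "W (Suc (Suc k)) = Z o\<^sub>L (W k o\<^sub>L Z)" using ZW[of "Suc k"] Suc by simp
    then show ?case by (simp add: ZW blinfun_compose_assoc)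
  qed
  have PP: "P o\<^sub>L P = P" by (simp add: P_def tensor_op_compose GG)
  have PW: "P o\<^sub>L W k = W k" "W k o\<^sub>L P = W k" for k
    by (induction k) (simp_all add: W0 PP ZW blinfun_compose_assoc[symmetric] PZ, simp add: ZW blinfun_compose_assoc)
  have lt: "norm Z < 1"
    unfolding Z_def using X by (intro norm_row_tensor_adj_lt_1 rc) (simp_all add: strict_row_contraction_on_def)
  have "summable W"
    by (rule summable_of_ratio_bound[OF _ _ lt]) (simp_all add: ZW norm_blinfun_compose)
  define R where "R = suminf W"
  have Rs: "W sums R" unfolding R_def using \<open>summable W\<close> by (rule summable_sums)
  have tail: "(\<lambda>k. W (Suc k)) sums (R - P)"
    using Rs W0 by (simp add: sums_Suc_iff)
  have left: "(\<lambda>k. A o\<^sub>L W k) sums (A o\<^sub>L R)" for A :: "('s, 'h) ell2 \<Rightarrow>\<^sub>L ('s, 'h) ell2"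
    by (rule bounded_linear.sums[OF _ Rs]) (rule bounded_bilinear.bounded_linear_right[OF bounded_bilinear_blinfun_compose])
  have right: "(\<lambda>k. W k o\<^sub>L A) sums (R o\<^sub>L A)" for A :: "('s, 'h) ell2 \<Rightarrow>\<^sub>L ('s, 'h) ell2"
    by (rule bounded_linear.sums[OF _ Rs]) (rule bounded_bilinear.bounded_linear_left[OF bounded_bilinear_blinfun_compose])
  have ZR: "Z o\<^sub>L R = R - P" using left[of Z] tail unfolding ZW[symmetric] by (rule sums_unique2)
  have RZ: "R o\<^sub>L Z = R - P" using right[of Z] tail unfolding WZ[symmetric] by (rule sums_unique2)
  have PR: "P o\<^sub>L R = R" using left[of P] Rs unfolding PW by (rule sums_unique2)
  have RP: "R o\<^sub>L P = R" using right[of P] Rs unfolding PW by (rule sums_unique2)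
  have Wc: "clin (W k)" for k unfolding W_def by simp
  have "clin R"
    by (rule clin_lim[OF Rs[unfolded sums_def]]) (simp add: Wc)
  have Rb: "R \<in> bop ?M ?M"
    unfolding bop_iff
  proof (intro conjI allI ballI)
    fix x
    have "P (R x) \<in> ?M" using oproj_in[OF M, of "R x"] by (simp only: PM)
    then show "R x \<in> ?M" by (simp only: blinfun_compose_applyD[OF PR])
    assume "x \<in> ortho ?M"
    then have "P x = 0" using oproj_ker[OF M, of x] by (simp only: PM)
    then have "R (P x) = 0" by (simp only: blinfun.zero_right)
    then show "R x = 0" by (simp only: blinfun_compose_applyD[OF RP])
  qed fact
  have inv: "inv_on ?M (P - Z) = R"
  proof (rule inv_on_eqI[OF M Rb])
    show "R o\<^sub>L (P - Z) = oproj ?M"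
      by (simp add: bounded_bilinear.diff_right[OF bounded_bilinear_blinfun_compose] RP RZ PM)
    show "(P - Z) o\<^sub>L R = oproj ?M"
      by (simp add: bounded_bilinear.diff_left[OF bounded_bilinear_blinfun_compose] PR ZR PM)
  qed
  define C where "C = (\<Sum>i\<in>UNIV. (X i \<otimes>\<^sub>o ?J) o\<^sub>L (oproj G \<otimes>\<^sub>o vec_coord i)) o\<^sub>L (oproj G \<otimes>\<^sub>o (\<Delta>s o\<^sub>L Ps))"
  have Cf: "C f = (\<Sum>i\<in>UNIV. (X i \<otimes>\<^sub>o (vec_coord i o\<^sub>L (\<Delta>s o\<^sub>L Ps))) f)" for f
  proof -
    have "(X i \<otimes>\<^sub>o ?J) o\<^sub>L (oproj G \<otimes>\<^sub>o vec_coord i) o\<^sub>L (oproj G \<otimes>\<^sub>o (\<Delta>s o\<^sub>L Ps)) = X i \<otimes>\<^sub>o (vec_coord i o\<^sub>L (\<Delta>s o\<^sub>L Ps))" for i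
      by (simp add: tensor_op_compose Gr)
    note this[THEN blinfun_compose3_applyD]
    then show ?thesis by (simp add: C_def blinfun.sum_left)
  qed
  let ?F = "\<lambda>k. \<Sum>\<alpha> | length \<alpha> = k. word_op G X \<alpha> \<otimes>\<^sub>o char_coeff \<alpha>"
  have FS: "?F (Suc k) = (oproj G \<otimes>\<^sub>o \<Delta>) o\<^sub>L W k o\<^sub>L C" for k
  proof (rule blinfun_eqI)
    fix f
    have tm: "(oproj G \<otimes>\<^sub>o \<Delta>) ((word_op G X \<alpha> \<otimes>\<^sub>o adj (Tw (rev \<alpha>))) ((X i \<otimes>\<^sub>o (vec_coord i o\<^sub>L (\<Delta>s o\<^sub>L Ps))) f))
      = (word_op G X (\<alpha> @ [i]) \<otimes>\<^sub>o char_coeff (\<alpha> @ [i])) f" for \<alpha> i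
    proof -
      have "(oproj G \<otimes>\<^sub>o \<Delta>) o\<^sub>L (word_op G X \<alpha> \<otimes>\<^sub>o adj (Tw (rev \<alpha>))) o\<^sub>L (X i \<otimes>\<^sub>o (vec_coord i o\<^sub>L (\<Delta>s o\<^sub>L Ps)))
        = word_op G X (\<alpha> @ [i]) \<otimes>\<^sub>o char_coeff (\<alpha> @ [i])"
        by (simp add: tensor_op_compose wl w1 char_coeff_def Ps_def[symmetric] blinfun_compose_assoc)
      then show ?thesis by (rule blinfun_compose3_applyD)
    qed
    show "?F (Suc k) f = ((oproj G \<otimes>\<^sub>o \<Delta>) o\<^sub>L W k o\<^sub>L C) f"
      by (simp add: sum_words_snoc Cf W_def blinfun.sum_left blinfun.sum_right tm, rule sum.swap)
  qed
  have "(\<lambda>k. (oproj G \<otimes>\<^sub>o \<Delta>) o\<^sub>L W k) sums ((oproj G \<otimes>\<^sub>o \<Delta>) o\<^sub>L R)"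
    by (rule bounded_linear.sums[OF bounded_bilinear.bounded_linear_right[OF bounded_bilinear_blinfun_compose] Rs])
  then have "(\<lambda>k. (oproj G \<otimes>\<^sub>o \<Delta>) o\<^sub>L W k o\<^sub>L C) sums ((oproj G \<otimes>\<^sub>o \<Delta>) o\<^sub>L R o\<^sub>L C)"
    by (rule bounded_linear.sums[OF bounded_bilinear.bounded_linear_left[OF bounded_bilinear_blinfun_compose]])
  then have "?F sums (((oproj G \<otimes>\<^sub>o \<Delta>) o\<^sub>L R o\<^sub>L C) + ?F 0)"
    unfolding FS[symmetric] by (rule sums_Suc)
  moreover have "?F 0 = - (oproj G \<otimes>\<^sub>o (rowT o\<^sub>L Ps))"
    by (simp add: char_coeff_def word_op_Nil tensor_op_minus_right Ps_def[symmetric])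
  moreover have "charfun T G X = - (oproj G \<otimes>\<^sub>o (rowT o\<^sub>L Ps)) + ((oproj G \<otimes>\<^sub>o \<Delta>) o\<^sub>L R o\<^sub>L C)"
    unfolding charfun_def C_def Ps_def[symmetric] inv[unfolded P_def Z_def] by (simp only: blinfun_compose_assoc)
  ultimately show ?thesis by (simp add: add.commute)
qed

end

subsection \<open>Uniqueness of the coefficients\<close>

text \<open>These are scaled left creation operators on a copy of the Fock space, indexed by words through \<open>f\<close>: \<open>X i\<close>
  maps the basis vector at \<open>\<beta>\<close> to \<open>r\<close> times the one at \<open>i # \<beta>\<close>. Truncation to the finitely many \<open>\<beta>\<close> with
  \<open>length \<beta> < k\<close> makes them finite sums of operators of rank one.\<close>

lemma truncated_creation_tuple:
  assumes inf: "infinite (UNIV :: 's set)"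
  shows "\<exists>(f :: 'n::finite list \<Rightarrow> 's) r X. inj f \<and> r \<noteq> 0 \<and> strict_row_contraction_on UNIV X \<and>
    (\<forall>\<alpha>. word_op UNIV X \<alpha> (ket (f [])) = (if length \<alpha> \<le> k then complex_of_real (r ^ length \<alpha>) *\<^sub>C ket (f \<alpha>) else 0))"
proof -
  have "countable (UNIV :: 'n list set)"
    using countable_lists[of "UNIV :: 'n set"] by (simp add: countable_finite)
  then obtain h :: "'n list \<Rightarrow> nat" where h: "inj h" by (auto simp: countable_def)
  obtain g :: "nat \<Rightarrow> 's" where g: "inj g" using inf infinite_iff_countable_subset[of "UNIV :: 's set"] by auto
  define f where "f = g \<circ> h"
  have f: "inj f" unfolding f_def using g h by (rule inj_compose)
  define L where "L = {\<beta> :: 'n list. length \<beta> < k}"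
  have L: "finite L" unfolding L_def
  proof (rule finite_subset)
    show "{\<beta> :: 'n list. length \<beta> < k} \<subseteq> {\<beta>. set \<beta> \<subseteq> UNIV \<and> length \<beta> \<le> k}" by auto
    show "finite {\<beta> :: 'n list. set \<beta> \<subseteq> UNIV \<and> length \<beta> \<le> k}" by (rule finite_lists_length_le) simp
  qed
  define N where "N = real CARD('n) * real (card L)"
  \<comment> \<open>So small that the triangle inequality alone bounds \<open>\<Sum>i. X i (X i)\<^sup>*\<close> by \<open>r * N < 1\<close>.\<close>
  define r where "r = 1 / (1 + N)"
  have N: "N \<ge> 0" by (simp add: N_def)
  have r: "0 < r" "r \<le> 1" using N by (simp_all add: r_def)
  define c where "c i x = (\<Sum>\<beta>\<in>L. (complex_of_real r * cinner x (ket (f \<beta>))) *\<^sub>C ket (f (i # \<beta>)))" for i x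
  define d where "d i x = (\<Sum>\<beta>\<in>L. (complex_of_real r * cinner x (ket (f (i # \<beta>)))) *\<^sub>C ket (f \<beta>))" for i x
  have blc: "bounded_linear (c i)" "bounded_linear (d i)" for i
    unfolding c_def d_def
    by (intro bounded_linear_sum bounded_linear_compose[OF bounded_linear_scaleC_left]
        bounded_linear_compose[OF bounded_linear_mult_right] cinner.bounded_linear_left)+
  define X where "X i = Blinfun (c i)" for i
  have Xa: "X i x = c i x" for i x unfolding X_def by (simp add: bounded_linear_Blinfun_apply[OF blc(1)])
  have Xc: "clin (X i)" for i
    unfolding clin_def Xa by (simp add: c_def cinner_scaleC_left scaleC_sum_right scaleC_scaleC ac_simps)
  have adjX: "adj (X i) = Blinfun (d i)" for i
    by (rule adj_unique)
      (simp add: Xa bounded_linear_Blinfun_apply[OF blc(2)] c_def d_def cinner_sum_left cinner_sum_right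
        cinner_scaleC_left cinner_scaleC_right cinner_commute[of "ket _"] ac_simps)
  have kk: "cinner (ket (f \<alpha>)) (ket (f \<beta>)) = (if \<alpha> = \<beta> then 1 else 0)" for \<alpha> \<beta>
    using f by (auto simp: cinner_ket_ket inj_def)
  have Xk: "X i (ket (f \<alpha>)) = (if length \<alpha> < k then complex_of_real r *\<^sub>C ket (f (i # \<alpha>)) else 0)" for i \<alpha>
  proof -
    have "X i (ket (f \<alpha>)) = (\<Sum>\<beta>\<in>L. if \<beta> = \<alpha> then complex_of_real r *\<^sub>C ket (f (i # \<alpha>)) else 0)"
      unfolding Xa c_def by (rule sum.cong) (auto simp: kk)
    then show ?thesis using L by (simp add: L_def)
  qed
  have word: "word_op UNIV X \<alpha> (ket (f [])) = (if length \<alpha> \<le> k then complex_of_real (r ^ length \<alpha>) *\<^sub>C ket (f \<alpha>) else 0)" for \<alpha>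
  proof (induction \<alpha>)
    case Nil
    show ?case by (simp add: word_op_Nil scaleC_one)
  next
    case (Cons i \<alpha>)
    then show ?case
      by (auto simp: word_op_Cons clinD[OF Xc] Xk blinfun.zero_right scaleC_scaleC)
  qed
  have "norm ((\<Sum>i\<in>UNIV. X i o\<^sub>L adj (X i)) x) \<le> (r * N) * norm x" for x
  proof -
    have tm: "norm (X i (adj (X i) x)) \<le> r * real (card L) * norm x" for i
    proof -
      have "X i (adj (X i) x) = (\<Sum>\<beta>\<in>L. (complex_of_real r * (complex_of_real r * cinner x (ket (f (i # \<beta>))))) *\<^sub>C ket (f (i # \<beta>)))"
      proof -
        have "X i (adj (X i) x) = (\<Sum>\<beta>\<in>L. (complex_of_real r * cinner x (ket (f (i # \<beta>)))) *\<^sub>C X i (ket (f \<beta>)))"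
          unfolding adjX bounded_linear_Blinfun_apply[OF blc(2)] d_def by (simp add: blinfun.sum_right clinD[OF Xc])
        also have "\<dots> = (\<Sum>\<beta>\<in>L. (complex_of_real r * (complex_of_real r * cinner x (ket (f (i # \<beta>))))) *\<^sub>C ket (f (i # \<beta>)))"
          by (rule sum.cong) (auto simp: Xk L_def scaleC_scaleC ac_simps)
        finally show ?thesis .
      qed
      also have "norm \<dots> \<le> (\<Sum>\<beta>\<in>L. r * norm x)"
      proof (rule order_trans[OF norm_sum sum_mono])
        fix \<beta>
        have "cmod (cinner x (ket (f (i # \<beta>)))) \<le> norm x"
          using norm_cinner_le[of x "ket (f (i # \<beta>))"] by (simp add: norm_ket)
        then have "r * (r * cmod (cinner x (ket (f (i # \<beta>))))) \<le> r * (1 * norm x)"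
          using r by (intro mult_left_mono mult_mono) auto
        then show "norm ((complex_of_real r * (complex_of_real r * cinner x (ket (f (i # \<beta>))))) *\<^sub>C ket (f (i # \<beta>))) \<le> r * norm x"
          using r by (simp add: norm_scaleC norm_ket norm_mult)
      qed
      finally show ?thesis by (simp add: ac_simps)
    qed
    have "norm ((\<Sum>i\<in>UNIV. X i o\<^sub>L adj (X i)) x) \<le> (\<Sum>i\<in>(UNIV::'n set). r * real (card L) * norm x)"
      by (simp only: blinfun.sum_left blinfun_apply_blinfun_compose)
        (rule order_trans[OF norm_sum sum_mono], rule tm)
    then show ?thesis by (simp add: N_def ac_simps)
  qed
  then have "norm (\<Sum>i\<in>UNIV. X i o\<^sub>L adj (X i)) \<le> r * N"
    using r N by (intro norm_blinfun_bound) auto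
  also have "r * N < 1" using N by (simp add: r_def)
  finally have "strict_row_contraction_on UNIV X"
    by (simp add: strict_row_contraction_on_def bop_UNIV Xc)
  then show ?thesis using f r word by (intro exI[of _ f] exI[of _ r] exI[of _ X]) auto
qed

text \<open>At the truncated creation operators, \<open>X\<^sub>\<beta>\<close> maps the vacuum vector to a multiple of the basis vector at
  \<open>\<beta>\<close>, so that the component at \<open>\<alpha>\<close> of the value of the series isolates the coefficient of \<open>\<alpha>\<close>.\<close>

lemma power_series_coeff_unique:
  fixes A B :: "'n::finite list \<Rightarrow> 'a::complex_hilbert \<Rightarrow>\<^sub>L 'b::complex_hilbert"
  assumes A: "\<And>\<alpha>. clin (A \<alpha>)" and B: "\<And>\<alpha>. clin (B \<alpha>)"
    and eq: "\<And>X :: 'n \<Rightarrow> ('s::infinite, complex) ell2 \<Rightarrow>\<^sub>L ('s, complex) ell2. strict_row_contraction_on UNIV X \<Longrightarrow>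
      \<exists>S. (\<lambda>k. \<Sum>\<alpha> | length \<alpha> = k. word_op UNIV X \<alpha> \<otimes>\<^sub>o A \<alpha>) sums S \<and>
          (\<lambda>k. \<Sum>\<alpha> | length \<alpha> = k. word_op UNIV X \<alpha> \<otimes>\<^sub>o B \<alpha>) sums S"
  shows "A \<alpha> = B \<alpha>"
proof (rule blinfun_eqI)
  fix x
  let ?k = "length \<alpha>"
  obtain f :: "'n list \<Rightarrow> 's" and r X where f: "inj f" and r: "r \<noteq> 0" and X: "strict_row_contraction_on UNIV X"
    and w: "\<And>\<beta>. word_op UNIV X \<beta> (ket (f [])) = (if length \<beta> \<le> ?k then complex_of_real (r ^ length \<beta>) *\<^sub>C ket (f \<beta>) else 0)"
    using truncated_creation_tuple[where k = ?k, OF infinite_UNIV] by blast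
  obtain S where S: "(\<lambda>k. \<Sum>\<beta> | length \<beta> = k. word_op UNIV X \<beta> \<otimes>\<^sub>o A \<beta>) sums S"
    "(\<lambda>k. \<Sum>\<beta> | length \<beta> = k. word_op UNIV X \<beta> \<otimes>\<^sub>o B \<beta>) sums S"
    using eq[OF X] by blast
  have wc: "clin (word_op UNIV X \<beta>)" for \<beta>
    by (rule clin_word_op) (use X in \<open>auto simp: strict_row_contraction_on_def bop_UNIV\<close>)
  have val: "complex_of_real (r ^ ?k) *\<^sub>C D \<alpha> x = Rep_ell2 (S (ket (f []) \<otimes>\<^sub>h x)) (f \<alpha>)"
    if D: "\<And>\<beta>. clin (D \<beta>)" and sums: "(\<lambda>k. \<Sum>\<beta> | length \<beta> = k. word_op UNIV X \<beta> \<otimes>\<^sub>o D \<beta>) sums S"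
    for D :: "'n list \<Rightarrow> 'a \<Rightarrow>\<^sub>L 'b"
  proof (rule cinner_left_ext)
    fix z :: 'b
    let ?e = "\<lambda>R. cinner (blinfun_apply R (ket (f []) \<otimes>\<^sub>h x)) (ket (f \<alpha>) \<otimes>\<^sub>h z)"
    have bl: "bounded_linear ?e"
      by (intro bounded_linear_compose[OF cinner.bounded_linear_left] blinfun.bounded_linear_left)
    have tm: "?e (word_op UNIV X \<beta> \<otimes>\<^sub>o D \<beta>) = (if \<beta> = \<alpha> then complex_of_real (r ^ ?k) * cinner (D \<alpha> x) z else 0)" for \<beta>
      using f by (auto simp: tensor_op_tensor wc D w cinner_tensor cinner_scaleC_left cinner_ket_ket inj_eq)
    have "?e (\<Sum>\<beta> | length \<beta> = k. word_op UNIV X \<beta> \<otimes>\<^sub>o D \<beta>) = (if k = ?k then complex_of_real (r ^ ?k) * cinner (D \<alpha> x) z else 0)" for k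
      by (simp add: blinfun.sum_left cinner_sum_left tm finite_words)
    then have "(\<lambda>k. if k = ?k then complex_of_real (r ^ ?k) * cinner (D \<alpha> x) z else 0) sums ?e S"
      using bounded_linear.sums[OF bl sums] by simp
    then have "?e S = complex_of_real (r ^ ?k) * cinner (D \<alpha> x) z"
      using sums_single[of ?k "\<lambda>_. complex_of_real (r ^ ?k) * cinner (D \<alpha> x) z"] sums_unique2 by blast
    then show "cinner (complex_of_real (r ^ ?k) *\<^sub>C D \<alpha> x) z = cinner (Rep_ell2 (S (ket (f []) \<otimes>\<^sub>h x)) (f \<alpha>)) z"
      by (simp add: cinner_scaleC_left cinner_ket_tensor_right)
  qed
  have "complex_of_real (r ^ ?k) *\<^sub>C A \<alpha> x = complex_of_real (r ^ ?k) *\<^sub>C B \<alpha> x"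
    using val[OF A S(1)] val[OF B S(2)] by simp
  then show "A \<alpha> x = B \<alpha> x" using r complex_vector.scale_left_imp_eq by fastforce
qed

context row_contraction_tuple
begin

lemma charfun_coeff_eq: "charfun_coeff TYPE('s::infinite) T = char_coeff"
  unfolding charfun_coeff_def
proof (rule the_equality)
  show "(\<forall>\<alpha>. char_coeff \<alpha> \<in> bop (defect_star_space T) (defect_space T)) \<and>
    (\<forall>(G :: ('s, complex) ell2 set) X. closed_csubspace G \<and> strict_row_contraction_on G X \<longrightarrow>
      (\<lambda>k. \<Sum>\<alpha> | length \<alpha> = k. word_op G X \<alpha> \<otimes>\<^sub>o char_coeff \<alpha>) sums charfun T G X)"
    using char_coeff_bop charfun_expansion by blast
next
  fix A assume A: "(\<forall>\<alpha>. A \<alpha> \<in> bop (defect_star_space T) (defect_space T)) \<and>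
    (\<forall>(G :: ('s, complex) ell2 set) X. closed_csubspace G \<and> strict_row_contraction_on G X \<longrightarrow>
      (\<lambda>k. \<Sum>\<alpha> | length \<alpha> = k. word_op G X \<alpha> \<otimes>\<^sub>o A \<alpha>) sums charfun T G X)"
  then have Ac: "clin (A \<alpha>)" for \<alpha> by (simp add: bop_iff)
  show "A = char_coeff"
  proof
    fix \<alpha>
    show "A \<alpha> = char_coeff \<alpha>"
    proof (rule power_series_coeff_unique[where 's = 's and A = A and B = char_coeff and \<alpha> = \<alpha>])
      fix X :: "'n \<Rightarrow> ('s, complex) ell2 \<Rightarrow>\<^sub>L ('s, complex) ell2"
      assume X: "strict_row_contraction_on UNIV X"
      show "\<exists>S. (\<lambda>k. \<Sum>\<alpha> | length \<alpha> = k. word_op UNIV X \<alpha> \<otimes>\<^sub>o A \<alpha>) sums S \<and>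
          (\<lambda>k. \<Sum>\<alpha> | length \<alpha> = k. word_op UNIV X \<alpha> \<otimes>\<^sub>o char_coeff \<alpha>) sums S"
        using A charfun_expansion[OF closed_csubspace_UNIV X] X closed_csubspace_UNIV by blast
    qed (simp_all add: Ac)
  qed
qed

text \<open>If the function is constant, then it also has the expansion whose only coefficient is the one of the empty
  word, and uniqueness applies.\<close>

lemma charfun_constant_iff:
  "charfun_constant TYPE('s::infinite) T \<longleftrightarrow> (\<forall>\<alpha>. \<alpha> \<noteq> [] \<longrightarrow> char_coeff \<alpha> = 0)"
proof -
  have const: "(\<lambda>k. \<Sum>\<alpha> | length \<alpha> = k. word_op G X \<alpha> \<otimes>\<^sub>o D \<alpha>) sums (oproj G \<otimes>\<^sub>o D [])"
    if "\<And>\<alpha>. \<alpha> \<noteq> [] \<Longrightarrow> word_op G X \<alpha> \<otimes>\<^sub>o D \<alpha> = 0"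
    for G and X :: "'n \<Rightarrow> ('s, complex) ell2 \<Rightarrow>\<^sub>L ('s, complex) ell2" and D :: "'n list \<Rightarrow> ('h ^ 'n) \<Rightarrow>\<^sub>L 'h"
  proof -
    have "(\<Sum>\<alpha> | length \<alpha> = k. word_op G X \<alpha> \<otimes>\<^sub>o D \<alpha>) = (if k = 0 then oproj G \<otimes>\<^sub>o D [] else 0)" for k
    proof (cases k)
      case (Suc j)
      then show ?thesis by (auto intro!: sum.neutral that)
    qed (simp add: word_op_Nil)
    then show ?thesis using sums_single[of 0 "\<lambda>_. oproj G \<otimes>\<^sub>o D []"] by simp
  qed
  have zero: "strict_row_contraction_on G (\<lambda>_. 0)" if "closed_csubspace G" for G :: "('s, complex) ell2 set"
    using closed_csubspaceD(1)[OF that] by (simp add: strict_row_contraction_on_def bop_iff)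
  have at0: "charfun T G (\<lambda>_. 0) = oproj G \<otimes>\<^sub>o char_coeff []" if G: "closed_csubspace G" for G :: "('s, complex) ell2 set"
  proof (rule sums_unique2[OF charfun_expansion[OF G zero[OF G]]], rule const)
    fix \<alpha> :: "'n list" assume "\<alpha> \<noteq> []"
    then obtain i \<beta> where "\<alpha> = i # \<beta>" by (cases \<alpha>) auto
    then show "word_op G (\<lambda>_. 0) \<alpha> \<otimes>\<^sub>o char_coeff \<alpha> = 0"
      by (simp add: word_op_Cons tensor_op_zero_left)
  qed
  show ?thesis
  proof
    assume c: "charfun_constant TYPE('s) T"
    have "char_coeff \<alpha> = (if \<alpha> = [] then char_coeff [] else 0)" for \<alpha>
    proof (rule power_series_coeff_unique[where 's = 's and A = char_coeff
          and B = "\<lambda>\<alpha>. if \<alpha> = [] then char_coeff [] else 0" and \<alpha> = \<alpha>])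
      fix X :: "'n \<Rightarrow> ('s, complex) ell2 \<Rightarrow>\<^sub>L ('s, complex) ell2"
      assume X: "strict_row_contraction_on UNIV X"
      then have Xc: "clin (word_op UNIV X \<alpha>)" for \<alpha>
        by (intro clin_word_op) (auto simp: strict_row_contraction_on_def bop_UNIV)
      have "charfun T UNIV X = oproj UNIV \<otimes>\<^sub>o char_coeff []"
        using c X at0[OF closed_csubspace_UNIV] unfolding charfun_constant_def by simp
      moreover have "(\<lambda>k. \<Sum>\<alpha> | length \<alpha> = k. word_op UNIV X \<alpha> \<otimes>\<^sub>o (if \<alpha> = [] then char_coeff [] else 0))
        sums (oproj UNIV \<otimes>\<^sub>o char_coeff [])"
        using const[of UNIV X "\<lambda>\<alpha>. if \<alpha> = [] then char_coeff [] else 0"] by (simp add: tensor_op_zero_right Xc)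
      ultimately show "\<exists>S. (\<lambda>k. \<Sum>\<alpha> | length \<alpha> = k. word_op UNIV X \<alpha> \<otimes>\<^sub>o char_coeff \<alpha>) sums S \<and>
          (\<lambda>k. \<Sum>\<alpha> | length \<alpha> = k. word_op UNIV X \<alpha> \<otimes>\<^sub>o (if \<alpha> = [] then char_coeff [] else 0)) sums S"
        using charfun_expansion[OF closed_csubspace_UNIV X] by auto
    qed simp_all
    then show "\<forall>\<alpha>. \<alpha> \<noteq> [] \<longrightarrow> char_coeff \<alpha> = 0" by metis
  next
    assume z: "\<forall>\<alpha>. \<alpha> \<noteq> [] \<longrightarrow> char_coeff \<alpha> = 0"
    show "charfun_constant TYPE('s) T"
      unfolding charfun_constant_def
    proof (intro allI impI)
      fix G :: "('s, complex) ell2 set" and X :: "'n \<Rightarrow> ('s, complex) ell2 \<Rightarrow>\<^sub>L ('s, complex) ell2"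
      assume GX: "closed_csubspace G \<and> strict_row_contraction_on G X"
      then have Xc: "clin (word_op G X \<alpha>)" for \<alpha>
        by (intro clin_word_op) (auto simp: strict_row_contraction_on_def bop_iff)
      have "(\<lambda>k. \<Sum>\<alpha> | length \<alpha> = k. word_op G X \<alpha> \<otimes>\<^sub>o char_coeff \<alpha>) sums (oproj G \<otimes>\<^sub>o char_coeff [])"
        by (rule const) (simp add: z tensor_op_zero_right Xc)
      then have "charfun T G X = oproj G \<otimes>\<^sub>o char_coeff []"
        using charfun_expansion GX sums_unique2 by blast
      then show "charfun T G X = charfun T G (\<lambda>_. 0)" using at0 GX by simp
    qed
  qed
qed

lemma Gamma_map_iff:
  "Gamma_map TYPE('s::infinite) T \<in> UNIV \<times> {0} \<times> UNIV \<longleftrightarrow> (\<forall>\<alpha>. \<alpha> \<noteq> [] \<longrightarrow> char_coeff \<alpha> = 0)"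
proof -
  define N where "N = {\<alpha>. char_coeff \<alpha> \<noteq> 0}"
  have deg: "charfun_degree TYPE('s) T = (if finite N then enat (Max (insert 0 (length ` N))) else \<infinity>)"
    by (simp add: charfun_degree_def charfun_coeff_eq N_def Let_def)
  have "Gamma_map TYPE('s) T \<in> UNIV \<times> {0} \<times> UNIV \<longleftrightarrow> charfun_degree TYPE('s) T = 0"
    by (simp add: Gamma_map_def)
  also have "\<dots> \<longleftrightarrow> N \<subseteq> {[]}"
  proof
    assume "charfun_degree TYPE('s) T = 0"
    then have fin: "finite N" and max: "Max (insert 0 (length ` N)) = 0"
      by (auto simp: deg zero_enat_def split: if_splits)
    have "length \<alpha> \<le> Max (insert 0 (length ` N))" if "\<alpha> \<in> N" for \<alpha>
      by (rule Max_ge) (use fin that in auto)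
    then show "N \<subseteq> {[]}" using max by auto
  next
    assume N: "N \<subseteq> {[]}"
    then have "finite N" by (rule finite_subset) simp
    then show "charfun_degree TYPE('s) T = 0" using N by (auto simp: deg zero_enat_def Max_eq_iff)
  qed
  also have "\<dots> \<longleftrightarrow> (\<forall>\<alpha>. \<alpha> \<noteq> [] \<longrightarrow> char_coeff \<alpha> = 0)" by (auto simp: N_def)
  finally show ?thesis .
qed

text \<open>The projection in \<open>char_coeff\<close> disappears because \<open>\<Delta>s\<close> vanishes on the orthogonal complement of its range.
  The right-hand side places all components of \<open>\<Delta>s x\<close> in the kernel of the Poisson kernel.\<close>

lemma char_coeff_zero_iff:
  "(\<forall>\<alpha>. \<alpha> \<noteq> [] \<longrightarrow> char_coeff \<alpha> = 0) \<longleftrightarrow> (\<forall>x i \<beta>. \<Delta> (adj (Tw \<beta>) (\<Delta>s x $ i)) = 0)"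
proof -
  have eq: "char_coeff (\<beta> @ [i]) x = \<Delta> (adj (Tw (rev \<beta>)) (\<Delta>s x $ i))" for \<beta> i x
    by (simp add: char_coeff_def defect_star_oproj vec_coord.rep_eq)
  show ?thesis
  proof
    assume z: "\<forall>\<alpha>. \<alpha> \<noteq> [] \<longrightarrow> char_coeff \<alpha> = 0"
    show "\<forall>x i \<beta>. \<Delta> (adj (Tw \<beta>) (\<Delta>s x $ i)) = 0"
    proof (intro allI)
      fix x i \<beta>
      show "\<Delta> (adj (Tw \<beta>) (\<Delta>s x $ i)) = 0" using eq[of "rev \<beta>" i x] z by simp
    qed
  next
    assume z: "\<forall>x i \<beta>. \<Delta> (adj (Tw \<beta>) (\<Delta>s x $ i)) = 0"
    show "\<forall>\<alpha>. \<alpha> \<noteq> [] \<longrightarrow> char_coeff \<alpha> = 0"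
    proof (intro allI impI)
      fix \<alpha> :: "'n list" assume "\<alpha> \<noteq> []"
      then have "\<alpha> = butlast \<alpha> @ [last \<alpha>]" by simp
      then show "char_coeff \<alpha> = 0" using eq z by (metis blinfun_eqI blinfun.zero_left)
    qed
  qed
qed

end

section \<open>The canonical decomposition\<close>

lemma image_closure_cspan_in:
  fixes A :: "'a::complex_hilbert \<Rightarrow>\<^sub>L 'b::complex_hilbert"
  assumes A: "clin A" and M: "closed_csubspace M" and S: "\<And>x. x \<in> S \<Longrightarrow> A x \<in> M"
    and x: "x \<in> closure (cspan S)"
  shows "A x \<in> M"
proof -
  have "closed (A -` M)"
    using closed_csubspaceD(6)[OF M]
    by (rule closed_vimage) (rule linear_continuous_on[OF blinfun.bounded_linear_right])
  then have "closed_csubspace (A -` M)"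
    using closed_csubspaceD(1-3)[OF M]
    by (auto simp: closed_csubspace_def csubspace_iff blinfun.zero_right blinfun.add_right clinD[OF A])
  then have "closure (cspan S) \<subseteq> A -` M"
    using S by (intro closure_cspan_minimal) auto
  then show ?thesis using x by auto
qed

text \<open>By this lemma, purity need only be checked on vectors that generate \<open>\<H>\<^sub>v\<close>. The inequality \<open>add\<close> serves as a
  triangle inequality for squared norms.\<close>

lemma closed_csubspace_vanishing_limit:
  fixes p :: "nat \<Rightarrow> 'a::complex_hilbert \<Rightarrow> real"
  assumes add: "\<And>k x y. p k (x + y) \<le> 2 * p k x + 2 * p k y"
    and scale: "\<And>k c x. p k (c *\<^sub>C x) = (cmod c)\<^sup>2 * p k x"
    and bounds: "\<And>k x. 0 \<le> p k x" "\<And>k x. p k x \<le> (norm x)\<^sup>2"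
  shows "closed_csubspace {x. (\<lambda>k. p k x) \<longlonglongrightarrow> 0}"
proof -
  let ?M = "{x. (\<lambda>k. p k x) \<longlonglongrightarrow> 0}"
  have "p k 0 = 0" for k using bounds[where x = 0 and k = k] by simp
  then have "0 \<in> ?M" by simp
  moreover have "x + y \<in> ?M" if "x \<in> ?M" "y \<in> ?M" for x y
  proof -
    have "(\<lambda>k. 2 * p k x + 2 * p k y) \<longlonglongrightarrow> 2 * 0 + 2 * 0" using that by (intro tendsto_intros) auto
    then have "(\<lambda>k. 2 * p k x + 2 * p k y) \<longlonglongrightarrow> 0" by simp
    then have "(\<lambda>k. p k (x + y)) \<longlonglongrightarrow> 0"
      by (rule Lim_null_comparison[rotated]) (simp add: add abs_of_nonneg[OF bounds(1)])
    then show ?thesis by simp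
  qed
  moreover have "c *\<^sub>C x \<in> ?M" if "x \<in> ?M" for c x
  proof -
    have "(\<lambda>k. (cmod c)\<^sup>2 * p k x) \<longlonglongrightarrow> (cmod c)\<^sup>2 * 0" using that by (intro tendsto_intros) auto
    then show ?thesis by (simp add: scale)
  qed
  moreover have "closed ?M"
    unfolding closed_sequential_limits
  proof (intro allI impI)
    fix f and x :: 'a assume f: "(\<forall>n. f n \<in> ?M) \<and> f \<longlonglongrightarrow> x"
    have "(\<lambda>k. p k x) \<longlonglongrightarrow> 0"
    proof (rule LIMSEQ_I)
      fix e :: real assume e: "e > 0"
      have "(\<lambda>n. (norm (x - f n))\<^sup>2) \<longlonglongrightarrow> (norm (x - x))\<^sup>2" using f by (intro tendsto_intros) auto
      then obtain n where n: "(norm (x - f n))\<^sup>2 < e / 4"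
        using e LIMSEQ_D[of "\<lambda>n. (norm (x - f n))\<^sup>2" 0 "e / 4"] by fastforce
      have "(\<lambda>k. p k (f n)) \<longlonglongrightarrow> 0" using f by simp
      then obtain K where K: "\<And>k. k \<ge> K \<Longrightarrow> norm (p k (f n)) < e / 4"
        using e LIMSEQ_D[of "\<lambda>k. p k (f n)" 0 "e / 4"] by fastforce
      have "norm (p k x - 0) < e" if "k \<ge> K" for k
        using add[of k "x - f n" "f n"] bounds(2)[of k "x - f n"] bounds(1)[of k x] n K[OF that] by simp
      then show "\<exists>K. \<forall>k\<ge>K. norm (p k x - 0) < e" by blast
    qed
    then show "x \<in> ?M" by simp
  qed
  ultimately show ?thesis by (simp add: closed_csubspace_def csubspace_iff)
qed

lemma axis_component: "axis i v $ j = (if j = i then v else 0)"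
  by (simp add: axis_def)

lemma cinner_axis_right: "cinner x (axis i v) = cinner (x $ i) (v :: 'a::complex_hilbert)"
proof -
  have "cinner x (axis i v) = (\<Sum>j\<in>UNIV. if j = i then cinner (x $ i) v else 0)"
    unfolding cinner_vec_def by (rule sum.cong) (auto simp: axis_component)
  then show ?thesis by simp
qed

lemma row_op_axis: "row_op X (axis i v) = X i v"
proof -
  have "row_op X (axis i v) = (\<Sum>j\<in>UNIV. if j = i then X i v else 0)"
    unfolding row_op_apply by (rule sum.cong) (auto simp: axis_component blinfun.zero_right)
  then show ?thesis by simp
qed

context row_contraction_tuple
begin

abbreviation "Hv \<equiv> H_v T"
abbreviation "Hc \<equiv> H_c T"

lemma closed_Hv: "closed_csubspace Hv"
  unfolding H_v_def by (rule closed_csubspace_closure_cspan)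

lemma defect_space_eq: "defect_space T = closure (cspan (range \<Delta>))"
proof -
  have "cspan (range \<Delta>) = range \<Delta>"
    using csubspace_range[OF clin_defect] by (simp add: complex_vector.span_eq_iff)
  then show ?thesis by (simp only: defect_space_def)
qed

lemma ortho_defect_space_iff: "y \<in> ortho (defect_space T) \<longleftrightarrow> \<Delta> y = 0"
proof -
  have "ortho (defect_space T) = ortho (range \<Delta>)"
    unfolding defect_space_eq by (rule ortho_closure_cspan)
  also have "y \<in> ortho (range \<Delta>) \<longleftrightarrow> (\<forall>k. cinner (\<Delta> y) k = 0)"
    using cinner_adj[OF clin_defect] by (simp add: ortho_def)
  also have "\<dots> \<longleftrightarrow> \<Delta> y = 0" using cinner_left_ext[of "\<Delta> y" 0] by auto
  finally show ?thesis .
qed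

lemma ortho_Hv_iff: "h \<in> ortho Hv \<longleftrightarrow> (\<forall>\<beta>. \<Delta> (adj (Tw \<beta>) h) = 0)"
proof -
  have "h \<in> ortho Hv \<longleftrightarrow> (\<forall>\<beta>. \<forall>d\<in>defect_space T. cinner h (Tw \<beta> d) = 0)"
    unfolding H_v_def ortho_closure_cspan by (auto simp: ortho_def)
  also have "\<dots> \<longleftrightarrow> (\<forall>\<beta>. adj (Tw \<beta>) h \<in> ortho (defect_space T))"
    by (simp add: ortho_def cinner_adj')
  finally show ?thesis by (simp add: ortho_defect_space_iff)
qed

text \<open>Membership in \<open>\<H>\<^sub>c\<close> means that this quantity does not depend on \<open>k\<close>.\<close>

definition word_mass :: "nat \<Rightarrow> 'h \<Rightarrow> real" where
  "word_mass k h = (\<Sum>\<alpha> | length \<alpha> = k. (norm (adj (Tw \<alpha>) h))\<^sup>2)"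

lemma word_mass_0: "word_mass 0 h = (norm h)\<^sup>2"
  by (simp add: word_mass_def)

lemma word_mass_Suc: "word_mass (Suc k) h = word_mass k h - (\<Sum>\<alpha> | length \<alpha> = k. (norm (\<Delta> (adj (Tw \<alpha>) h)))\<^sup>2)"
  by (simp add: word_mass_def sum_words_snoc adj_Tw_snoc norm_defect sum_subtractf)

lemma word_mass_le: "word_mass k h \<le> (norm h)\<^sup>2"
proof (induction k)
  case (Suc k)
  have "0 \<le> (\<Sum>\<alpha> | length \<alpha> = k. (norm (\<Delta> (adj (Tw \<alpha>) h)))\<^sup>2)" by (rule sum_nonneg) simp
  then show ?case using Suc by (simp add: word_mass_Suc)
qed (simp add: word_mass_0)

text \<open>By \<open>word_mass_Suc\<close>, the mass is constant iff every loss \<open>\<parallel>\<Delta> T\<^sub>\<alpha>\<^sup>* h\<parallel>\<^sup>2\<close> vanishes.\<close>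

lemma Hc_eq: "Hc = ortho Hv"
proof (intro set_eqI)
  fix h
  have "h \<in> Hc \<longleftrightarrow> (\<forall>k. word_mass k h = (norm h)\<^sup>2)" by (simp add: H_c_def word_mass_def)
  also have "\<dots> \<longleftrightarrow> (\<forall>k. (\<Sum>\<alpha> | length \<alpha> = k. (norm (\<Delta> (adj (Tw \<alpha>) h)))\<^sup>2) = 0)"
  proof
    assume a: "\<forall>k. word_mass k h = (norm h)\<^sup>2"
    show "\<forall>k. (\<Sum>\<alpha> | length \<alpha> = k. (norm (\<Delta> (adj (Tw \<alpha>) h)))\<^sup>2) = 0"
    proof
      fix k
      show "(\<Sum>\<alpha> | length \<alpha> = k. (norm (\<Delta> (adj (Tw \<alpha>) h)))\<^sup>2) = 0"
        using word_mass_Suc[of k h] a[rule_format, of k] a[rule_format, of "Suc k"] by simp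
    qed
  next
    assume a: "\<forall>k. (\<Sum>\<alpha> | length \<alpha> = k. (norm (\<Delta> (adj (Tw \<alpha>) h)))\<^sup>2) = 0"
    show "\<forall>k. word_mass k h = (norm h)\<^sup>2"
    proof
      show "word_mass k h = (norm h)\<^sup>2" for k
        by (induction k) (simp_all only: word_mass_0 word_mass_Suc a[rule_format] diff_0_right)
    qed
  qed
  also have "\<dots> \<longleftrightarrow> (\<forall>\<beta>. \<Delta> (adj (Tw \<beta>) h) = 0)"
    by (auto simp: sum_nonneg_eq_0_iff finite_words)
  finally show "h \<in> Hc \<longleftrightarrow> h \<in> ortho Hv" by (simp add: ortho_Hv_iff)
qed

lemma closed_Hc: "closed_csubspace Hc"
  unfolding Hc_eq by (rule closed_csubspace_ortho)

lemma ortho_Hc: "ortho Hc = Hv"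
  unfolding Hc_eq by (rule ortho_ortho[OF closed_Hv])

lemma cinner_Hv_Hc: "x \<in> Hv \<Longrightarrow> y \<in> Hc \<Longrightarrow> cinner x y = 0"
  unfolding Hc_eq using cinner_sym_zero by (auto simp: ortho_def)

lemma orthogonal_decomposition_Hv_Hc: "orthogonal_decomposition Hv Hc"
  unfolding orthogonal_decomposition_def
proof (intro conjI ballI allI)
  fix h
  have "h - oproj Hv h \<in> Hc" unfolding Hc_eq by (rule oproj_ortho[OF closed_Hv])
  then show "\<exists>x\<in>Hv. \<exists>y\<in>Hc. h = x + y"
    using oproj_in[OF closed_Hv, of h] by (intro bexI[of _ "oproj Hv h"] bexI[of _ "h - oproj Hv h"]) auto
qed (simp_all add: closed_Hv closed_Hc cinner_Hv_Hc)

lemma Tw_defect_space_in_Hv: "d \<in> defect_space T \<Longrightarrow> Tw \<beta> d \<in> Hv"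
  unfolding H_v_def by (rule subsetD[OF closure_cspan_superset]) blast

lemma T_Hv: assumes "x \<in> Hv" shows "T i x \<in> Hv"
proof (rule image_closure_cspan_in[OF clin_T closed_Hv _ assms[unfolded H_v_def]])
  fix x assume "x \<in> {Tw \<beta> h |\<beta> h. h \<in> defect_space T}"
  then obtain \<beta> h where "x = Tw \<beta> h" "h \<in> defect_space T" by blast
  then show "T i x \<in> Hv" using Tw_defect_space_in_Hv[of h "i # \<beta>"] by (simp add: word_op_Cons)
qed

lemma Tw_Hv: "x \<in> Hv \<Longrightarrow> Tw \<alpha> x \<in> Hv"
  by (induction \<alpha>) (simp_all add: word_op_Cons T_Hv)

lemma adj_T_Hc: assumes "x \<in> Hc" shows "adj (T i) x \<in> Hc"
proof -
  have "cinner (adj (T i) x) v = 0" if "v \<in> Hv" for v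
    using assms T_Hv[OF that, of i] by (simp add: cinner_adj' Hc_eq ortho_def)
  then show ?thesis by (simp add: Hc_eq ortho_def)
qed

lemma adj_Tw_Hc: "x \<in> Hc \<Longrightarrow> adj (Tw \<alpha>) x \<in> Hc"
  by (induction \<alpha> arbitrary: x) (simp_all add: adj_Tw_Cons adj_T_Hc)

text \<open>\<open>\<Delta>\<close> vanishes on \<open>\<H>\<^sub>c\<close>, and \<open>\<Delta>\<^sup>2 = I - \<Sum>i. T\<^sub>i T\<^sub>i\<^sup>*\<close>.\<close>

lemma sum_T_adj_T_Hc: assumes "x \<in> Hc" shows "(\<Sum>i\<in>UNIV. T i (adj (T i) x)) = x"
proof -
  have "\<Delta> (adj (Tw []) x) = 0" using assms unfolding Hc_eq ortho_Hv_iff by blast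
  then have "\<Delta> (\<Delta> x) = 0" by (simp add: blinfun.zero_right)
  then show ?thesis unfolding defect_square by simp
qed

text \<open>The blocks of \<open>T\<close>. As \<open>\<H>\<^sub>v\<close> is invariant under \<open>T\<^sub>i\<close>, no projection is applied after \<open>T\<^sub>i\<close> in \<open>Vc\<close>.\<close>

definition Pv where "Pv = oproj Hv"
definition Pc where "Pc = oproj Hc"
definition Vc where "Vc i = T i o\<^sub>L Pv"
definition Wc where "Wc i = Pc o\<^sub>L T i o\<^sub>L Pc"

lemma clin_Pv [simp]: "clin Pv" unfolding Pv_def by (rule clin_oproj[OF closed_Hv])
lemma clin_Pc [simp]: "clin Pc" unfolding Pc_def by (rule clin_oproj[OF closed_Hc])
lemma adj_Pv [simp]: "adj Pv = Pv" unfolding Pv_def by (rule adj_oproj[OF closed_Hv])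
lemma adj_Pc [simp]: "adj Pc = Pc" unfolding Pc_def by (rule adj_oproj[OF closed_Hc])
lemma Pv_in [simp]: "Pv x \<in> Hv" unfolding Pv_def by (rule oproj_in[OF closed_Hv])
lemma Pc_in [simp]: "Pc x \<in> Hc" unfolding Pc_def by (rule oproj_in[OF closed_Hc])
lemma Pv_fix: "x \<in> Hv \<Longrightarrow> Pv x = x" unfolding Pv_def by (rule oproj_fix[OF closed_Hv])
lemma Pc_fix: "x \<in> Hc \<Longrightarrow> Pc x = x" unfolding Pc_def by (rule oproj_fix[OF closed_Hc])
lemma Pv_ker: "x \<in> Hc \<Longrightarrow> Pv x = 0" unfolding Pv_def Hc_eq by (rule oproj_ker[OF closed_Hv])
lemma Pc_ker: "x \<in> Hv \<Longrightarrow> Pc x = 0" unfolding Pc_def ortho_Hc[symmetric] by (rule oproj_ker[OF closed_Hc])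
lemma Pv_Pc: "Pv x + Pc x = x"
proof -
  obtain v c where "v \<in> Hv" "c \<in> Hc" "x = v + c"
    using orthogonal_decomposition_Hv_Hc unfolding orthogonal_decomposition_def by blast
  then show ?thesis by (simp add: blinfun.add_right Pv_fix Pc_fix Pv_ker Pc_ker)
qed

lemma clin_Vc [simp]: "clin (Vc i)" and clin_Wc [simp]: "clin (Wc i)"
  by (simp_all add: Vc_def Wc_def)

lemma adj_Vc: "adj (Vc i) h = Pv (adj (T i) h)"
  by (simp add: Vc_def adj_compose)

lemma adj_Wc: "adj (Wc i) h = adj (T i) (Pc h)"
  by (simp add: Wc_def adj_compose Pc_fix adj_T_Hc)

lemma Vc_bop: "Vc i \<in> bop Hv Hv"
  by (auto simp: bop_iff Vc_def T_Hv Pv_ker Hc_eq[symmetric] blinfun.zero_right)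

lemma Wc_bop: "Wc i \<in> bop Hc Hc"
  by (auto simp: bop_iff Wc_def ortho_Hc Pc_ker blinfun.zero_right)

lemma canonical_rep: "upper_triangular_rep Hv Hc T Vc Wc"
  unfolding upper_triangular_rep_def
proof (intro conjI allI orthogonal_decomposition_Hv_Hc Vc_bop Wc_bop)
  fix i
  show "\<exists>Y\<in>bop Hc Hv. \<forall>x\<in>Hv. \<forall>y\<in>Hc. T i (x + y) = Vc i x + Y y + Wc i y"
  proof (intro bexI[of _ "Pv o\<^sub>L T i o\<^sub>L Pc"] ballI)
    show "Pv o\<^sub>L T i o\<^sub>L Pc \<in> bop Hc Hv"
      by (auto simp: bop_iff ortho_Hc Pc_ker blinfun.zero_right)
    show "T i (x + y) = Vc i x + (Pv o\<^sub>L T i o\<^sub>L Pc) y + Wc i y" if "x \<in> Hv" "y \<in> Hc" for x y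
      using that Pv_Pc[of "T i y"] by (simp add: Vc_def Wc_def Pv_fix Pc_fix blinfun.add_right add.assoc)
  qed
qed

text \<open>Compressing \<open>T\<^sub>i\<close> to the two summands recovers the diagonal blocks, and operators on a subspace vanish on its
  orthogonal complement by convention.\<close>

lemma canonical_rep_unique:
  assumes "upper_triangular_rep Hv Hc T V W"
  shows "V = Vc" "W = Wc"
proof -
  have rep: "V i \<in> bop Hv Hv" "W i \<in> bop Hc Hc"
    "\<exists>Y\<in>bop Hc Hv. \<forall>x\<in>Hv. \<forall>y\<in>Hc. T i (x + y) = (V i x + Y y) + W i y" for i
    using assms unfolding upper_triangular_rep_def by blast+
  have V: "V i x = T i x" if x: "x \<in> Hv" for i x
  proof -
    obtain Y where Y: "\<forall>x\<in>Hv. \<forall>y\<in>Hc. T i (x + y) = (V i x + blinfun_apply Y y) + W i y"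
      using rep(3) by blast
    show ?thesis using Y[rule_format, OF x closed_csubspaceD(1)[OF closed_Hc]]
      by (simp add: blinfun.zero_right)
  qed
  have W: "W i y = Pc (T i y)" if y: "y \<in> Hc" for i y
  proof -
    obtain Y where Y: "Y \<in> bop Hc Hv" "\<forall>x\<in>Hv. \<forall>y\<in>Hc. T i (x + y) = (V i x + blinfun_apply Y y) + W i y"
      using rep(3) by blast
    have "Y y \<in> Hv" "W i y \<in> Hc" using Y(1) rep(2) by (auto simp: bop_iff)
    then show ?thesis using Y(2)[rule_format, OF closed_csubspaceD(1)[OF closed_Hv] y]
      by (simp add: blinfun.zero_right blinfun.add_right Pc_ker Pc_fix)
  qed
  show "V = Vc"
  proof (rule ext, rule blinfun_eqI)
    fix i x
    have "V i x = V i (Pv x)"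
      using blinfun_compose_applyD[OF bop_oproj_right[OF closed_Hv rep(1)]] by (simp add: Pv_def)
    then show "V i x = Vc i x" by (simp add: V Vc_def)
  qed
  show "W = Wc"
  proof (rule ext, rule blinfun_eqI)
    fix i x
    have "W i x = W i (Pc x)"
      using blinfun_compose_applyD[OF bop_oproj_right[OF closed_Hc rep(2)]] by (simp add: Pc_def)
    then show "W i x = Wc i x" by (simp add: W Wc_def)
  qed
qed

text \<open>\<open>\<H>\<^sub>c\<close> is invariant under each \<open>T\<^sub>i\<^sup>*\<close>, so the adjoint of the block is a restriction of \<open>T\<^sub>i\<^sup>*\<close>.\<close>

lemma coisometry_Wc: "coisometry_on Hc Wc"
  unfolding coisometry_on_def
proof (rule blinfun_eqI)
  fix x
  have "(\<Sum>i\<in>UNIV. Wc i o\<^sub>L adj (Wc i)) x = (\<Sum>i\<in>UNIV. Pc (T i (adj (T i) (Pc x))))"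
    by (simp add: blinfun.sum_left adj_Wc) (simp add: Wc_def Pc_fix adj_T_Hc)
  also have "\<dots> = Pc (\<Sum>i\<in>UNIV. T i (adj (T i) (Pc x)))" by (simp add: blinfun.sum_right)
  also have "\<dots> = Pc x" by (simp add: sum_T_adj_T_Hc Pc_fix)
  finally show "(\<Sum>i\<in>UNIV. Wc i o\<^sub>L adj (Wc i)) x = oproj Hc x" by (simp add: Pc_def)
qed

lemma row_contraction_Wc: "row_contraction_on Hc Wc"
proof -
  have "(0 :: 'h \<Rightarrow>\<^sub>L 'h) \<in> bop Hc Hc" using closed_csubspaceD(1)[OF closed_Hc] by (simp add: bop_iff)
  then show ?thesis
    using coisometry_Wc by (simp add: row_contraction_on_def coisometry_on_def Wc_bop positive_on_def)
qed

lemma row_contraction_Vc: "row_contraction_on Hv Vc"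
  unfolding row_contraction_on_def positive_on_def
proof (intro conjI allI Vc_bop ballI)
  let ?A = "oproj Hv - (\<Sum>i\<in>UNIV. Vc i o\<^sub>L adj (Vc i))"
  show "?A \<in> bop Hv Hv"
    unfolding bop_iff Pv_def[symmetric]
  proof (intro conjI allI ballI)
    fix x
    show "(Pv - (\<Sum>i\<in>UNIV. Vc i o\<^sub>L adj (Vc i))) x \<in> Hv"
      by (simp add: blinfun.diff_left blinfun.sum_left Vc_def T_Hv
          closed_csubspaceD(4)[OF closed_Hv] closed_csubspace_sum[OF closed_Hv])
    assume "x \<in> ortho Hv"
    then have "x \<in> Hc" by (simp add: Hc_eq)
    then show "(Pv - (\<Sum>i\<in>UNIV. Vc i o\<^sub>L adj (Vc i))) x = 0"
      by (simp add: blinfun.diff_left blinfun.sum_left adj_Vc Pv_ker adj_T_Hc blinfun.zero_right)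
  qed simp
  fix h assume h: "h \<in> Hv"
  have "cinner (?A h) h = cinner h h - (\<Sum>i\<in>UNIV. cinner (adj (Vc i) h) (adj (Vc i) h))"
    using h by (simp add: blinfun.diff_left blinfun.sum_left cinner_diff_left cinner_sum_left
        Pv_def[symmetric] Pv_fix cinner_adj)
  also have "\<dots> = complex_of_real ((norm h)\<^sup>2 - (\<Sum>i\<in>UNIV. (norm (adj (Vc i) h))\<^sup>2))"
    by (simp only: cinner_self of_real_diff of_real_sum)
  finally have eq: "cinner (?A h) h = complex_of_real ((norm h)\<^sup>2 - (\<Sum>i\<in>UNIV. (norm (adj (Vc i) h))\<^sup>2))" .
  have "(\<Sum>i\<in>UNIV. (norm (adj (Vc i) h))\<^sup>2) \<le> (\<Sum>i\<in>UNIV. (norm (adj (T i) h))\<^sup>2)"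
    unfolding adj_Vc Pv_def by (intro sum_mono power_mono norm_oproj_le[OF closed_Hv]) simp
  also have "\<dots> \<le> (norm h)\<^sup>2" by (rule sum_adj_T_le)
  finally have le: "(\<Sum>i\<in>UNIV. (norm (adj (Vc i) h))\<^sup>2) \<le> (norm h)\<^sup>2" .
  show "cinner (?A h) h \<in> \<real>\<^sub>\<ge>\<^sub>0" unfolding eq nonneg_Reals_of_real_iff using le by simp
qed

subsection \<open>Isometry of the corner on \<open>\<H>\<^sub>v\<close>\<close>

text \<open>Both sides express that \<open>\<Delta>s\<close> pairs to zero with vectors whose components lie in \<open>\<H>\<^sub>v\<close>; the self-adjoint
  \<open>\<Delta>s\<close> is moved to the other argument.\<close>

lemma char_coeff_zero_iff_defect_star_Hv:
  "(\<forall>\<alpha>. \<alpha> \<noteq> [] \<longrightarrow> char_coeff \<alpha> = 0) \<longleftrightarrow> (\<forall>x :: 'h ^ 'n. (\<forall>i. x $ i \<in> Hv) \<longrightarrow> \<Delta>s x = 0)"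
proof -
  have "(\<forall>\<alpha>. \<alpha> \<noteq> [] \<longrightarrow> char_coeff \<alpha> = 0) \<longleftrightarrow> (\<forall>x i. \<Delta>s x $ i \<in> ortho Hv)"
    unfolding char_coeff_zero_iff ortho_Hv_iff by blast
  also have "\<dots> \<longleftrightarrow> (\<forall>x :: 'h ^ 'n. (\<forall>i. x $ i \<in> Hv) \<longrightarrow> \<Delta>s x = 0)"
  proof (intro iffI allI impI)
    fix x :: "'h ^ 'n" assume o: "\<forall>x i. \<Delta>s x $ i \<in> ortho Hv" and x: "\<forall>i. x $ i \<in> Hv"
    show "\<Delta>s x = 0"
    proof (rule cinner_right_ext)
      fix z
      have "cinner z (\<Delta>s x) = cinner (\<Delta>s z) x" by (simp add: cinner_adj)
      also have "\<dots> = (\<Sum>i\<in>UNIV. cinner (\<Delta>s z $ i) (x $ i))" by (simp add: cinner_vec_def)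
      also have "\<dots> = 0" using o x by (intro sum.neutral) (auto simp: ortho_def)
      finally show "cinner z (\<Delta>s x) = cinner z 0" by simp
    qed
  next
    fix x i assume z: "\<forall>x :: 'h ^ 'n. (\<forall>i. x $ i \<in> Hv) \<longrightarrow> \<Delta>s x = 0"
    have "cinner (\<Delta>s x $ i) v = 0" if "v \<in> Hv" for v
    proof -
      have "\<Delta>s (axis i v) = 0"
        using z that closed_csubspaceD(1)[OF closed_Hv] by (simp add: axis_component)
      moreover have "cinner (\<Delta>s x $ i) v = cinner x (\<Delta>s (axis i v))"
        by (simp add: cinner_axis_right[symmetric] cinner_adj)
      ultimately show ?thesis by simp
    qed
    then show "\<Delta>s x $ i \<in> ortho Hv" by (simp add: ortho_def)
  qed
  finally show ?thesis .
qed

lemma adj_T_T_Hv: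
  assumes z: "\<And>x :: 'h ^ 'n. (\<And>i. x $ i \<in> Hv) \<Longrightarrow> \<Delta>s x = 0" and v: "v \<in> Hv"
  shows "adj (T i) (T j v) = (if i = j then v else 0)"
proof -
  have "\<Delta>s (axis j v) = 0"
    using v closed_csubspaceD(1)[OF closed_Hv] by (intro z) (simp add: axis_component)
  then have "\<Delta>s (\<Delta>s (axis j v)) = 0" by (simp add: blinfun.zero_right)
  then have "axis j v = adj rowT (T j v)" by (simp add: defect_star_square row_op_axis)
  then have "axis j v $ i = adj rowT (T j v) $ i" by simp
  then show ?thesis by (simp add: axis_component adj_row_op)
qed

text \<open>Both sides say that \<open>T\<close> preserves norms of vectors with components in \<open>\<H>\<^sub>v\<close>, as
  \<open>\<parallel>\<Delta>\<^sub>* x\<parallel>\<^sup>2 = \<parallel>x\<parallel>\<^sup>2 - \<parallel>T x\<parallel>\<^sup>2\<close>.\<close>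

lemma isometry_Vc_iff: "isometry_on Hv Vc \<longleftrightarrow> (\<forall>x :: 'h ^ 'n. (\<forall>i. x $ i \<in> Hv) \<longrightarrow> \<Delta>s x = 0)"
proof
  assume iso: "isometry_on Hv Vc"
  show "\<forall>x :: 'h ^ 'n. (\<forall>i. x $ i \<in> Hv) \<longrightarrow> \<Delta>s x = 0"
  proof (intro allI impI)
    fix x :: "'h ^ 'n" assume x: "\<forall>i. x $ i \<in> Hv"
    have ij: "cinner (T i (x $ i)) (T j (x $ j)) = (if i = j then cinner (x $ i) (x $ i) else 0)" for i j
    proof -
      have "T k (x $ k) = Vc k (x $ k)" for k using x by (simp add: Vc_def Pv_fix)
      then have "cinner (T i (x $ i)) (T j (x $ j)) = cinner (x $ i) ((adj (Vc i) o\<^sub>L Vc j) (x $ j))"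
        by (simp only: cinner_adj[OF clin_Vc] blinfun_apply_blinfun_compose)
      also have "\<dots> = (if i = j then cinner (x $ i) (x $ i) else 0)"
        using iso x by (simp add: isometry_on_def Pv_def[symmetric] Pv_fix)
      finally show ?thesis .
    qed
    have "cinner (rowT x) (rowT x) = (\<Sum>i\<in>UNIV. \<Sum>j\<in>UNIV. cinner (T i (x $ i)) (T j (x $ j)))"
      by (simp add: row_op_apply cinner_sum_left cinner_sum_right, rule sum.swap)
    also have "\<dots> = cinner x x" unfolding ij by (simp add: cinner_vec_def)
    finally have "(norm (\<Delta>s x))\<^sup>2 = 0" unfolding norm_defect_star by (simp add: norm_square_cinner)
    then show "\<Delta>s x = 0" by simp
  qed
next
  assume z: "\<forall>x :: 'h ^ 'n. (\<forall>i. x $ i \<in> Hv) \<longrightarrow> \<Delta>s x = 0"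
  show "isometry_on Hv Vc"
    unfolding isometry_on_def
  proof (intro allI blinfun_eqI)
    fix i j y
    have "adj (T i) (T j (Pv y)) = (if i = j then Pv y else 0)"
      by (rule adj_T_T_Hv) (use z in auto)
    then show "(adj (Vc i) o\<^sub>L Vc j) y = (if i = j then oproj Hv else 0) y"
      by (cases "i = j") (simp_all add: adj_Vc, simp_all add: Vc_def Pv_def[symmetric] Pv_fix blinfun.zero_right)
  qed
qed

lemma word_op_Vc: "word_op Hv Vc \<alpha> = Tw \<alpha> o\<^sub>L Pv"
proof (induction \<alpha>)
  case Nil
  show ?case by (simp add: word_op_Nil Pv_def)
next
  case (Cons i \<alpha>)
  show ?case
    by (rule blinfun_eqI) (simp add: word_op_Cons Cons, simp add: Vc_def Pv_fix Tw_Hv)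
qed

text \<open>The isometric relations cancel the letters of \<open>\<beta>\<close> against those of \<open>\<alpha>\<close>, or produce \<open>0\<close> at the
  first mismatch. At least one \<open>T\<^sub>i\<^sup>*\<close> is left, and it
  maps the defect space into \<open>\<H>\<^sub>c\<close>: by \<open>\<Delta> T = T \<Delta>\<^sub>*\<close>, \<open>\<Delta> T\<^sub>i\<close> vanishes on \<open>\<H>\<^sub>v\<close>.\<close>

lemma adj_Tw_Tw_defect_space:
  assumes z: "\<And>x :: 'h ^ 'n. (\<And>i. x $ i \<in> Hv) \<Longrightarrow> \<Delta>s x = 0" and d: "d \<in> defect_space T"
    and len: "length \<beta> < length \<alpha>"
  shows "adj (Tw \<alpha>) (Tw \<beta> d) \<in> Hc"
  using len
proof (induction \<beta> arbitrary: \<alpha>)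
  case Nil
  then obtain i \<alpha>' where \<alpha>: "\<alpha> = i # \<alpha>'" by (cases \<alpha>) auto
  have "\<Delta> (T i v) = 0" if v: "v \<in> Hv" for v
  proof -
    have "\<Delta>s (axis i v) = 0"
      using v closed_csubspaceD(1)[OF closed_Hv] by (intro z) (simp add: axis_component)
    then show ?thesis using row_defect_star[of "axis i v"] by (simp add: row_op_axis blinfun.zero_right)
  qed
  then have "cinner (adj (T i) (\<Delta> k)) v = 0" if "v \<in> Hv" for k v
    using that cinner_adj[OF clin_defect] by (simp add: cinner_adj')
  then have gen: "adj (T i) y \<in> Hc" if "y \<in> range \<Delta>" for y using that by (auto simp: Hc_eq ortho_def)
  have "adj (T i) d \<in> Hc"
    using d unfolding defect_space_eq by (intro image_closure_cspan_in[OF _ closed_Hc gen]) auto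
  then show ?case by (simp add: \<alpha> adj_Tw_Cons adj_Tw_Hc)
next
  case (Cons j \<beta>)
  then obtain i \<alpha>' where \<alpha>: "\<alpha> = i # \<alpha>'" "length \<beta> < length \<alpha>'" by (cases \<alpha>) auto
  have "adj (T i) (T j (Tw \<beta> d)) = (if i = j then Tw \<beta> d else 0)"
    by (rule adj_T_T_Hv[OF z Tw_defect_space_in_Hv[OF d]])
  then show ?case
    using Cons.IH[OF \<alpha>(2)] closed_csubspaceD(1)[OF closed_Hc]
    unfolding \<alpha>(1) adj_Tw_Cons by (simp add: word_op_Cons blinfun.zero_right)
qed

text \<open>On a generator \<open>T\<^sub>\<beta> d\<close> of \<open>\<H>\<^sub>v\<close> the sums even vanish as soon as \<open>k\<close> exceeds the length of \<open>\<beta>\<close>.\<close>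

lemma pure_Vc:
  assumes z: "\<And>x :: 'h ^ 'n. (\<And>i. x $ i \<in> Hv) \<Longrightarrow> \<Delta>s x = 0"
  shows "pure_on Hv Vc"
proof -
  define p where "p k h = (\<Sum>\<alpha> | length \<alpha> = k. (norm (Pv (adj (Tw \<alpha>) h)))\<^sup>2)" for k h
  have "closed_csubspace {h. (\<lambda>k. p k h) \<longlonglongrightarrow> 0}"
  proof (rule closed_csubspace_vanishing_limit)
    fix k x y c
    have sq: "(norm (a + b))\<^sup>2 \<le> 2 * (norm a)\<^sup>2 + 2 * (norm b)\<^sup>2" for a b :: 'h
    proof -
      have "(norm (a + b))\<^sup>2 \<le> (norm a + norm b)\<^sup>2" by (intro power_mono norm_triangle_ineq) simp
      also have "\<dots> \<le> 2 * (norm a)\<^sup>2 + 2 * (norm b)\<^sup>2"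
        using sum_squares_bound[of "norm a" "norm b"] by (simp add: power2_sum)
      finally show ?thesis .
    qed
    show "p k (x + y) \<le> 2 * p k x + 2 * p k y"
      unfolding p_def blinfun.add_right sum_distrib_left sum.distrib[symmetric] by (intro sum_mono sq)
    show "p k (c *\<^sub>C x) = (cmod c)\<^sup>2 * p k x"
      unfolding p_def sum_distrib_left
      by (rule sum.cong) (simp_all add: clinD norm_scaleC power_mult_distrib)
    show "0 \<le> p k x" unfolding p_def by (rule sum_nonneg) simp
    have "p k x \<le> word_mass k x"
      unfolding p_def word_mass_def Pv_def by (intro sum_mono power_mono norm_oproj_le[OF closed_Hv]) simp
    also have "\<dots> \<le> (norm x)\<^sup>2" by (rule word_mass_le)
    finally show "p k x \<le> (norm x)\<^sup>2" .
  qed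
  moreover have "(\<lambda>k. p k (Tw \<beta> d)) \<longlonglongrightarrow> 0" if d: "d \<in> defect_space T" for \<beta> d
  proof -
    have "p k (Tw \<beta> d) = 0" if "k > length \<beta>" for k
      unfolding p_def using that d by (auto intro!: sum.neutral simp: Pv_ker adj_Tw_Tw_defect_space[OF z])
    then have "\<forall>\<^sub>F k in sequentially. p k (Tw \<beta> d) = 0"
      using eventually_gt_at_top[of "length \<beta>"] by (rule eventually_mono[rotated])
    then show ?thesis by (rule tendsto_eventually)
  qed
  ultimately have "Hv \<subseteq> {h. (\<lambda>k. p k h) \<longlonglongrightarrow> 0}"
    unfolding H_v_def by (intro closure_cspan_minimal) auto
  moreover have "adj (word_op Hv Vc \<alpha>) h = Pv (adj (Tw \<alpha>) h)" for \<alpha> h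
    by (simp add: word_op_Vc adj_compose)
  ultimately show ?thesis by (auto simp: pure_on_def p_def)
qed

lemma canonical_rep_iff:
  "(\<exists>V W. upper_triangular_rep Hv Hc T V W \<and>
      row_contraction_on Hv V \<and> pure_on Hv V \<and> isometry_on Hv V \<and>
      row_contraction_on Hc W \<and> coisometry_on Hc W) \<longleftrightarrow>
    (\<forall>\<alpha>. \<alpha> \<noteq> [] \<longrightarrow> char_coeff \<alpha> = 0)"
proof
  assume "\<exists>V W. upper_triangular_rep Hv Hc T V W \<and>
      row_contraction_on Hv V \<and> pure_on Hv V \<and> isometry_on Hv V \<and>
      row_contraction_on Hc W \<and> coisometry_on Hc W"
  then have "isometry_on Hv Vc" using canonical_rep_unique(1) by blast
  then show "\<forall>\<alpha>. \<alpha> \<noteq> [] \<longrightarrow> char_coeff \<alpha> = 0"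
    unfolding char_coeff_zero_iff_defect_star_Hv isometry_Vc_iff .
next
  assume z: "\<forall>\<alpha>. \<alpha> \<noteq> [] \<longrightarrow> char_coeff \<alpha> = 0"
  then have "isometry_on Hv Vc"
    unfolding char_coeff_zero_iff_defect_star_Hv isometry_Vc_iff .
  moreover have "pure_on Hv Vc"
    by (rule pure_Vc) (use z in \<open>auto simp: char_coeff_zero_iff_defect_star_Hv\<close>)
  ultimately show "\<exists>V W. upper_triangular_rep Hv Hc T V W \<and>
      row_contraction_on Hv V \<and> pure_on Hv V \<and> isometry_on Hv V \<and>
      row_contraction_on Hc W \<and> coisometry_on Hc W"
    using canonical_rep row_contraction_Vc row_contraction_Wc coisometry_Wc by blast
qed

text \<open>For \<open>x\<close> in a subspace on which \<open>W\<close> is unitary, \<open>\<parallel>W\<^sub>i x\<parallel> = \<parallel>x\<parallel> \<ge> \<parallel>T\<^sub>i x\<parallel>\<close>, and \<open>W\<^sub>i x\<close> is the component of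
  \<open>T\<^sub>i x\<close> in \<open>\<H>\<^sub>c\<close>. So the other component is \<open>0\<close>.\<close>

lemma cnu_Wc:
  assumes cnu: "cnu_on UNIV T"
  shows "cnu_on Hc Wc"
  unfolding cnu_on_def
proof
  assume "\<exists>L. L \<subseteq> Hc \<and> L \<noteq> {0} \<and> reducing Wc L \<and> unitary_between (row_op Wc) {x. \<forall>i. x $ i \<in> L} L"
  then obtain L where L: "L \<subseteq> Hc" "L \<noteq> {0}" and red: "reducing Wc L"
    and uni: "unitary_between (row_op Wc) {x. \<forall>i. x $ i \<in> L} L" by blast
  have cL: "closed_csubspace L" using red by (simp add: reducing_def)
  have TW: "T i x = Wc i x" if x: "x \<in> L" for i x
  proof -
    have ax: "axis i x \<in> {x. \<forall>i. x $ i \<in> L}"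
      using x closed_csubspaceD(1)[OF cL] by (simp add: axis_component)
    have "cinner (Wc i x) (Wc i x) = cinner (axis i x) (axis i x)"
      using uni ax by (simp add: unitary_between_def row_op_axis[symmetric])
    also have "\<dots> = cinner x x" by (simp add: cinner_axis_right axis_component)
    finally have nW: "(norm (Wc i x))\<^sup>2 = (norm x)\<^sup>2" by (simp add: norm_square_cinner)
    have xc: "x \<in> Hc" using x L(1) by blast
    have W: "Wc i x = Pc (T i x)" by (simp add: Wc_def Pc_fix[OF xc])
    have "norm (T i x) \<le> norm rowT * norm (axis i x)"
      using norm_blinfun[of rowT "axis i x"] by (simp add: row_op_axis)
    also have "\<dots> \<le> 1 * norm (axis i x)" by (intro mult_right_mono norm_row) simp
    also have "norm (axis i x) = norm x"
      by (simp add: norm_eq_sqrt_inner inner_eq_Re_cinner cinner_axis_right axis_component)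
    finally have "(norm (T i x))\<^sup>2 \<le> (norm x)\<^sup>2" by (simp add: power_mono)
    moreover have "(norm (T i x))\<^sup>2 = (norm (Pv (T i x)))\<^sup>2 + (norm (Pc (T i x)))\<^sup>2"
      using norm_add_square[of "Pv (T i x)" "Pc (T i x)"] by (simp add: Pv_Pc cinner_Hv_Hc)
    ultimately have "(norm (Pv (T i x)))\<^sup>2 \<le> 0" using nW W by simp
    then have "Pv (T i x) = 0" by simp
    then show ?thesis using Pv_Pc[of "T i x"] W by simp
  qed
  have adjTW: "adj (T i) x = adj (Wc i) x" if "x \<in> L" for i x
    using that L(1) by (simp add: adj_Wc Pc_fix subset_iff)
  have "reducing T L" using red by (simp add: reducing_def TW adjTW)
  moreover have rowTW: "row_op T x = row_op Wc x" if "x \<in> {x. \<forall>i. x $ i \<in> L}" for x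
    using that by (simp add: row_op_apply TW)
  then have "unitary_between (row_op T) {x. \<forall>i. x $ i \<in> L} L"
    using uni bij_betw_cong[of "{x. \<forall>i. x $ i \<in> L}" "row_op T" "row_op Wc" L]
    by (simp add: unitary_between_def)
  ultimately show False using cnu L(2) unfolding cnu_on_def by blast
qed

end

theorem theorem2p7:
  fixes T :: "'n::finite \<Rightarrow> 'h::complex_hilbert \<Rightarrow>\<^sub>L 'h"
  assumes "row_contraction T"
  shows "(charfun_constant TYPE('s::infinite) T \<longleftrightarrow> Gamma_map TYPE('s) T \<in> UNIV \<times> {0} \<times> UNIV) \<and>
    (Gamma_map TYPE('s) T \<in> UNIV \<times> {0} \<times> UNIV \<longleftrightarrow>
      (\<exists>V W. upper_triangular_rep (H_v T) (H_c T) T V W \<and>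
        row_contraction_on (H_v T) V \<and> pure_on (H_v T) V \<and> isometry_on (H_v T) V \<and>
        row_contraction_on (H_c T) W \<and> coisometry_on (H_c T) W)) \<and>
    (cnu_on UNIV T \<longrightarrow>
      (charfun_constant TYPE('s) T \<longleftrightarrow>
        (\<exists>V W. upper_triangular_rep (H_v T) (H_c T) T V W \<and>
          row_contraction_on (H_v T) V \<and> pure_on (H_v T) V \<and> isometry_on (H_v T) V \<and>
          row_contraction_on (H_c T) W \<and> coisometry_on (H_c T) W \<and> cnu_on (H_c T) W)))"
proof -
  interpret row_contraction_tuple T by unfold_locales (rule assms)
  have cnu: "cnu_on (H_c T) W" if "cnu_on UNIV T" "upper_triangular_rep (H_v T) (H_c T) T V W" for V W
    using cnu_Wc[OF that(1)] canonical_rep_unique(2)[OF that(2)] by simp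
  show ?thesis
    unfolding charfun_constant_iff Gamma_map_iff canonical_rep_iff[symmetric] using cnu by blast
qed

end
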